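(* Let $F=\alpha e^{\beta/\alpha}+\gamma$ be an $(\alpha,\beta,\gamma)$-metric on a manifold $M$, where $\alpha$ is a Riemannian metric and $\beta,\gamma$ are 1-forms with $\|\beta\|_\alpha<b_0$ and $\|\gamma\|_\alpha<g_0$. Then $F$ is a Douglas metric if and only if $\beta$ is parallel with respect to $\alpha$ and $\gamma$ is closed.
   Context: Finsler metric: a function $F:TM\to[0,\infty)$, $C^\infty$ on $TM\setminus\{0\}$, positively 1-homogeneous in $y$, with $g_{ij}=\frac12[F^2]_{y^iy^j}$ positive definite for $y\ne0$. Here $\alpha=\sqrt{a_{ij}(x)y^iy^j}$, $\beta=b_i(x)y^i$, $\gamma=\gamma_i(x)y^i$, and $F=\alpha\Psi(s,\bar s)$ with $s=\beta/\alpha$, $\bar s=\gamma/\alpha$, $\Psi(s,\bar s)=e^s+\bar s$. With $b=\|\beta\|_\alpha$, $g=\|\gamma\|_\alpha$, the numbers $b_0,g_0>0$ are the largest numbers such that $(1-s)e^s>0$ and $(1-s+b^2-s^2)e^s>0$ for $|s|<b<b_0$, $|\bar s|<g<g_0$, so that $F$ is a Finsler metric. The spray coefficients of $F$ are $G^i=\frac14 g^{il}\{\partial_{x^k}g_{jl}+\partial_{x^j}g_{lk}-\partial_{x^l}g_{jk}\}y^jy^k$. The Douglas tensor is $D^i_{j\,kl}=\frac{\partial^3}{\partial y^j\partial y^k\partial y^l}\big(G^i-\frac1{n+1}\frac{\partial G^m}{\partial y^m}y^i\big)$, $n=\dim M$; $F$ is a Douglas metric ($(M,F)$ is a Douglas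 space) if this tensor vanishes, equivalently if $G^iy^j-G^jy^i$ is, for all $i,j$, a homogeneous polynomial of degree three in $y$ in local coordinates. $\beta$ is parallel with respect to $\alpha$ if $b_{i|j}=0$, where $|$ is the Levi-Civita covariant derivative of $\alpha$; $\gamma$ is closed if $d\gamma=0$.
   Formalization: The manifold M is assumed to have dimension at least 2; in dimension 1 the Douglas tensor of every Finsler metric vanishes, so F is Douglas even when β is not parallel and the claim fails. *)

theory Defs
  imports "HOL-Analysis.Analysis"
begin

section \<open>Smooth functions and partial derivatives\<close>

definition ddir :: "'a::euclidean_space \<Rightarrow> ('a \<Rightarrow> real) \<Rightarrow> 'a \<Rightarrow> real" where
  "ddir e f x = deriv (\<lambda>t. f (x + t *\<^sub>R e)) 0"

abbreviation partial :: "'n::finite \<Rightarrow> (real^'n \<Rightarrow> real) \<Rightarrow> real^'n \<Rightarrow> real" where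
  "partial i \<equiv> ddir (axis i 1)"

text \<open>The set \<open>U\<close> is open wherever this is used.\<close>

primrec Ck_on :: "nat \<Rightarrow> 'a::euclidean_space set \<Rightarrow> ('a \<Rightarrow> real) \<Rightarrow> bool" where
  "Ck_on 0 U f \<longleftrightarrow> continuous_on U f"
| "Ck_on (Suc k) U f \<longleftrightarrow> f differentiable_on U \<and> (\<forall>e\<in>Basis. Ck_on k U (ddir e f))"

definition smooth_on :: "'a::euclidean_space set \<Rightarrow> ('a \<Rightarrow> real) \<Rightarrow> bool" where
  "smooth_on U f \<longleftrightarrow> (\<forall>k. Ck_on k U f)"


section \<open>Smooth manifolds and tensor fields in local coordinates\<close>

type_synonym ('m, 'n) chart = "'m set \<times> ('m \<Rightarrow> real^'n)"

definition cimage :: "('m, 'n::finite) chart \<Rightarrow> (real^'n) set" where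
  "cimage c = snd c ` fst c"

definition overlap :: "('m, 'n::finite) chart \<Rightarrow> ('m, 'n) chart \<Rightarrow> (real^'n) set" where
  "overlap c d = snd c ` (fst c \<inter> fst d)"

definition transition :: "('m, 'n::finite) chart \<Rightarrow> ('m, 'n) chart \<Rightarrow> real^'n \<Rightarrow> real^'n" where
  "transition c d x = snd d (inv_into (fst c) (snd c) x)"

definition smooth_atlas :: "('m::topological_space, 'n::finite) chart set \<Rightarrow> bool" where
  "smooth_atlas A \<longleftrightarrow>
     (\<forall>c\<in>A. open (fst c) \<and> open (cimage c) \<and>
        homeomorphism (fst c) (cimage c) (snd c) (inv_into (fst c) (snd c))) \<and>
     (\<Union>c\<in>A. fst c) = UNIV \<and>
     (\<forall>c\<in>A. \<forall>d\<in>A. \<forall>i. smooth_on (overlap c d) (\<lambda>x. transition c d x $ i))"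

definition jacobian :: "('m, 'n::finite) chart \<Rightarrow> ('m, 'n) chart \<Rightarrow> real^'n \<Rightarrow> real^'n^'n" where
  "jacobian c d x = (\<chi> i j. partial j (\<lambda>x. transition c d x $ i) x)"

text \<open>
  Tensor fields on the manifold, and functions on its tangent bundle, are given classically: as
  families of local expressions, one for each chart of the atlas, that satisfy the
  transformation law on overlaps.  Local expressions are only meaningful for \<open>x \<in> cimage c\<close>.
\<close>

definition riemannian_metric ::
    "('m, 'n::finite) chart set \<Rightarrow> (('m, 'n) chart \<Rightarrow> real^'n \<Rightarrow> real^'n^'n) \<Rightarrow> bool" where
  "riemannian_metric A a \<longleftrightarrow>
     (\<forall>c\<in>A. (\<forall>i j. smooth_on (cimage c) (\<lambda>x. a c x $ i $ j)) \<and>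
        (\<forall>x\<in>cimage c. transpose (a c x) = a c x \<and> (\<forall>v. v \<noteq> 0 \<longrightarrow> v \<bullet> (a c x *v v) > 0))) \<and>
     (\<forall>c\<in>A. \<forall>d\<in>A. \<forall>x\<in>overlap c d.
        a c x = transpose (jacobian c d x) ** a d (transition c d x) ** jacobian c d x)"

definition one_form ::
    "('m, 'n::finite) chart set \<Rightarrow> (('m, 'n) chart \<Rightarrow> real^'n \<Rightarrow> real^'n) \<Rightarrow> bool" where
  "one_form A b \<longleftrightarrow>
     (\<forall>c\<in>A. \<forall>i. smooth_on (cimage c) (\<lambda>x. b c x $ i)) \<and>
     (\<forall>c\<in>A. \<forall>d\<in>A. \<forall>x\<in>overlap c d.
        b c x = transpose (jacobian c d x) *v b d (transition c d x))"

definition tangent_bundle_function ::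
    "('m, 'n::finite) chart set \<Rightarrow> (('m, 'n) chart \<Rightarrow> real^'n \<Rightarrow> real^'n \<Rightarrow> real) \<Rightarrow> bool" where
  "tangent_bundle_function A F \<longleftrightarrow>
     (\<forall>c\<in>A. \<forall>d\<in>A. \<forall>x\<in>overlap c d. \<forall>y. F c x y = F d (transition c d x) (jacobian c d x *v y))"

definition covector_norm :: "real^'n^'n \<Rightarrow> real^'n \<Rightarrow> real" where
  "covector_norm a b = sqrt (\<Sum>i\<in>UNIV. \<Sum>j\<in>UNIV. matrix_inv a $ i $ j * b $ i * b $ j)"

definition christoffel ::
    "(real^'n \<Rightarrow> real^'n^'n) \<Rightarrow> real^'n \<Rightarrow> 'n \<Rightarrow> 'n \<Rightarrow> 'n::finite \<Rightarrow> real" where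
  "christoffel a x k i j = 1/2 * (\<Sum>l\<in>UNIV. matrix_inv (a x) $ k $ l *
     (partial i (\<lambda>x. a x $ j $ l) x + partial j (\<lambda>x. a x $ i $ l) x - partial l (\<lambda>x. a x $ i $ j) x))"

definition covariant_deriv ::
    "(real^'n \<Rightarrow> real^'n^'n) \<Rightarrow> (real^'n \<Rightarrow> real^'n) \<Rightarrow> real^'n \<Rightarrow> 'n \<Rightarrow> 'n::finite \<Rightarrow> real" where
  "covariant_deriv a b x i j =
     partial j (\<lambda>x. b x $ i) x - (\<Sum>k\<in>UNIV. christoffel a x k i j * b x $ k)"

definition parallel_form ::
    "('m, 'n::finite) chart set \<Rightarrow> (('m, 'n) chart \<Rightarrow> real^'n \<Rightarrow> real^'n^'n) \<Rightarrow>
     (('m, 'n) chart \<Rightarrow> real^'n \<Rightarrow> real^'n) \<Rightarrow> bool" where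
  "parallel_form A a b \<longleftrightarrow> (\<forall>c\<in>A. \<forall>x\<in>cimage c. \<forall>i j. covariant_deriv (a c) (b c) x i j = 0)"

definition closed_form ::
    "('m, 'n::finite) chart set \<Rightarrow> (('m, 'n) chart \<Rightarrow> real^'n \<Rightarrow> real^'n) \<Rightarrow> bool" where
  "closed_form A b \<longleftrightarrow>
     (\<forall>c\<in>A. \<forall>x\<in>cimage c. \<forall>i j. partial i (\<lambda>x. b c x $ j) x - partial j (\<lambda>x. b c x $ i) x = 0)"


section \<open>Finsler and Douglas metrics\<close>

definition fundamental_tensor ::
    "(real^'n \<Rightarrow> real^'n \<Rightarrow> real) \<Rightarrow> real^'n \<Rightarrow> real^'n \<Rightarrow> real^'n^'n::finite" where
  "fundamental_tensor F x y = (\<chi> i j. 1/2 * partial j (partial i (\<lambda>y. (F x y)\<^sup>2)) y)"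

definition finsler_metric ::
    "('m, 'n::finite) chart set \<Rightarrow> (('m, 'n) chart \<Rightarrow> real^'n \<Rightarrow> real^'n \<Rightarrow> real) \<Rightarrow> bool" where
  "finsler_metric A F \<longleftrightarrow>
     tangent_bundle_function A F \<and>
     (\<forall>c\<in>A.
        (\<forall>x\<in>cimage c. \<forall>y. F c x y \<ge> 0) \<and>
        smooth_on (cimage c \<times> (UNIV - {0})) (\<lambda>(x, y). F c x y) \<and>
        (\<forall>x\<in>cimage c. \<forall>y. \<forall>t>0. F c x (t *\<^sub>R y) = t * F c x y) \<and>
        (\<forall>x\<in>cimage c. \<forall>y. y \<noteq> 0 \<longrightarrow>
           (\<forall>v. v \<noteq> 0 \<longrightarrow> v \<bullet> (fundamental_tensor (F c) x y *v v) > 0)))"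

definition spray_coeff ::
    "(real^'n \<Rightarrow> real^'n \<Rightarrow> real) \<Rightarrow> real^'n \<Rightarrow> real^'n \<Rightarrow> 'n::finite \<Rightarrow> real" where
  "spray_coeff F x y i = 1/4 * (\<Sum>l\<in>UNIV. \<Sum>j\<in>UNIV. \<Sum>k\<in>UNIV.
     matrix_inv (fundamental_tensor F x y) $ i $ l *
     (partial k (\<lambda>x. fundamental_tensor F x y $ j $ l) x +
      partial j (\<lambda>x. fundamental_tensor F x y $ l $ k) x -
      partial l (\<lambda>x. fundamental_tensor F x y $ j $ k) x) * y $ j * y $ k)"

text \<open>\<open>douglas_tensor F x y i j k l\<close> is the component with upper index \<open>i\<close> and lower indices
  \<open>j\<close>, \<open>k\<close>, \<open>l\<close>.\<close>

definition douglas_tensor ::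
    "(real^'n \<Rightarrow> real^'n \<Rightarrow> real) \<Rightarrow> real^'n \<Rightarrow> real^'n \<Rightarrow> 'n \<Rightarrow> 'n \<Rightarrow> 'n \<Rightarrow> 'n::finite \<Rightarrow> real" where
  "douglas_tensor F x y i j k l =
     partial j (partial k (partial l (\<lambda>y. spray_coeff F x y i -
       1 / (real CARD('n) + 1) * (\<Sum>m\<in>UNIV. partial m (\<lambda>y. spray_coeff F x y m) y) * y $ i))) y"

definition douglas_metric ::
    "('m, 'n::finite) chart set \<Rightarrow> (('m, 'n) chart \<Rightarrow> real^'n \<Rightarrow> real^'n \<Rightarrow> real) \<Rightarrow> bool" where
  "douglas_metric A F \<longleftrightarrow> finsler_metric A F \<and>
     (\<forall>c\<in>A. \<forall>x\<in>cimage c. \<forall>y. y \<noteq> 0 \<longrightarrow> (\<forall>i j k l. douglas_tensor (F c) x y i j k l = 0))"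


section \<open>The metric\<close>

definition riemannian_length :: "real^'n^'n \<Rightarrow> real^'n \<Rightarrow> real" where
  "riemannian_length a y = sqrt (\<Sum>i\<in>UNIV. \<Sum>j\<in>UNIV. a $ i $ j * y $ i * y $ j)"

definition form_value :: "real^'n \<Rightarrow> real^'n \<Rightarrow> real" where
  "form_value b y = (\<Sum>i\<in>UNIV. b $ i * y $ i)"

text \<open>At \<open>y = 0\<close> the quotient is \<open>0 / 0 = 0\<close>, so the value there is \<open>0\<close>, as it must be.\<close>

definition exp_abc_metric ::
    "(('m, 'n) chart \<Rightarrow> real^'n \<Rightarrow> real^'n^'n) \<Rightarrow> (('m, 'n) chart \<Rightarrow> real^'n \<Rightarrow> real^'n) \<Rightarrow>
     (('m, 'n) chart \<Rightarrow> real^'n \<Rightarrow> real^'n) \<Rightarrow> ('m, 'n::finite) chart \<Rightarrow> real^'n \<Rightarrow> real^'n \<Rightarrow> real" where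
  "exp_abc_metric a b \<gamma> c x y =
     (let \<alpha> = riemannian_length (a c x) y; \<beta> = form_value (b c x) y
      in \<alpha> * exp (\<beta> / \<alpha>) + form_value (\<gamma> c x) y)"

text \<open>
  The two inequalities on \<open>s\<close> alone do not bound \<open>g0\<close>.  The bound comes from the requirement that
  \<open>F\<close> be a Finsler metric, which adds positivity \<open>\<Psi> (s, s') = exp s + s' > 0\<close>.
  ``Largest'' is maximality of the pair \<open>(b0, g0)\<close>; the maximal pair with the largest possible
  \<open>b0\<close> is \<open>(1, exp (- 1))\<close>.
\<close>

definition admissible_bounds :: "real \<Rightarrow> real \<Rightarrow> bool" where
  "admissible_bounds b0 g0 \<longleftrightarrow> b0 > 0 \<and> g0 > 0 \<and>
     (\<forall>b g s s'. \<bar>s\<bar> < b \<and> b < b0 \<and> \<bar>s'\<bar> < g \<and> g < g0 \<longrightarrow>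
        exp s + s' > 0 \<and> (1 - s) * exp s > 0 \<and> (1 - s + b\<^sup>2 - s\<^sup>2) * exp s > 0)"

definition largest_bounds :: "real \<Rightarrow> real \<Rightarrow> bool" where
  "largest_bounds b0 g0 \<longleftrightarrow> admissible_bounds b0 g0 \<and>
     (\<forall>b1 g1. admissible_bounds b1 g1 \<and> b0 \<le> b1 \<and> g0 \<le> g1 \<longrightarrow> b1 = b0 \<and> g1 = g0)"

end

theory Submission
  imports Defs
begin

text \<open>
  Write \<open>\<alpha>\<close>, \<open>\<beta>\<close>, \<open>s = \<beta> / \<alpha>\<close> for the given data.  In a chart the spray of \<open>F\<close> is
  \<open>G = G\<^sub>\<alpha> + W + P y\<close>, where \<open>G\<^sub>\<alpha>\<close> is the (quadratic) spray of \<open>\<alpha>\<close>, \<open>P\<close> is a scalar, and \<open>W\<close> is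
  \<open>\<alpha>\<close>-orthogonal to \<open>y\<close> and linear in the covariant derivative of \<open>\<beta>\<close>, \<open>d\<beta>\<close> and \<open>d\<gamma>\<close>.  If \<open>\<beta>\<close> is
  parallel and \<open>\<gamma>\<close> is closed, then \<open>W = 0\<close>, so \<open>F\<close> is projectively equivalent to \<open>\<alpha>\<close>.

  Conversely, a vanishing Douglas tensor makes \<open>G - (div G) y / (n + 1)\<close> quadratic on every line that
  misses the origin; being 2-homogeneous it is therefore even in \<open>y\<close>, and hence so is \<open>W\<close>.
  Since \<open>\<alpha>\<close> is even and \<open>s\<close> is odd, comparing \<open>W\<close> at \<open>y\<close> and \<open>- y\<close> separates
  the terms carrying \<open>cosh s\<close> and \<open>sinh s\<close> from the polynomial ones.  Where \<open>\<beta> \<noteq> 0\<close> this forces all of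
  them to vanish; the points with \<open>\<beta> = 0\<close> are reached by continuity, or because \<open>\<beta>\<close> vanishes nearby.
\<close>

section \<open>Calculus of smooth functions\<close>

text \<open>The fundamental tensor of F is never inverted explicitly. The spray is characterised by
  a linear equation, and since \<gamma> is linear in y it drops out of the Hessian of F, which on
  vectors orthogonal to y is a multiple of the identity plus a rank-one term. Inverting this
  produces the denominators 1 - s and 1 - s + b^2 - s^2, the two factors that appear in
  \<open>admissible_bounds\<close>. These denominators and the exponential make W awkward to compare
  with a polynomial. Evenness in y is a weaker condition, but it can be imposed on the cleared
  equation, where W stays an unknown vector to be eliminated between y and -y. At a point where
  \<beta> = 0 evenness is too weak: there s = 0, and it yields only S + K = 0 for the skew parts S
  and K of the derivatives of \<beta> and \<gamma>. Hence \<beta> is shown to be parallel everywhere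
  before \<gamma> is shown to be closed at such points.\<close>

lemma ddirI:
  assumes "((\<lambda>t. f (x + t *\<^sub>R e)) has_real_derivative D) (at 0)"
  shows "ddir e f x = D"
  using assms unfolding ddir_def by (rule DERIV_imp_deriv)

lemma eventually_line_in_open:
  fixes x e :: "'a::real_normed_vector"
  assumes "open U" "x \<in> U"
  shows "\<forall>\<^sub>F t in nhds (0::real). x + t *\<^sub>R e \<in> U"
proof -
  have "((\<lambda>t::real. x + t *\<^sub>R e) \<longlongrightarrow> x + 0 *\<^sub>R e) (nhds 0)"
    by (intro tendsto_intros filterlim_ident)
  then show ?thesis
    using assms by (auto dest: topological_tendstoD)
qed

lemma ddir_cong:
  assumes "open U" "x \<in> U" "\<And>z. z \<in> U \<Longrightarrow> f z = g z"
  shows "ddir e f x = ddir e g x"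
proof -
  have "\<forall>\<^sub>F t in nhds (0::real). f (x + t *\<^sub>R e) = g (x + t *\<^sub>R e)"
    using eventually_line_in_open[OF assms(1,2)] by eventually_elim (rule assms(3))
  then show ?thesis
    unfolding ddir_def by (rule deriv_cong_ev) simp
qed

lemma has_ddir_frechet:
  fixes f :: "'a::euclidean_space \<Rightarrow> real"
  assumes "(f has_derivative f') (at x)"
  shows "((\<lambda>t. f (x + t *\<^sub>R e)) has_real_derivative f' e) (at 0)"
proof -
  have 1: "((\<lambda>t::real. x + t *\<^sub>R e) has_derivative (\<lambda>t. t *\<^sub>R e)) (at 0)"
    by (auto intro!: derivative_eq_intros)
  have "((\<lambda>t. f (x + t *\<^sub>R e)) has_derivative (\<lambda>t. f' (t *\<^sub>R e))) (at 0)"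
    using has_derivative_compose[OF 1] assms by simp
  moreover have "(\<lambda>t. f' (t *\<^sub>R e)) = (*) (f' e)"
    using linear_scale[OF has_derivative_linear[OF assms]] by (auto simp: fun_eq_iff)
  ultimately show ?thesis
    by (simp add: has_field_derivative_def)
qed

lemma ddir_frechet:
  assumes "(f has_derivative f') (at x)"
  shows "ddir e f x = f' e"
  by (rule ddirI[OF has_ddir_frechet[OF assms]])

lemma has_ddir:
  assumes "f differentiable (at x)"
  shows "((\<lambda>t. f (x + t *\<^sub>R e)) has_real_derivative ddir e f x) (at 0)"
  using assms has_ddir_frechet ddir_frechet unfolding differentiable_def by metis

lemma linear_ddir:
  assumes "f differentiable (at x)"
  shows "linear (\<lambda>e. ddir e f x)"
proof -
  obtain f' where f': "(f has_derivative f') (at x)"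
    using assms by (auto simp: differentiable_def)
  have "(\<lambda>e. ddir e f x) = f'"
    using ddir_frechet[OF f'] by auto
  then show ?thesis
    using has_derivative_linear[OF f'] by simp
qed

lemma ddir_eq_sum_partial:
  fixes f :: "real^'n::finite \<Rightarrow> real"
  assumes "f differentiable (at x)"
  shows "ddir e f x = (\<Sum>i\<in>UNIV. e $ i * partial i f x)"
proof -
  interpret linear "\<lambda>e. ddir e f x"
    by (rule linear_ddir[OF assms])
  have "(\<Sum>i\<in>UNIV. e $ i *\<^sub>R axis i 1) = e"
    using basis_expansion[of e] by (simp add: scalar_mult_eq_scaleR)
  then have "ddir e f x = ddir (\<Sum>i\<in>UNIV. e $ i *\<^sub>R axis i 1) f x"
    by (simp only:)
  also have "\<dots> = (\<Sum>i\<in>UNIV. e $ i * partial i f x)"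
    unfolding sum by (simp add: scale)
  finally show ?thesis .
qed

section \<open>Closure properties of the classes C^k on an open set\<close>

lemma differentiable_on_open_at:
  "open U \<Longrightarrow> f differentiable_on U \<Longrightarrow> x \<in> U \<Longrightarrow> f differentiable (at x)"
  by (simp add: differentiable_on_eq_differentiable_at)

text \<open>The formulas for \<open>ddir\<close> of a sum, product or composite hold only at points
  of \<open>U\<close>; this lemma lets them stand in for \<open>ddir\<close> in the recursion of
  \<open>Ck_on\<close>.\<close>

lemma Ck_on_cong:
  assumes "open U" "\<And>x. x \<in> U \<Longrightarrow> f x = g x" "Ck_on k U f"
  shows "Ck_on k U g"
  using assms(2,3)
proof (induction k arbitrary: f g)
  case 0
  then show ?case using continuous_on_cong[of U U f g] by simp
next
  case (Suc k)
  have "g differentiable_on U"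
    unfolding differentiable_on_def
  proof
    fix x assume x: "x \<in> U"
    have "f differentiable (at x within U)"
      using Suc.prems(2) x by (simp add: differentiable_on_def)
    then show "g differentiable (at x within U)"
      by (rule differentiable_transform_within[of _ _ _ 1]) (use x Suc.prems(1) in auto)
  qed
  moreover have "Ck_on k U (ddir e g)" if "e \<in> Basis" for e
  proof (rule Suc.IH)
    show "ddir e f x = ddir e g x" if "x \<in> U" for x
      by (rule ddir_cong[OF assms(1) that Suc.prems(1)])
    show "Ck_on k U (ddir e f)"
      using Suc.prems(2) \<open>e \<in> Basis\<close> by simp
  qed
  ultimately show ?case by simp
qed

lemma Ck_on_Suc: "Ck_on (Suc k) U f \<Longrightarrow> Ck_on k U f"
proof (induction k arbitrary: f)
  case 0
  then show ?case by (auto simp: differentiable_imp_continuous_on)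
next
  case (Suc k)
  have "Ck_on k U (ddir e f)" if "e \<in> Basis" for e
    using Suc.prems that Ck_on.simps(2)[of "Suc k" U f] by (intro Suc.IH) blast
  then show ?case
    using Suc.prems by simp
qed

lemma Ck_on_const: "Ck_on k U (\<lambda>_. c)"
proof (induction k arbitrary: c)
  case (Suc k)
  have "ddir e (\<lambda>_::'a. c) = (\<lambda>_. 0)" for e
    by (auto simp: ddir_def)
  then show ?case using Suc by simp
qed simp

lemma Ck_on_linear:
  assumes "bounded_linear L"
  shows "Ck_on k U L"
proof (cases k)
  case 0
  then show ?thesis using assms by (simp add: linear_continuous_on)
next
  case (Suc m)
  have "ddir e L = (\<lambda>_. L e)" for e
    using ddir_frechet[OF bounded_linear_imp_has_derivative[OF assms]] by auto
  then show ?thesis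
    using assms Suc by (auto simp: Ck_on_const differentiable_on_def bounded_linear_imp_differentiable)
qed

lemma Ck_on_add:
  assumes "open U" "Ck_on k U f" "Ck_on k U g"
  shows "Ck_on k U (\<lambda>x. f x + g x)"
  using assms(2,3)
proof (induction k arbitrary: f g)
  case 0
  then show ?case by (simp add: continuous_on_add)
next
  case (Suc k)
  have "Ck_on k U (ddir e (\<lambda>x. f x + g x))" if "e \<in> Basis" for e
  proof (rule Ck_on_cong[OF assms(1)])
    show "Ck_on k U (\<lambda>x. ddir e f x + ddir e g x)"
      using Suc that by auto
    show "ddir e f x + ddir e g x = ddir e (\<lambda>x. f x + g x) x" if "x \<in> U" for x
      using Suc.prems DERIV_add[OF has_ddir[of f x e] has_ddir[of g x e]]
      by (intro ddirI[symmetric]) (auto intro: differentiable_on_open_at[OF assms(1) _ that])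
  qed
  then show ?case using Suc.prems by simp
qed

lemma Ck_on_mult:
  assumes "open U" "Ck_on k U f" "Ck_on k U g"
  shows "Ck_on k U (\<lambda>x. f x * g x)"
  using assms(2,3)
proof (induction k arbitrary: f g)
  case 0
  then show ?case by (simp add: continuous_on_mult)
next
  case (Suc k)
  have "Ck_on k U (ddir e (\<lambda>x. f x * g x))" if e: "e \<in> Basis" for e
  proof (rule Ck_on_cong[OF assms(1)])
    have "Ck_on k U f" "Ck_on k U g"
      by (rule Suc.prems[THEN Ck_on_Suc])+
    then show "Ck_on k U (\<lambda>x. ddir e f x * g x + ddir e g x * f x)"
      using Suc.prems e by (intro Ck_on_add[OF assms(1)] Suc.IH) auto
    show "ddir e f x * g x + ddir e g x * f x = ddir e (\<lambda>x. f x * g x) x" if x: "x \<in> U" for x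
    proof -
      have "((\<lambda>t. f (x + t *\<^sub>R e) * g (x + t *\<^sub>R e)) has_real_derivative
          ddir e f x * g (x + 0 *\<^sub>R e) + ddir e g x * f (x + 0 *\<^sub>R e)) (at 0)"
        using Suc.prems DERIV_mult[OF has_ddir[of f x e] has_ddir[of g x e]]
        by (auto intro: differentiable_on_open_at[OF assms(1) _ x])
      from ddirI[OF this] show ?thesis by simp
    qed
  qed
  then show ?case using Suc.prems by simp
qed

text \<open>The derivative contains the function itself, so the step to order k + 1 uses the
  statement at order k for the same \<open>f\<close>; likewise for \<open>inverse\<close> and
  \<open>sqrt\<close>.\<close>

lemma Ck_on_exp:
  assumes "open U" "Ck_on k U f"
  shows "Ck_on k U (\<lambda>x. exp (f x))"
  using assms(2)
proof (induction k arbitrary: f)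
  case 0
  then show ?case using continuous_on_exp[of U f] by simp
next
  case (Suc k)
  have d: "f differentiable (at x)" if "x \<in> U" for x
    by (rule differentiable_on_open_at[OF assms(1) _ that]) (use Suc.prems in simp)
  have "Ck_on k U (ddir e (\<lambda>x. exp (f x)))" if e: "e \<in> Basis" for e
  proof (rule Ck_on_cong[OF assms(1)])
    have "Ck_on k U f"
      by (rule Suc.prems(1)[THEN Ck_on_Suc])
    then show "Ck_on k U (\<lambda>x. exp (f x) * ddir e f x)"
      using Suc.prems e by (intro Ck_on_mult[OF assms(1)] Suc.IH) auto
    show "exp (f x) * ddir e f x = ddir e (\<lambda>x. exp (f x)) x" if x: "x \<in> U" for x
      using ddirI[OF DERIV_fun_exp[OF has_ddir[OF d[OF x], of e]]] by simp
  qed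
  moreover have "(\<lambda>x. exp (f x)) differentiable_on U"
    unfolding differentiable_on_eq_differentiable_at[OF assms(1)]
  proof
    fix x assume "x \<in> U"
    then obtain f' where "(f has_derivative f') (at x)"
      using d by (auto simp: differentiable_def)
    from has_derivative_exp[OF this] show "(\<lambda>x. exp (f x)) differentiable (at x)"
      by (auto simp: differentiable_def)
  qed
  ultimately show ?case by simp
qed

lemma Ck_on_inverse:
  assumes "open U" "Ck_on k U f" "\<And>x. x \<in> U \<Longrightarrow> f x \<noteq> 0"
  shows "Ck_on k U (\<lambda>x. inverse (f x))"
  using assms(2,3)
proof (induction k arbitrary: f)
  case 0
  then show ?case using continuous_on_inverse[of U f] by simp
next
  case (Suc k)
  have d: "f differentiable (at x)" if "x \<in> U" for x
    by (rule differentiable_on_open_at[OF assms(1) _ that]) (use Suc.prems in simp)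
  have "Ck_on k U (ddir e (\<lambda>x. inverse (f x)))" if e: "e \<in> Basis" for e
  proof (rule Ck_on_cong[OF assms(1)])
    have "Ck_on k U f"
      by (rule Suc.prems(1)[THEN Ck_on_Suc])
    then show "Ck_on k U (\<lambda>x. (-1) * (ddir e f x * (inverse (f x) * inverse (f x))))"
      using Suc.prems e by (intro Ck_on_mult[OF assms(1)] Suc.IH Ck_on_const) auto
    show "(-1) * (ddir e f x * (inverse (f x) * inverse (f x))) = ddir e (\<lambda>x. inverse (f x)) x" if x: "x \<in> U" for x
      using ddirI[OF DERIV_inverse_fun[OF has_ddir[OF d[OF x], of e]]] Suc.prems(2)[OF x]
      by (simp add: power2_eq_square)
  qed
  moreover have "(\<lambda>x. inverse (f x)) differentiable_on U"
    using Suc.prems d by (auto intro!: differentiable_inverse simp: differentiable_on_eq_differentiable_at[OF assms(1)])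
  ultimately show ?case by simp
qed

lemma Ck_on_sqrt:
  assumes "open U" "Ck_on k U f" "\<And>x. x \<in> U \<Longrightarrow> f x > 0"
  shows "Ck_on k U (\<lambda>x. sqrt (f x))"
  using assms(2,3)
proof (induction k arbitrary: f)
  case 0
  then show ?case using continuous_on_real_sqrt[of U f] by simp
next
  case (Suc k)
  have d: "f differentiable (at x)" if "x \<in> U" for x
    by (rule differentiable_on_open_at[OF assms(1) _ that]) (use Suc.prems in simp)
  have "Ck_on k U (ddir e (\<lambda>x. sqrt (f x)))" if e: "e \<in> Basis" for e
  proof (rule Ck_on_cong[OF assms(1)])
    have "Ck_on k U (\<lambda>x. sqrt (f x))"
      by (rule Suc.IH[OF Suc.prems(1)[THEN Ck_on_Suc] Suc.prems(2)])
    then have "Ck_on k U (\<lambda>x. inverse (sqrt (f x)))"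
      using Suc.prems by (intro Ck_on_inverse[OF assms(1)]) (auto simp: less_imp_neq dest: Suc.prems(2))
    then show "Ck_on k U (\<lambda>x. inverse (sqrt (f x)) * ((1/2) * ddir e f x))"
      using Suc.prems e by (intro Ck_on_mult[OF assms(1)] Ck_on_const) auto
    show "inverse (sqrt (f x)) * ((1/2) * ddir e f x) = ddir e (\<lambda>x. sqrt (f x)) x" if x: "x \<in> U" for x
    proof -
      have "((\<lambda>t. sqrt (f (x + t *\<^sub>R e))) has_real_derivative
         (inverse (sqrt (f (x + 0 *\<^sub>R e))) / 2) * ddir e f x) (at 0)"
        using Suc.prems(2)[OF x] by (intro DERIV_chain2[OF DERIV_real_sqrt has_ddir[OF d[OF x]]]) simp
      from ddirI[OF this] show ?thesis by simp
    qed
  qed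
  moreover have "(\<lambda>x. sqrt (f x)) differentiable_on U"
    unfolding differentiable_on_eq_differentiable_at[OF assms(1)]
  proof
    fix x assume x: "x \<in> U"
    then obtain f' where "(f has_derivative f') (at x)"
      using d by (auto simp: differentiable_def)
    from has_derivative_real_sqrt[OF _ this] show "(\<lambda>x. sqrt (f x)) differentiable (at x)"
      using Suc.prems(2)[OF x] by (auto simp: differentiable_def)
  qed
  ultimately show ?case by simp
qed

lemma Ck_on_fst:
  assumes "open U" "open V" "Ck_on k U f"
  shows "Ck_on k (U \<times> V) (\<lambda>z. f (fst z))"
  using assms(3)
proof (induction k arbitrary: f)
  case 0
  then show ?case
    by (auto intro!: continuous_on_compose2[OF _ continuous_on_fst[OF continuous_on_id]])
next
  case (Suc k)
  have d: "f differentiable (at x)" if "x \<in> U" for x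
    by (rule differentiable_on_open_at[OF assms(1) _ that]) (use Suc.prems in simp)
  have "Ck_on k (U \<times> V) (ddir e (\<lambda>z. f (fst z)))" if e: "e \<in> Basis" for e
  proof -
    have *: "ddir e (\<lambda>z. f (fst z)) = (\<lambda>z. ddir (fst e) f (fst z))"
      by (auto simp: ddir_def)
    \<comment> \<open>A basis vector of the product points along one factor; along the second factor
      the function is constant.\<close>
    from e consider "fst e \<in> Basis" | "fst e = 0"
      by (auto simp: Basis_prod_def)
    then show ?thesis
    proof cases
      case 1
      then show ?thesis unfolding * using Suc by auto
    next
      case 2
      then have "ddir (fst e) f = (\<lambda>_. 0)"
        by (auto simp: ddir_def)
      then show ?thesis unfolding * by (simp add: Ck_on_const)
    qed
  qed
  moreover have "(\<lambda>z. f (fst z)) differentiable_on (U \<times> V)"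
    unfolding differentiable_on_eq_differentiable_at[OF open_Times[OF assms(1,2)]]
    by (intro ballI differentiable_chain_at[of fst _ f, unfolded o_def] d
          bounded_linear_imp_differentiable bounded_linear_fst) auto
  ultimately show ?case by simp
qed

section \<open>Closure properties of smooth functions\<close>

lemma smooth_on_cong:
  "open U \<Longrightarrow> (\<And>x. x \<in> U \<Longrightarrow> f x = g x) \<Longrightarrow> smooth_on U f \<Longrightarrow> smooth_on U g"
  unfolding smooth_on_def using Ck_on_cong by blast

lemma smooth_on_const: "smooth_on U (\<lambda>_. c)"
  by (simp add: smooth_on_def Ck_on_const)

lemma smooth_on_linear: "bounded_linear L \<Longrightarrow> smooth_on U L"
  by (simp add: smooth_on_def Ck_on_linear)

lemma smooth_on_add: "open U \<Longrightarrow> smooth_on U f \<Longrightarrow> smooth_on U g \<Longrightarrow> smooth_on U (\<lambda>x. f x + g x)"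
  by (simp add: smooth_on_def Ck_on_add)

lemma smooth_on_mult: "open U \<Longrightarrow> smooth_on U f \<Longrightarrow> smooth_on U g \<Longrightarrow> smooth_on U (\<lambda>x. f x * g x)"
  by (simp add: smooth_on_def Ck_on_mult)

lemma smooth_on_minus: "open U \<Longrightarrow> smooth_on U f \<Longrightarrow> smooth_on U (\<lambda>x. - f x)"
  using smooth_on_mult[OF _ smooth_on_const[of U "-1"], of f] by simp

lemma smooth_on_diff: "open U \<Longrightarrow> smooth_on U f \<Longrightarrow> smooth_on U g \<Longrightarrow> smooth_on U (\<lambda>x. f x - g x)"
  using smooth_on_add[OF _ _ smooth_on_minus[of U g], of f] by simp

lemma smooth_on_sum:
  "open U \<Longrightarrow> (\<And>i. i \<in> I \<Longrightarrow> smooth_on U (f i)) \<Longrightarrow> smooth_on U (\<lambda>x. \<Sum>i\<in>I. f i x)"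
  by (induction I rule: infinite_finite_induct) (auto intro: smooth_on_const smooth_on_add)

lemma smooth_on_divide:
  "open U \<Longrightarrow> smooth_on U f \<Longrightarrow> smooth_on U g \<Longrightarrow> (\<And>x. x \<in> U \<Longrightarrow> g x \<noteq> 0) \<Longrightarrow> smooth_on U (\<lambda>x. f x / g x)"
  using smooth_on_mult[of U f "\<lambda>x. inverse (g x)"]
  by (simp add: smooth_on_def Ck_on_inverse divide_inverse)

lemma smooth_on_exp: "open U \<Longrightarrow> smooth_on U f \<Longrightarrow> smooth_on U (\<lambda>x. exp (f x))"
  by (simp add: smooth_on_def Ck_on_exp)

lemma smooth_on_sqrt:
  "open U \<Longrightarrow> smooth_on U f \<Longrightarrow> (\<And>x. x \<in> U \<Longrightarrow> f x > 0) \<Longrightarrow> smooth_on U (\<lambda>x. sqrt (f x))"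
  by (simp add: smooth_on_def Ck_on_sqrt)

lemma smooth_on_power: "open U \<Longrightarrow> smooth_on U f \<Longrightarrow> smooth_on U (\<lambda>x. f x ^ n)"
  by (induction n) (auto intro: smooth_on_const smooth_on_mult)

lemma smooth_on_fst: "open U \<Longrightarrow> open V \<Longrightarrow> smooth_on U f \<Longrightarrow> smooth_on (U \<times> V) (\<lambda>z. f (fst z))"
  by (simp add: smooth_on_def Ck_on_fst)

lemma smooth_on_ddir_Basis: "smooth_on U f \<Longrightarrow> e \<in> Basis \<Longrightarrow> smooth_on U (ddir e f)"
  unfolding smooth_on_def by (metis Ck_on.simps(2))

lemma smooth_on_partial: "smooth_on U f \<Longrightarrow> smooth_on U (partial i f)"
  by (rule smooth_on_ddir_Basis) (auto simp: axis_in_Basis_iff)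

lemma smooth_on_imp_differentiable:
  assumes "open U" "smooth_on U f" "x \<in> U"
  shows "f differentiable (at x)"
  using assms Ck_on.simps(2)[of 0 U f] differentiable_on_open_at unfolding smooth_on_def by blast

lemma smooth_on_imp_continuous_on: "smooth_on U f \<Longrightarrow> continuous_on U f"
  unfolding smooth_on_def using Ck_on.simps(1) by blast

section \<open>The metric at a point\<close>

definition pos_def :: "real^'n^'n \<Rightarrow> bool" where
  "pos_def A \<longleftrightarrow> transpose A = A \<and> (\<forall>v. v \<noteq> 0 \<longrightarrow> v \<bullet> (A *v v) > 0)"

lemma symmetric_inner:
  fixes A :: "real^'n^'n"
  assumes "transpose A = A"
  shows "u \<bullet> (A *v v) = v \<bullet> (A *v u)"
proof -
  have "u \<bullet> (A *v v) = (transpose A *v u) \<bullet> v"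
    by (simp add: dot_lmul_matrix)
  then show ?thesis
    using assms by (simp add: inner_commute)
qed

lemma pos_def_symmetric: "pos_def A \<Longrightarrow> u \<bullet> (A *v v) = v \<bullet> (A *v u)"
  by (simp add: pos_def_def symmetric_inner)

lemma pos_def_pos: "pos_def A \<Longrightarrow> v \<noteq> 0 \<Longrightarrow> v \<bullet> (A *v v) > 0"
  by (simp add: pos_def_def)

lemma pos_def_nonneg: "pos_def A \<Longrightarrow> v \<bullet> (A *v v) \<ge> 0"
  by (cases "v = 0") (auto dest: pos_def_pos[of A v])

lemma pos_def_Cauchy:
  assumes A: "pos_def A" and v: "v \<noteq> 0"
  shows "(u \<bullet> (A *v v))\<^sup>2 \<le> (u \<bullet> (A *v u)) * (v \<bullet> (A *v v))"
    and "(\<And>c. u \<noteq> c *\<^sub>R v) \<Longrightarrow> (u \<bullet> (A *v v))\<^sup>2 < (u \<bullet> (A *v u)) * (v \<bullet> (A *v v))"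
proof -
  \<comment> \<open>\<open>c *\<^sub>R v\<close> is the A-orthogonal projection of \<open>u\<close>
    to the line of \<open>v\<close>; the remainder has nonnegative square, positive unless
    \<open>u\<close> lies on that line.\<close>
  define c where "c = (u \<bullet> (A *v v)) / (v \<bullet> (A *v v))"
  have vp: "v \<bullet> (A *v v) > 0"
    using pos_def_pos[OF assms] .
  have "(u - c *\<^sub>R v) \<bullet> (A *v (u - c *\<^sub>R v)) =
      u \<bullet> (A *v u) - 2 * c * (u \<bullet> (A *v v)) + c\<^sup>2 * (v \<bullet> (A *v v))"
    using pos_def_symmetric[OF A, of v u]
    by (simp add: matrix_vector_mult_diff_distrib matrix_vector_mult_scaleR inner_diff_left
        inner_diff_right power2_eq_square algebra_simps)
  also have "\<dots> = u \<bullet> (A *v u) - (u \<bullet> (A *v v))\<^sup>2 / (v \<bullet> (A *v v))"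
    using vp by (simp add: c_def field_simps power2_eq_square)
  finally have *: "(u - c *\<^sub>R v) \<bullet> (A *v (u - c *\<^sub>R v)) =
      u \<bullet> (A *v u) - (u \<bullet> (A *v v))\<^sup>2 / (v \<bullet> (A *v v))" .
  show "(u \<bullet> (A *v v))\<^sup>2 \<le> (u \<bullet> (A *v u)) * (v \<bullet> (A *v v))"
    using pos_def_nonneg[OF A, of "u - c *\<^sub>R v"] vp unfolding * by (simp add: field_simps)
  show "(u \<bullet> (A *v v))\<^sup>2 < (u \<bullet> (A *v u)) * (v \<bullet> (A *v v))" if "\<And>c. u \<noteq> c *\<^sub>R v"
    using pos_def_pos[OF A, of "u - c *\<^sub>R v"] that[of c] vp unfolding * by (simp add: field_simps)
qed

lemma pos_def_inverse:
  assumes "pos_def A"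
  shows "A ** matrix_inv A = mat 1" "matrix_inv A ** A = mat 1"
proof -
  have "x = 0" if "A *v x = 0" for x
    using pos_def_pos[OF assms, of x] that by force
  then have "\<exists>B. B ** A = mat 1"
    using matrix_left_invertible_ker[of A] by blast
  then have "invertible A"
    by (simp add: invertible_left_inverse)
  then show "A ** matrix_inv A = mat 1" "matrix_inv A ** A = mat 1"
    unfolding invertible_def matrix_inv_def by (rule someI2_ex; simp)+
qed

lemma pos_def_mult_inv: "pos_def A \<Longrightarrow> A *v (matrix_inv A *v b) = b"
  by (simp add: matrix_vector_mul_assoc pos_def_inverse)

lemma pos_def_inv_mult: "pos_def A \<Longrightarrow> matrix_inv A *v (A *v b) = b"
  by (simp add: matrix_vector_mul_assoc pos_def_inverse)

lemma inner_matrix_sum: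
  "u \<bullet> (A *v v) = (\<Sum>i\<in>UNIV. \<Sum>j\<in>UNIV. A $ i $ j * u $ i * v $ j)"
  by (simp add: inner_vec_def matrix_vector_mult_def sum_distrib_left mult_ac)

lemma riemannian_length_eq: "riemannian_length A y = sqrt (y \<bullet> (A *v y))"
  by (simp add: riemannian_length_def inner_matrix_sum)

lemma covector_norm_eq: "covector_norm A b = sqrt (b \<bullet> (matrix_inv A *v b))"
  by (simp add: covector_norm_def inner_matrix_sum)

lemma form_value_eq: "form_value b y = b \<bullet> y"
  by (simp add: form_value_def inner_vec_def)

lemma riemannian_length_pos: "pos_def A \<Longrightarrow> y \<noteq> 0 \<Longrightarrow> riemannian_length A y > 0"
  by (simp add: riemannian_length_eq pos_def_pos)

lemma riemannian_length_square: "pos_def A \<Longrightarrow> (riemannian_length A y)\<^sup>2 = y \<bullet> (A *v y)"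
  by (simp add: riemannian_length_eq pos_def_nonneg)

lemma riemannian_length_scale: "riemannian_length A (t *\<^sub>R y) = \<bar>t\<bar> * riemannian_length A y"
  by (simp add: riemannian_length_eq matrix_vector_mult_scaleR real_sqrt_mult flip: mult.assoc)

text \<open>Cauchy-Schwarz for \<open>y\<close> and the vector \<open>matrix_inv A *v b\<close> dual
  to \<open>b\<close>.\<close>

lemma abs_form_le:
  assumes A: "pos_def A"
  shows "\<bar>b \<bullet> y\<bar> \<le> covector_norm A b * riemannian_length A y"
proof (cases "y = 0")
  case False
  have "(b \<bullet> y)\<^sup>2 \<le> (b \<bullet> (matrix_inv A *v b)) * (y \<bullet> (A *v y))"
    using pos_def_Cauchy(1)[OF A False, of "matrix_inv A *v b"] pos_def_symmetric[OF A, of "matrix_inv A *v b" y]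
    by (simp add: pos_def_mult_inv[OF A] inner_commute)
  then have "sqrt ((b \<bullet> y)\<^sup>2) \<le> sqrt ((b \<bullet> (matrix_inv A *v b)) * (y \<bullet> (A *v y)))"
    by (rule real_sqrt_le_mono)
  then show ?thesis
    by (simp add: real_sqrt_mult covector_norm_eq riemannian_length_eq)
qed (simp add: riemannian_length_eq)

text \<open>
  The metric at a fixed point of a chart, its gradient and its Hessian in \<open>y\<close>; the form \<open>\<gamma>\<close> is
  linear and does not enter the Hessian.
\<close>

definition fun_val where
  "fun_val A b g y = riemannian_length A y * exp ((b \<bullet> y) / riemannian_length A y) + g \<bullet> y"

definition fun_grad where
  "fun_grad A b g y =
    (let \<alpha> = riemannian_length A y; s = (b \<bullet> y) / \<alpha>
     in exp s *\<^sub>R (((1 - s) / \<alpha>) *\<^sub>R (A *v y) + b) + g)"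

definition fun_hess where
  "fun_hess A b y u v =
    (let \<alpha> = riemannian_length A y; s = (b \<bullet> y) / \<alpha>
     in exp s / \<alpha> * ((1 - s) * (u \<bullet> (A *v v) - (u \<bullet> (A *v y)) * (v \<bullet> (A *v y)) / \<alpha>\<^sup>2) +
          (b \<bullet> u - s * (u \<bullet> (A *v y)) / \<alpha>) * (b \<bullet> v - s * (v \<bullet> (A *v y)) / \<alpha>)))"

text \<open>Reduced to the scalars \<alpha>^2, \<beta>(y), \<gamma>(y) along a curve, so that it
  serves both for lines in \<open>y\<close> at a fixed point
  (\<open>fun_val_direction_deriv\<close>) and for lines in \<open>x\<close> with \<open>y\<close>
  fixed (\<open>F_x_deriv\<close>).\<close>

lemma fun_val_scalar_deriv:
  fixes Q \<beta> \<gamma> :: "real \<Rightarrow> real"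
  assumes "(Q has_real_derivative Q') (at t)" "(\<beta> has_real_derivative \<beta>') (at t)"
    "(\<gamma> has_real_derivative \<gamma>') (at t)" "Q t > 0"
  defines "s \<equiv> \<beta> t / sqrt (Q t)"
  shows "((\<lambda>t. sqrt (Q t) * exp (\<beta> t / sqrt (Q t)) + \<gamma> t) has_real_derivative
    exp s * ((1 - s) * Q' / (2 * sqrt (Q t)) + \<beta>') + \<gamma>') (at t)"
proof -
  have a: "sqrt (Q t) > 0" using assms(4) by simp
  have "((\<lambda>t. sqrt (Q t)) has_real_derivative (inverse (sqrt (Q t)) / 2) * Q') (at t)"
    by (rule DERIV_chain2[OF DERIV_real_sqrt[OF assms(4)] assms(1)])
  then have "((\<lambda>t. sqrt (Q t)) has_real_derivative Q' / (2 * sqrt (Q t))) (at t)"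
    by (simp add: field_simps)
  note 1 = this
  note 2 = DERIV_divide[OF assms(2) 1]
  note 3 = DERIV_add[OF DERIV_mult[OF 1 DERIV_fun_exp[OF 2]] assms(3)]
  show ?thesis
  proof (rule DERIV_cong[OF 3])
    define r where "r = sqrt (Q t)"
    show "Q' / (2 * sqrt (Q t)) * exp (\<beta> t / sqrt (Q t)) +
        exp (\<beta> t / sqrt (Q t)) * ((\<beta>' * sqrt (Q t) - \<beta> t * (Q' / (2 * sqrt (Q t)))) / (sqrt (Q t) * sqrt (Q t))) * sqrt (Q t) + \<gamma>'
      = exp s * ((1 - s) * Q' / (2 * sqrt (Q t)) + \<beta>') + \<gamma>'"
      using a unfolding s_def r_def[symmetric] by (simp add: field_simps)
  qed (use a in auto)
qed

text \<open>\<open>Y\<close>, \<open>p\<close>, \<open>r\<close> are the values of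
  \<open>A *v y\<close>, \<open>b\<close> and \<open>g\<close> on a test vector. The derivative of s
  enters through the exponential and through 1 - s; together they leave the factor
  \<open>p t - s * Y t / sqrt (Q t)\<close>, which vanishes when the test vector is
  \<open>y\<close>.\<close>

lemma fun_grad_scalar_deriv:
  fixes Q \<beta> \<gamma> :: "real \<Rightarrow> real"
  assumes "(Q has_real_derivative Q') (at t)" "(\<beta> has_real_derivative \<beta>') (at t)"
    "(Y has_real_derivative Y') (at t)" "(p has_real_derivative p') (at t)"
    "(r has_real_derivative r') (at t)" "Q t > 0"
  defines "s \<equiv> \<beta> t / sqrt (Q t)"
  defines "ds \<equiv> (\<beta>' - s * Q' / (2 * sqrt (Q t))) / sqrt (Q t)"
  shows "((\<lambda>t. exp (\<beta> t / sqrt (Q t)) * ((1 - \<beta> t / sqrt (Q t)) / sqrt (Q t) * Y t + p t) + r t)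
    has_real_derivative
    exp s * (ds * (p t - s * Y t / sqrt (Q t)) +
      (1 - s) * (Y' / sqrt (Q t) - Y t * Q' / (2 * sqrt (Q t) ^ 3)) + p') + r') (at t)"
proof -
  have a: "sqrt (Q t) > 0" using assms(6) by simp
  have "((\<lambda>t. sqrt (Q t)) has_real_derivative (inverse (sqrt (Q t)) / 2) * Q') (at t)"
    by (rule DERIV_chain2[OF DERIV_real_sqrt[OF assms(6)] assms(1)])
  then have "((\<lambda>t. sqrt (Q t)) has_real_derivative Q' / (2 * sqrt (Q t))) (at t)"
    by (simp add: field_simps)
  note 1 = this
  have 2: "((\<lambda>t. \<beta> t / sqrt (Q t)) has_real_derivative ds) (at t)"
    by (rule DERIV_cong[OF DERIV_divide[OF assms(2) 1]])
      (use a in \<open>simp_all add: s_def ds_def field_simps\<close>)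
  note 3 = DERIV_divide[OF DERIV_diff[OF DERIV_const[of 1] 2] 1]
  note 4 = DERIV_add[OF DERIV_mult[OF DERIV_fun_exp[OF 2] DERIV_add[OF DERIV_mult[OF 3 assms(3)] assms(4)]] assms(5)]
  have c: "2 * sqrt (Q t) ^ 3 = 2 * (sqrt (Q t) * (sqrt (Q t) * sqrt (Q t)))"
    by (simp add: power3_eq_cube)
  show ?thesis
    unfolding c
  proof (rule DERIV_cong[OF 4])
    define r where "r = sqrt (Q t)"
    have r: "r > 0" using a by (simp add: r_def)
    have sb: "\<beta> t / r = s" by (simp add: r_def s_def)
    show "exp (\<beta> t / sqrt (Q t)) * ds * ((1 - \<beta> t / sqrt (Q t)) / sqrt (Q t) * Y t + p t) +
        (((0 - ds) * sqrt (Q t) - (1 - \<beta> t / sqrt (Q t)) * (Q' / (2 * sqrt (Q t)))) / (sqrt (Q t) * sqrt (Q t)) * Y t +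
           Y' * ((1 - \<beta> t / sqrt (Q t)) / sqrt (Q t)) + p') * exp (\<beta> t / sqrt (Q t)) + r'
      = exp s * (ds * (p t - s * Y t / sqrt (Q t)) +
          (1 - s) * (Y' / sqrt (Q t) - Y t * Q' / (2 * (sqrt (Q t) * (sqrt (Q t) * sqrt (Q t))))) + p') + r'"
      unfolding r_def[symmetric] sb using r by (simp add: field_simps)
  qed (use a in auto)
qed

text \<open>
  The scalar core of lemma \<open>rapcsak\<close> below: \<open>Q\<close>, \<open>Y\<close>, \<open>p\<close>, \<open>r\<close> stand for \<open>\<alpha>\<^sup>2\<close>, \<open>\<langle>u, y\<rangle>\<close>, \<open>\<beta> u\<close>, \<open>\<gamma> u\<close>;
  derivatives are in \<open>x\<close>, along \<open>u\<close> for \<open>Qu'\<close>, \<open>\<beta>u'\<close>, \<open>\<gamma>u'\<close> and along \<open>y\<close> for the others.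
\<close>

lemma rapcsak_identity:
  fixes \<alpha> s E \<beta>' Qy' Qu' p Y Y' p' r' \<beta>u' \<gamma>u' Gb :: real
  assumes "\<alpha> > 0" "E > 0"
  defines "ds \<equiv> (\<beta>' - s * Qy' / (2 * \<alpha>)) / \<alpha>"
  defines "B \<equiv> p - s * Y / \<alpha>"
  shows "(E * (ds * B + (1 - s) * (Y' / \<alpha> - Y * Qy' / (2 * \<alpha> ^ 3)) + p') + r')
      - (E * ((1 - s) * Qu' / (2 * \<alpha>) + \<beta>u') + \<gamma>u')
    = 2 * (E / \<alpha> * ((1 - s) * ((Y' / 2 - Qu' / 4) - Y * (Qy' / 4) / \<alpha>\<^sup>2) + B * (Gb - s * (Qy' / 4) / \<alpha>))
       + E / \<alpha> * ((\<beta>' - 2 * Gb) / 2 * B + \<alpha> * ((p' - \<beta>u') / 2) + \<alpha> * (1 / E) * ((r' - \<gamma>u') / 2)))"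
proof -
  have a3: "\<alpha> ^ 3 = \<alpha> * (\<alpha> * \<alpha>)" and a2: "\<alpha>\<^sup>2 = \<alpha> * \<alpha>"
    by (simp_all add: power3_eq_cube power2_eq_square)
  have 1: "2 * (E / \<alpha> * (B * (Gb - s * (Qy' / 4) / \<alpha>)) + E / \<alpha> * ((\<beta>' - 2 * Gb) / 2 * B)) = E * (ds * B)"
    using assms(1) by (simp add: ds_def field_simps)
  have 2: "2 * (E / \<alpha> * ((1 - s) * ((Y' / 2 - Qu' / 4) - Y * (Qy' / 4) / \<alpha>\<^sup>2)))
     = E * ((1 - s) * (Y' / \<alpha> - Y * Qy' / (2 * \<alpha> ^ 3))) - E * ((1 - s) * Qu' / (2 * \<alpha>))"
    using assms(1) unfolding a3 a2 by (simp add: field_simps)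
  have 3: "2 * (E / \<alpha> * (\<alpha> * ((p' - \<beta>u') / 2) + \<alpha> * (1 / E) * ((r' - \<gamma>u') / 2))) = E * (p' - \<beta>u') + (r' - \<gamma>u')"
    using assms(1,2) by (simp add: field_simps)
  have 4: "E * (p' - \<beta>u') = E * p' - E * \<beta>u'"
    by (simp add: algebra_simps)
  from 1 2 3 show ?thesis
    unfolding distrib_left 4 by linarith
qed


text \<open>Because s < 1, the first summand is a positive multiple of the Cauchy-Schwarz gap of
  \<open>v\<close> and \<open>y\<close>; the second is a square. So the Hessian degenerates only
  along \<open>y\<close>.\<close>

lemma fun_hess_diag:
  assumes A: "pos_def A" and y: "y \<noteq> 0" and s: "b \<bullet> y < riemannian_length A y"
  shows "fun_hess A b y v v \<ge> 0" "(\<And>c. v \<noteq> c *\<^sub>R y) \<Longrightarrow> fun_hess A b y v v > 0"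
proof -
  define \<alpha> where "\<alpha> = riemannian_length A y"
  have \<alpha>: "\<alpha> > 0" "\<alpha>\<^sup>2 = y \<bullet> (A *v y)"
    using riemannian_length_pos[OF A y] riemannian_length_square[OF A, of y] by (auto simp: \<alpha>_def)
  have s1: "1 - b \<bullet> y / \<alpha> > 0"
    using s \<alpha> by (simp add: \<alpha>_def)
  define D where "D = v \<bullet> (A *v v) - (v \<bullet> (A *v y)) * (v \<bullet> (A *v y)) / \<alpha>\<^sup>2"
  define P where "P = (b \<bullet> v - b \<bullet> y / \<alpha> * (v \<bullet> (A *v y)) / \<alpha>)"
  have h: "fun_hess A b y v v = exp (b \<bullet> y / \<alpha>) / \<alpha> * ((1 - b \<bullet> y / \<alpha>) * D + P * P)"
    by (simp add: fun_hess_def Let_def D_def P_def \<alpha>_def)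
  have Deq: "D * \<alpha>\<^sup>2 = (v \<bullet> (A *v v)) * (y \<bullet> (A *v y)) - (v \<bullet> (A *v y))\<^sup>2"
    unfolding D_def \<alpha>(2)[symmetric] using \<alpha>(1) by (simp add: field_simps power2_eq_square)
  have "D * \<alpha>\<^sup>2 \<ge> 0"
    using pos_def_Cauchy(1)[OF A y, of v] unfolding Deq by simp
  then have "D \<ge> 0"
    using \<alpha>(1) by (simp add: zero_le_mult_iff)
  then show "fun_hess A b y v v \<ge> 0"
    unfolding h using \<alpha>(1) s1 by simp
  assume "\<And>c. v \<noteq> c *\<^sub>R y"
  then have "D * \<alpha>\<^sup>2 > 0"
    using pos_def_Cauchy(2)[OF A y, of v] unfolding Deq by simp
  then have "D > 0"
    using \<alpha>(1) by (simp add: zero_less_mult_iff)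
  then show "fun_hess A b y v v > 0"
    unfolding h using \<alpha>(1) s1 by (simp add: add_pos_nonneg)
qed

text \<open>Euler's identity for a function of degree 1; \<open>fun_hess_self\<close> is the one for
  its gradient, of degree 0.\<close>

lemma fun_grad_self:
  assumes A: "pos_def A" and y: "y \<noteq> 0"
  shows "fun_grad A b g y \<bullet> y = fun_val A b g y"
proof -
  define \<alpha> where "\<alpha> = riemannian_length A y"
  have \<alpha>: "\<alpha> > 0" "(A *v y) \<bullet> y = \<alpha>\<^sup>2"
    using riemannian_length_pos[OF A y] riemannian_length_square[OF A, of y] by (auto simp: \<alpha>_def inner_commute)
  show ?thesis
    unfolding fun_grad_def fun_val_def Let_def \<alpha>_def[symmetric]
    using \<alpha> by (simp add: inner_add_left field_simps power2_eq_square)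
qed

lemma fun_hess_self:
  assumes A: "pos_def A" and y: "y \<noteq> 0"
  shows "fun_hess A b y u y = 0"
proof -
  define \<alpha> where "\<alpha> = riemannian_length A y"
  have \<alpha>: "\<alpha> > 0" "y \<bullet> (A *v y) = \<alpha>\<^sup>2"
    using riemannian_length_pos[OF A y] riemannian_length_square[OF A, of y] by (auto simp: \<alpha>_def)
  show ?thesis
    unfolding fun_hess_def Let_def \<alpha>_def[symmetric] \<alpha>(2)
    using \<alpha>(1) by (simp add: field_simps power2_eq_square)
qed

lemma fun_hess_add: "fun_hess A b y u (v + w) = fun_hess A b y u v + fun_hess A b y u w"
proof -
  have "c * (d * ((x1 + x2) - k * (z1 + z2) / a) + m * ((b1 + b2) - s * (z1 + z2) / e)) =
      c * (d * (x1 - k * z1 / a) + m * (b1 - s * z1 / e)) + c * (d * (x2 - k * z2 / a) + m * (b2 - s * z2 / e))"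
    for a b1 b2 c d e k m s x1 x2 z1 z2 :: real
    by (simp add: algebra_simps add_divide_distrib)
  then show ?thesis
    unfolding fun_hess_def Let_def matrix_vector_right_distrib inner_add_left inner_add_right by blast
qed

lemma fun_hess_scale: "fun_hess A b y u (r *\<^sub>R v) = r * fun_hess A b y u v"
proof -
  have "c * (d * (r * x - k * (r * z) / a) + m * (r * b - s * (r * z) / e)) =
      r * (c * (d * (x - k * z / a) + m * (b - s * z / e)))"
    for a b c d e k m s x z :: real
    by (simp add: algebra_simps)
  then show ?thesis
    unfolding fun_hess_def Let_def matrix_vector_mult_scaleR inner_scaleR_left inner_scaleR_right by blast
qed

lemma fun_hess_commute:
  assumes "pos_def A"
  shows "fun_hess A b y u v = fun_hess A b y v u"
  unfolding fun_hess_def Let_def pos_def_symmetric[OF assms, of u v] by (simp add: mult_ac)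

text \<open>
  On vectors orthogonal to \<open>y\<close> the Hessian acts, up to the factor \<open>exp s / \<alpha>\<close>, as
  \<open>W \<mapsto> (1 - s) W + \<langle>W, b\<rangle> B\<close> with \<open>B = proj_form\<close>; \<open>W_form\<close> is the \<open>W\<close> for which this equals
  \<open>h_form\<close>.  The matrices \<open>M\<close>, \<open>S\<close>, \<open>K\<close> stand for the covariant derivative of \<open>\<beta>\<close> and the skew
  parts of the derivatives of \<open>\<beta>\<close> and \<open>\<gamma>\<close>.
\<close>

definition proj_form where
  "proj_form A b y = b - ((b \<bullet> y) / (riemannian_length A y)\<^sup>2) *\<^sub>R (A *v y)"

definition h_form where
  "h_form A b M S K y =
    ((y \<bullet> (M *v y)) / 2) *\<^sub>R proj_form A b y + riemannian_length A y *\<^sub>R (S *v y) +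
    (riemannian_length A y * exp (- ((b \<bullet> y) / riemannian_length A y))) *\<^sub>R (K *v y)"

definition W_form where
  "W_form A b M S K y =
    (let s = (b \<bullet> y) / riemannian_length A y; b' = matrix_inv A *v b; h = h_form A b M S K y
     in (1 / (1 - s)) *\<^sub>R (h - ((h \<bullet> b') / (1 - s + (b \<bullet> b' - s\<^sup>2))) *\<^sub>R proj_form A b y))"

definition skew where "skew S \<longleftrightarrow> (\<forall>y. y \<bullet> (S *v y) = 0)"

section \<open>Inversion of the Hessian on the complement of y\<close>

lemma proj_form_self:
  assumes A: "pos_def A" and y: "y \<noteq> 0"
  shows "proj_form A b y \<bullet> y = 0"
  using pos_def_pos[OF A y]
  by (simp add: proj_form_def riemannian_length_square[OF A] inner_diff_left inner_commute[of "A *v y" y])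

text \<open>The value b^2 - s^2 is the trace of the rank-one term of the Hessian, hence the summand
  added to 1 - s in the second denominator of \<open>W_form\<close>.\<close>

lemma proj_form_sharp:
  assumes A: "pos_def A"
  shows "proj_form A b y \<bullet> (matrix_inv A *v b) =
    b \<bullet> (matrix_inv A *v b) - ((b \<bullet> y) / riemannian_length A y)\<^sup>2"
proof -
  have "(A *v y) \<bullet> (matrix_inv A *v b) = b \<bullet> y"
    using pos_def_symmetric[OF A, of y "matrix_inv A *v b"]
    by (simp add: pos_def_mult_inv[OF A] inner_commute)
  then show ?thesis
    by (simp add: proj_form_def inner_diff_left power_divide) (simp add: power2_eq_square)
qed

text \<open>Cauchy-Schwarz in the form s^2 \<le> b^2: the second denominator of
  \<open>W_form\<close> is at least 1 - s.\<close>

lemma square_ratio_le: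
  assumes A: "pos_def A" and y: "y \<noteq> 0"
  shows "((b \<bullet> y) / riemannian_length A y)\<^sup>2 \<le> b \<bullet> (matrix_inv A *v b)"
proof -
  have "(b \<bullet> y)\<^sup>2 \<le> (b \<bullet> (matrix_inv A *v b)) * (y \<bullet> (A *v y))"
    using pos_def_Cauchy(1)[OF A y, of "matrix_inv A *v b"] pos_def_symmetric[OF A, of "matrix_inv A *v b" y]
    by (simp add: pos_def_mult_inv[OF A] inner_commute)
  then show ?thesis
    using pos_def_pos[OF A y] by (simp add: power_divide riemannian_length_square[OF A] field_simps)
qed

lemma W_form_self:
  assumes A: "pos_def A" and y: "y \<noteq> 0" and "skew S" "skew K"
  shows "W_form A b M S K y \<bullet> y = 0"
proof -
  have "h_form A b M S K y \<bullet> y = 0"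
    using assms(3,4)
    by (simp add: h_form_def inner_add_left proj_form_self[OF A y] skew_def
        inner_commute[of "S *v y"] inner_commute[of "K *v y"])
  then show ?thesis
    by (simp add: W_form_def Let_def inner_diff_left proj_form_self[OF A y])
qed

text \<open>Sherman-Morrison inversion of a multiple of the identity plus a rank-one term: pairing
  with the vector dual to \<open>b\<close> determines the scalar
  \<open>W \<bullet> (matrix_inv A *v b)\<close>, and this determines \<open>W\<close>. Both
  denominators are positive because s < 1.\<close>

lemma W_form_equation:
  fixes M S K :: "real^'n^'n"
  assumes A: "pos_def A" and y: "y \<noteq> 0" and s: "b \<bullet> y < riemannian_length A y"
  defines "W \<equiv> W_form A b M S K y"
  shows "(1 - (b \<bullet> y) / riemannian_length A y) *\<^sub>R W + (W \<bullet> (matrix_inv A *v b)) *\<^sub>R proj_form A b y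
    = h_form A b M S K y"
proof -
  define s where "s = (b \<bullet> y) / riemannian_length A y"
  define b' where "b' = matrix_inv A *v b"
  define q where "q = b \<bullet> b' - s\<^sup>2"
  define h where "h = h_form A b M S K y"
  define P where "P = proj_form A b y"
  have s1: "1 - s > 0"
    using assms(3) riemannian_length_pos[OF A y] by (simp add: s_def)
  have q: "q \<ge> 0"
    using square_ratio_le[OF A y] by (simp add: q_def s_def b'_def)
  have Pb: "P \<bullet> b' = q"
    by (simp add: P_def b'_def q_def s_def proj_form_sharp[OF A])
  have W: "W = (1 / (1 - s)) *\<^sub>R (h - ((h \<bullet> b') / (1 - s + q)) *\<^sub>R P)"
    by (simp add: W_def W_form_def Let_def s_def b'_def q_def h_def P_def)
  have 1: "W \<bullet> b' = (h \<bullet> b') / (1 - s + q)"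
  proof -
    have "x = 1 / (1 - s) * (x * (1 - s + q) - x * q)" for x
      using s1 by (simp add: field_simps)
    then have "1 / (1 - s) * (h \<bullet> b' - (h \<bullet> b') / (1 - s + q) * q) = (h \<bullet> b') / (1 - s + q)"
      using s1 q by (metis add_pos_nonneg less_irrefl nonzero_eq_divide_eq)
    then show ?thesis
      unfolding W by (simp add: inner_diff_left Pb)
  qed
  have 2: "(1 - s) *\<^sub>R W = h - ((h \<bullet> b') / (1 - s + q)) *\<^sub>R P"
    unfolding W using s1 by simp
  show ?thesis
    unfolding s_def[symmetric] b'_def[symmetric] h_def[symmetric] P_def[symmetric] 1 2 by simp
qed

text \<open>\<open>W_form\<close> is orthogonal to \<open>y\<close>, which removes the projection
  terms of the Hessian; what remains is the left-hand side of
  \<open>W_form_equation\<close>.\<close>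

lemma fun_hess_W:
  assumes A: "pos_def A" and y: "y \<noteq> 0" and s: "b \<bullet> y < riemannian_length A y"
    and "skew S" "skew K"
  shows "fun_hess A b y u (matrix_inv A *v W_form A b M S K y) =
    exp ((b \<bullet> y) / riemannian_length A y) / riemannian_length A y * (u \<bullet> h_form A b M S K y)"
proof -
  define \<alpha> where "\<alpha> = riemannian_length A y"
  define W where "W = W_form A b M S K y"
  have \<alpha>: "\<alpha> > 0"
    using riemannian_length_pos[OF A y] by (auto simp: \<alpha>_def)
  have 1: "(matrix_inv A *v W) \<bullet> (A *v y) = 0"
    using pos_def_symmetric[OF A, of y "matrix_inv A *v W"] W_form_self[OF A y assms(4,5)]
    by (simp add: pos_def_mult_inv[OF A] inner_commute W_def)
  have 2: "b \<bullet> (matrix_inv A *v W) = W \<bullet> (matrix_inv A *v b)"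
    using pos_def_symmetric[OF A, of "matrix_inv A *v b" "matrix_inv A *v W"]
    by (simp add: pos_def_mult_inv[OF A] inner_commute)
  have 3: "u \<bullet> proj_form A b y = b \<bullet> u - b \<bullet> y / \<alpha> * (u \<bullet> (A *v y)) / \<alpha>"
    by (simp add: proj_form_def \<alpha>_def inner_diff_right power2_eq_square inner_commute)
  show ?thesis
    unfolding W_form_equation[OF A y s, of M S K, symmetric]
    unfolding fun_hess_def Let_def \<alpha>_def[symmetric] W_def[symmetric] 1 2 pos_def_mult_inv[OF A]
    by (simp add: inner_add_right 3)
qed

text \<open>\<open>G\<close> is to be the spray of \<alpha>; its two assumptions are supplied by
  \<open>a_Ga\<close> and \<open>y_a_Ga\<close>.\<close>

lemma fun_hess_linear_G:
  assumes "u \<bullet> (A *v G) = Y' / 2 - Qu' / 4" "y \<bullet> (A *v G) = Qy' / 4" "pos_def A"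
  shows "fun_hess A b y u G =
   (let \<alpha> = riemannian_length A y; s = (b \<bullet> y) / \<alpha> in exp s / \<alpha> *
    ((1 - s) * ((Y' / 2 - Qu' / 4) - (u \<bullet> (A *v y)) * (Qy' / 4) / \<alpha>\<^sup>2) +
     (b \<bullet> u - s * (u \<bullet> (A *v y)) / \<alpha>) * (b \<bullet> G - s * (Qy' / 4) / \<alpha>)))"
  unfolding fun_hess_def Let_def assms(1) pos_def_symmetric[OF assms(3), of G y] assms(2) by simp

section \<open>Consequences of evenness\<close>

text \<open>x sinh x - cosh x has derivative x cosh x. The inequality eliminates the skew part of
  the derivative of \<gamma>, whose coefficient in the final equations is x sinh x - cosh x +
  1.\<close>

lemma x_sinh_gt: 
  fixes x :: real
  assumes "x > 0"
  shows "x * sinh x > cosh x - 1"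
proof -
  have "(0::real) * sinh 0 - cosh 0 < x * sinh x - cosh x"
  proof (rule DERIV_pos_imp_increasing_open[OF assms])
    fix t :: real assume "0 < t" "t < x"
    have "((\<lambda>x. x * sinh x - cosh x) has_real_derivative t * cosh t) (at t)"
      by (auto intro!: derivative_eq_intros)
    then show "\<exists>y. ((\<lambda>x. x * sinh x - cosh x) has_real_derivative y) (at t) \<and> 0 < y"
      using \<open>0 < t\<close> by (intro exI[of _ "t * cosh t"]) simp
  qed (intro continuous_intros)
  then show ?thesis by simp
qed

lemma skew_inner:
  assumes "skew S"
  shows "u \<bullet> (S *v v) = - (v \<bullet> (S *v u))"
proof -
  have "(u + v) \<bullet> (S *v (u + v)) = 0"
    using assms by (simp add: skew_def)
  then show ?thesis
    using assms by (simp add: skew_def matrix_vector_right_distrib inner_add_left inner_add_right)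
qed

lemma matrix_vector_mult_uminus: "A *v (- y) = - (A *v (y::real^'n))"
  using matrix_vector_mult_scaleR[of A "-1" y] by simp

text \<open>Half the sum and half the difference of \<open>W_form_equation\<close> at
  \<open>y\<close> and at \<open>- y\<close>: \<alpha>, \<open>P\<close> and the term with
  \<open>M\<close> are even, s and the terms with \<open>S\<close> and \<open>K\<close> are odd, so
  exp (- s) splits into cosh and sinh.\<close>

lemma W_form_even_equations:
  fixes M S K :: "real^'n^'n"
  assumes A: "pos_def A" and y: "y \<noteq> 0" and s: "\<bar>b \<bullet> y\<bar> < riemannian_length A y"
    and even: "W_form A b M S K (- y) = W_form A b M S K y"
  defines "\<alpha> \<equiv> riemannian_length A y" and "W \<equiv> W_form A b M S K y"
    and "P \<equiv> proj_form A b y" and "Wb \<equiv> W_form A b M S K y \<bullet> (matrix_inv A *v b)"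
  defines "s \<equiv> (b \<bullet> y) / \<alpha>"
  shows "W + Wb *\<^sub>R P = ((y \<bullet> (M *v y)) / 2) *\<^sub>R P - (\<alpha> * sinh s) *\<^sub>R (K *v y)"
    and "s *\<^sub>R W = - \<alpha> *\<^sub>R (S *v y + cosh s *\<^sub>R (K *v y))"
proof -
  have l: "riemannian_length A (- y) = \<alpha>"
    using riemannian_length_scale[of A "-1" y] by (simp add: \<alpha>_def)
  have P': "proj_form A b (- y) = P"
    by (simp add: proj_form_def P_def l \<alpha>_def matrix_vector_mult_uminus)
  have 1: "(1 - s) *\<^sub>R W + Wb *\<^sub>R P =
      ((y \<bullet> (M *v y)) / 2) *\<^sub>R P + \<alpha> *\<^sub>R (S *v y) + (\<alpha> * exp (- s)) *\<^sub>R (K *v y)"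
    using W_form_equation[OF A y, of b M S K] s
    by (simp add: h_form_def W_def Wb_def P_def s_def \<alpha>_def)
  have 2: "(1 + s) *\<^sub>R W + Wb *\<^sub>R P =
      ((y \<bullet> (M *v y)) / 2) *\<^sub>R P - \<alpha> *\<^sub>R (S *v y) - (\<alpha> * exp s) *\<^sub>R (K *v y)"
    using W_form_equation[OF A, of "- y" b M S K] s y
    by (simp add: h_form_def W_def Wb_def P_def s_def \<alpha>_def even
        P'[unfolded P_def] l[unfolded \<alpha>_def] matrix_vector_mult_uminus)
  have "(1/2) *\<^sub>R (((1 - s) *\<^sub>R W + Wb *\<^sub>R P) + ((1 + s) *\<^sub>R W + Wb *\<^sub>R P)) = W + Wb *\<^sub>R P"
    by (simp add: vec_eq_iff field_simps)
  then show "W + Wb *\<^sub>R P = ((y \<bullet> (M *v y)) / 2) *\<^sub>R P - (\<alpha> * sinh s) *\<^sub>R (K *v y)"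
    unfolding 1 2 by (simp add: vec_eq_iff sinh_field_def field_simps) (erule all_forward, linarith)
  have "(1/2) *\<^sub>R (((1 + s) *\<^sub>R W + Wb *\<^sub>R P) - ((1 - s) *\<^sub>R W + Wb *\<^sub>R P)) = s *\<^sub>R W"
    by (simp add: vec_eq_iff field_simps)
  then show "s *\<^sub>R W = - \<alpha> *\<^sub>R (S *v y + cosh s *\<^sub>R (K *v y))"
    unfolding 1 2 by (simp add: vec_eq_iff cosh_field_def field_simps) (erule all_forward, linarith)
qed

text \<open>
  The hypothesis is the evenness condition on the plane spanned by the vector dual to \<open>\<beta>\<close>, of squared
  length \<open>N\<close>, and a unit vector orthogonal to it.  The sign of \<open>v\<close> separates \<open>r11\<close> and \<open>r22\<close> from the rest;
  the rest is decided by \<open>s = 0\<close> and the limit \<open>s \<rightarrow> sqrt N\<close>, where \<open>r12\<close> drops out.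
\<close>

lemma plane_rigidity:
  fixes N r11 r12 r22 k g :: real
  assumes N: "N > 0"
    and eq: "\<And>s v. s\<^sup>2 < N \<Longrightarrow> v\<^sup>2 = 1 - s\<^sup>2 / N \<Longrightarrow>
      s * ((r11 * (s / N)\<^sup>2 + 2 * r12 * (s / N) * v + r22 * v\<^sup>2) * (N - s\<^sup>2) / 2 - sinh s * (v * k))
      = - (1 + (N - s\<^sup>2)) * (v * g + cosh s * (v * k))"
  shows "r11 = 0" "r12 = 0" "r22 = 0" "k = 0" "g = 0"
proof -
  define c where "c = sqrt N"
  have c: "c > 0" "c\<^sup>2 = N"
    using N by (auto simp: c_def)
  have sq: "s\<^sup>2 < N" if "0 \<le> s" "s < c" for s
    using that c power_strict_mono[of s c 2] by simp
  have A0: "s * (r11 * (s / N)\<^sup>2 + r22 * (1 - s\<^sup>2 / N)) = 0"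
    and red: "s\<^sup>2 * (1 - s\<^sup>2 / N) * r12 - s * sinh s * k = - (1 + (N - s\<^sup>2)) * (g + cosh s * k)"
    if s: "0 \<le> s" "s < c" for s
  proof -
    define v where "v = sqrt (1 - s\<^sup>2 / N)"
    have vp: "1 - s\<^sup>2 / N > 0"
      using sq[OF s] N by simp
    have v: "v > 0" "v\<^sup>2 = 1 - s\<^sup>2 / N" "N - s\<^sup>2 = N * v\<^sup>2"
      using vp N by (auto simp: v_def field_simps)
    have v': "(- v)\<^sup>2 = 1 - s\<^sup>2 / N"
      using v(2) by simp
    define X where "X = r11 * (s / N)\<^sup>2 + r22 * v\<^sup>2"
    define Y where "Y = 2 * r12 * (s / N)"
    have XY: "r11 * (s / N)\<^sup>2 + 2 * r12 * (s / N) * v + r22 * v\<^sup>2 = X + Y * v"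
      and XY': "r11 * (s / N)\<^sup>2 + 2 * r12 * (s / N) * - v + r22 * (- v)\<^sup>2 = X - Y * v"
      by (simp_all add: X_def Y_def)
    have e1: "s * ((X + Y * v) * (N * v\<^sup>2) / 2 - sinh s * (v * k)) = - (1 + N * v\<^sup>2) * (v * g + cosh s * (v * k))"
      using eq[OF sq[OF s] v(2)] unfolding v(3) XY .
    have e2: "s * ((X - Y * v) * (N * v\<^sup>2) / 2 + sinh s * (v * k)) = (1 + N * v\<^sup>2) * (v * g + cosh s * (v * k))"
      using eq[OF sq[OF s] v', unfolded v(3) XY'] by (simp add: algebra_simps)
    have "s * X * (N * v\<^sup>2) = s * ((X + Y * v) * (N * v\<^sup>2) / 2 - sinh s * (v * k)) +
        s * ((X - Y * v) * (N * v\<^sup>2) / 2 + sinh s * (v * k))"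
      by (simp add: field_simps)
    also have "\<dots> = 0"
      unfolding e1 e2 by (simp add: algebra_simps)
    finally have "s * X * (N * v\<^sup>2) = 0" .
    then have sX: "s * X = 0"
      using N v(1) by simp
    then show "s * (r11 * (s / N)\<^sup>2 + r22 * (1 - s\<^sup>2 / N)) = 0"
      by (simp add: X_def v(2))
    have "v * (s * (Y * (N * v\<^sup>2) / 2 - sinh s * k)) = v * (- (1 + N * v\<^sup>2) * (g + cosh s * k))"
    proof -
      have "s * ((X + Y * v) * (N * v\<^sup>2) / 2 - sinh s * (v * k))
          = (s * X) * (N * v\<^sup>2) / 2 + v * (s * (Y * (N * v\<^sup>2) / 2 - sinh s * k))"
        by (simp add: algebra_simps)
      then have "v * (s * (Y * (N * v\<^sup>2) / 2 - sinh s * k)) = - (1 + N * v\<^sup>2) * (v * g + cosh s * (v * k))"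
        unfolding sX e1 by simp
      then show ?thesis
        by (simp add: algebra_simps)
    qed
    then have "s * (Y * (N * v\<^sup>2) / 2 - sinh s * k) = - (1 + N * v\<^sup>2) * (g + cosh s * k)"
      using v(1) by (metis less_irrefl mult_left_cancel)
    moreover have "s * (Y * (N * v\<^sup>2) / 2) = s\<^sup>2 * v\<^sup>2 * r12"
      using N by (simp add: Y_def power2_eq_square)
    ultimately show "s\<^sup>2 * (1 - s\<^sup>2 / N) * r12 - s * sinh s * k = - (1 + (N - s\<^sup>2)) * (g + cosh s * k)"
      unfolding v(3) v(2)[symmetric] by (simp only: right_diff_distrib mult.assoc)
  qed
  \<comment> \<open>At s = c/2 and s = c/3 the quotient s^2 / N is 1/4 and 1/9, which gives two
    independent equations for \<open>r11\<close> and \<open>N * r22\<close>.\<close>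
  have "r11 * (1 / (4 * N)) + r22 * (3 / 4) = 0"
    using A0[of "c / 2"] c N by (simp add: power_divide power2_eq_square[of N])
  moreover have "r11 * (1 / (9 * N)) + r22 * (8 / 9) = 0"
    using A0[of "c / 3"] c N by (simp add: power_divide power2_eq_square[of N])
  ultimately have "r11 + 3 * (N * r22) = 0" "r11 + 8 * (N * r22) = 0"
    using N by (simp_all add: field_simps)
  then have "r11 = 0 \<and> N * r22 = 0"
    by linarith
  then show "r11 = 0" "r22 = 0"
    using N by auto
  have gk: "g = - k"
    using red[of 0] c N by auto
  \<comment> \<open>\<open>red\<close> is available only for s < c, where v > 0. The difference of
    its two sides is continuous, and at c both N - s^2 and the factor of \<open>r12\<close>
    vanish.\<close>
  define f where "f = (\<lambda>s. s\<^sup>2 * (1 - s\<^sup>2 / N) * r12 - s * sinh s * k + (1 + (N - s\<^sup>2)) * (g + cosh s * k))"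
  have "f c = 0"
  proof (rule continuous_constant_on_closure[of "{0<..<c}" f 0 c])
    show "continuous_on (closure {0<..<c}) f"
      unfolding f_def by (intro continuous_intros) (use N in auto)
    show "f x = 0" if "x \<in> {0<..<c}" for x
      using red[of x] that by (simp add: f_def flip: distrib_right)
    show "c \<in> closure {0<..<c}"
      using c by simp
  qed
  then have "k * (c * sinh c - cosh c + 1) = 0"
    using N unfolding f_def gk c(2) by (simp add: algebra_simps)
  then show k: "k = 0"
    using x_sinh_gt[OF c(1)] by simp
  then show "g = 0"
    using gk by simp
  then show "r12 = 0"
    using red[of "c / 2"] k c N by (simp add: power_divide)
qed


text \<open>Paired with the vector \<open>b'\<close> dual to \<open>b\<close>, the evenness
  equations become scalar and \<open>W\<close> can be eliminated. On each plane spanned by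
  \<open>b'\<close> and a unit vector in the kernel of \<open>b\<close> the result is the hypothesis
  of \<open>plane_rigidity\<close>; this removes the symmetric part of \<open>M\<close> and all
  pairings of \<open>S\<close> and \<open>K\<close> with \<open>b'\<close>. The vector equations
  then reduce to a relation between \<open>S *v y\<close> and \<open>K *v y\<close> whose
  coefficient varies with s.\<close>

lemma W_form_even_imp_zero:
  fixes M S K :: "real^'n^'n"
  assumes n: "CARD('n) \<ge> 2" and A: "pos_def A" and bnd: "\<And>y. y \<noteq> 0 \<Longrightarrow> \<bar>b \<bullet> y\<bar> < riemannian_length A y"
    and S: "skew S" and K: "skew K"
    and even: "\<And>y. y \<noteq> 0 \<Longrightarrow> W_form A b M S K (- y) = W_form A b M S K y"
    and b: "b \<noteq> 0"
  shows "y \<bullet> (M *v y) = 0" "S *v y = 0" "K *v y = 0"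
proof -
  define b' where "b' = matrix_inv A *v b"
  define N where "N = b \<bullet> b'"
  have Ab': "A *v b' = b"
    by (simp add: b'_def pos_def_mult_inv[OF A])
  have b'0: "b' \<noteq> 0"
    using Ab' b by auto
  have N: "N > 0"
    using pos_def_pos[OF A b'0] by (simp add: N_def Ab' inner_commute)
  \<comment> \<open>Unit vectors of the plane spanned by \<open>b'\<close> and \<open>w\<close>,
    parametrised so that \<beta>(y) / \<alpha> is exactly \<open>s\<close>; the coefficient s / N
    compensates \<open>b \<bullet> b' = N\<close>.\<close>
  have len1: "riemannian_length A ((s / N) *\<^sub>R b' + v *\<^sub>R w) = 1"
    and form1: "b \<bullet> ((s / N) *\<^sub>R b' + v *\<^sub>R w) = s"
    and nz: "(s / N) *\<^sub>R b' + v *\<^sub>R w \<noteq> 0"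
    if w: "b \<bullet> w = 0" "w \<bullet> (A *v w) = 1" and v: "v\<^sup>2 = 1 - s\<^sup>2 / N" for s v w
  proof -
    define y where "y = (s / N) *\<^sub>R b' + v *\<^sub>R w"
    have wb: "w \<bullet> b = 0" "b' \<bullet> (A *v w) = 0"
      using w pos_def_symmetric[OF A, of b' w] by (simp_all add: Ab' inner_commute)
    have "y \<bullet> (A *v y) = (s / N)\<^sup>2 * N + v\<^sup>2"
      using wb w by (simp add: y_def matrix_vector_right_distrib matrix_vector_mult_scaleR
          inner_add_left inner_add_right Ab' N_def inner_commute[of b' b] power2_eq_square)
    also have "\<dots> = 1"
      using N by (simp add: v power_divide power2_eq_square[of N])
    finally have "y \<bullet> (A *v y) = 1" .
    then show "riemannian_length A ((s / N) *\<^sub>R b' + v *\<^sub>R w) = 1" "(s / N) *\<^sub>R b' + v *\<^sub>R w \<noteq> 0"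
      unfolding y_def[symmetric] by (auto simp: riemannian_length_eq)
    show "b \<bullet> ((s / N) *\<^sub>R b' + v *\<^sub>R w) = s"
      using N w by (simp add: inner_add_right N_def)
  qed
  \<comment> \<open>Since \<open>P \<bullet> b'\<close> is \<open>q\<close>, pairing with
    \<open>b'\<close> makes both equations linear in the number \<open>W \<bullet> b'\<close>, which
    is then eliminated.\<close>
  have contracted: "s * ((y \<bullet> (M *v y)) * q / 2 - \<alpha> * sinh s * (b' \<bullet> (K *v y)))
      = - (\<alpha> * (1 + q)) * (b' \<bullet> (S *v y) + cosh s * (b' \<bullet> (K *v y)))"
    if y: "y \<noteq> 0" and \<alpha>: "\<alpha> = riemannian_length A y" and s: "s = (b \<bullet> y) / \<alpha>" and q: "q = N - s\<^sup>2"
    for y \<alpha> s q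
  proof -
    define W where "W = W_form A b M S K y"
    define P where "P = proj_form A b y"
    note e = W_form_even_equations[OF A y bnd[OF y] even[OF y], folded W_def P_def b'_def, folded \<alpha>, folded s]
    have "P \<bullet> b' = q"
      using proj_form_sharp[OF A, of b y] by (simp add: P_def b'_def q N_def s \<alpha>)
    then have e1: "(W \<bullet> b') * (1 + q) = (y \<bullet> (M *v y)) * q / 2 - \<alpha> * sinh s * (b' \<bullet> (K *v y))"
      using arg_cong[OF e(1), of "\<lambda>z. z \<bullet> b'"]
      by (simp add: inner_add_left inner_diff_left algebra_simps inner_commute[of "K *v y" b'])
    have e2: "s * (W \<bullet> b') = - \<alpha> * (b' \<bullet> (S *v y) + cosh s * (b' \<bullet> (K *v y)))"
      using arg_cong[OF e(2), of "\<lambda>z. z \<bullet> b'"]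
      by (simp add: inner_add_left inner_commute[of "K *v y" b'] inner_commute[of "S *v y" b'])
    have "s * ((W \<bullet> b') * (1 + q)) = s * (W \<bullet> b') * (1 + q)"
      by simp
    then show ?thesis
      unfolding e1 e2 by simp
  qed
  have K0: "b' \<bullet> (K *v b') = 0" "b' \<bullet> (S *v b') = 0"
    using S K by (auto simp: skew_def)
  have unit: "b' \<bullet> (M *v b') = 0 \<and> b' \<bullet> (M *v w) + w \<bullet> (M *v b') = 0 \<and> w \<bullet> (M *v w) = 0 \<and>
      b' \<bullet> (K *v w) = 0 \<and> b' \<bullet> (S *v w) = 0"
    if w: "b \<bullet> w = 0" "w \<bullet> (A *v w) = 1" for w
  proof -
    have main: "s * (((b' \<bullet> (M *v b')) * (s / N)\<^sup>2 + 2 * ((b' \<bullet> (M *v w) + w \<bullet> (M *v b')) / 2) * (s / N) * v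
          + (w \<bullet> (M *v w)) * v\<^sup>2) * (N - s\<^sup>2) / 2 - sinh s * (v * (b' \<bullet> (K *v w))))
      = - (1 + (N - s\<^sup>2)) * (v * (b' \<bullet> (S *v w)) + cosh s * (v * (b' \<bullet> (K *v w))))"
      if "s\<^sup>2 < N" and v: "v\<^sup>2 = 1 - s\<^sup>2 / N" for s v
    proof -
      define y where "y = (s / N) *\<^sub>R b' + v *\<^sub>R w"
      note y1 = len1[OF w v, folded y_def] form1[OF w v, folded y_def] nz[OF w v, folded y_def]
      have r: "y \<bullet> (M *v y) = (b' \<bullet> (M *v b')) * (s / N)\<^sup>2 +
          2 * ((b' \<bullet> (M *v w) + w \<bullet> (M *v b')) / 2) * (s / N) * v + (w \<bullet> (M *v w)) * v\<^sup>2"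
        by (simp add: y_def matrix_vector_right_distrib matrix_vector_mult_scaleR
          inner_add_left inner_add_right power2_eq_square algebra_simps)
      have k: "b' \<bullet> (K *v y) = v * (b' \<bullet> (K *v w))" "b' \<bullet> (S *v y) = v * (b' \<bullet> (S *v w))"
        by (simp_all add: y_def matrix_vector_right_distrib matrix_vector_mult_scaleR
          inner_add_right K0)
      show ?thesis
        using contracted[OF y1(3) y1(1)[symmetric], of s "N - s\<^sup>2"] unfolding r k by (simp add: y1(2))
    qed
    show ?thesis
      using plane_rigidity[OF N main] by auto
  qed
  have scaled: "\<exists>u c. w = c *\<^sub>R u \<and> b \<bullet> u = 0 \<and> u \<bullet> (A *v u) = 1" if w: "b \<bullet> w = 0" "w \<noteq> 0" for w
  proof -
    define l where "l = riemannian_length A w"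
    have l: "l > 0" "w \<bullet> (A *v w) = l * l"
      using riemannian_length_pos[OF A w(2)] riemannian_length_square[OF A, of w]
      by (auto simp: l_def power2_eq_square)
    show ?thesis
      using l w by (intro exI[of _ "(1 / l) *\<^sub>R w"] exI[of _ l]) (simp add: matrix_vector_mult_scaleR)
  qed
  have perp: "b' \<bullet> (M *v b') = 0 \<and> b' \<bullet> (M *v w) + w \<bullet> (M *v b') = 0 \<and> w \<bullet> (M *v w) = 0 \<and>
      b' \<bullet> (K *v w) = 0 \<and> b' \<bullet> (S *v w) = 0"
    if w: "b \<bullet> w = 0" "w \<noteq> 0" for w
  proof -
    obtain u c where u: "w = c *\<^sub>R u" "b \<bullet> u = 0" "u \<bullet> (A *v u) = 1"
      using scaled[OF w] by blast
    show ?thesis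
      using unit[OF u(2,3)] by (simp add: u(1) matrix_vector_mult_scaleR flip: distrib_left)
  qed
  have "2 \<le> DIM(real^'n)"
    using n by simp
  then obtain w0 where w0: "w0 \<noteq> 0" "orthogonal b w0"
    using orthogonal_to_vector_exists by blast
  have decomp: "\<exists>u w. z = u *\<^sub>R b' + w \<and> b \<bullet> w = 0" for z
    using N by (intro exI[of _ "(b \<bullet> z) / N"] exI[of _ "z - ((b \<bullet> z) / N) *\<^sub>R b'"])
      (simp add: inner_diff_right N_def)
  have b'K: "b' \<bullet> (K *v z) = 0" "b' \<bullet> (S *v z) = 0" and zM: "z \<bullet> (M *v z) = 0" for z
  proof -
    obtain u w where z: "z = u *\<^sub>R b' + w" "b \<bullet> w = 0"
      using decomp by blast
    \<comment> \<open>The component \<open>w\<close> of \<open>z\<close> may be zero, so the value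
      on \<open>b'\<close> is taken from the nonzero \<open>w0\<close>, which exists because the
      dimension is at least 2.\<close>
    have b'M: "b' \<bullet> (M *v b') = 0"
      using perp[of w0] w0 by (simp add: orthogonal_def)
    have w: "b' \<bullet> (M *v w) + w \<bullet> (M *v b') = 0 \<and> w \<bullet> (M *v w) = 0 \<and>
      b' \<bullet> (K *v w) = 0 \<and> b' \<bullet> (S *v w) = 0"
      using perp[OF z(2)] by (cases "w = 0") auto
    then show "b' \<bullet> (K *v z) = 0" "b' \<bullet> (S *v z) = 0"
      by (simp_all add: z matrix_vector_right_distrib matrix_vector_mult_scaleR inner_add_right K0)
    have "z \<bullet> (M *v z) = u * (b' \<bullet> (M *v w) + w \<bullet> (M *v b'))"
      using conjunct1[OF conjunct2[OF w]]
      by (simp add: z(1) matrix_vector_right_distrib matrix_vector_mult_scaleR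
          inner_add_left inner_add_right b'M distrib_left)
    then show "z \<bullet> (M *v z) = 0"
      using w by simp
  qed
  show "y \<bullet> (M *v y) = 0"
    by (rule zM)
  have Kb': "K *v b' = 0" "S *v b' = 0"
    using skew_inner[OF K, of _ b'] skew_inner[OF S, of _ b'] b'K by (metis inner_eq_zero_iff neg_0_equal_iff_equal)+
  \<comment> \<open>Pairing the sum equation with \<open>b'\<close> now gives
    \<open>W \<bullet> b' = 0\<close>, so W is - sinh s times \<open>K *v y\<close>; the difference
    equation then relates \<open>K *v y\<close> to \<open>S *v y\<close>.\<close>
  have reduced: "(s * sinh s - cosh s) *\<^sub>R (K *v y) = S *v y"
    if y: "y \<noteq> 0" and \<alpha>: "riemannian_length A y = 1" and s: "s = b \<bullet> y" for y s
  proof -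
    define W where "W = W_form A b M S K y"
    define P where "P = proj_form A b y"
    note e = W_form_even_equations[OF A y bnd[OF y] even[OF y], folded W_def P_def b'_def, unfolded \<alpha>, simplified, folded s]
    have Pb: "P \<bullet> b' = N - s\<^sup>2"
      using proj_form_sharp[OF A, of b y] by (simp add: P_def b'_def N_def s \<alpha>)
    have q: "N - s\<^sup>2 \<ge> 0"
      using square_ratio_le[OF A y, of b] by (simp add: N_def b'_def s \<alpha>)
    have "(W \<bullet> b') * (1 + (N - s\<^sup>2)) = 0"
      using arg_cong[OF e(1), of "\<lambda>z. z \<bullet> b'"]
      by (simp add: inner_add_left inner_diff_left algebra_simps inner_commute[of "K *v y" b'] b'K zM Pb)
    then have "W \<bullet> b' = 0"
      using q by simp
    then have "W = - (sinh s *\<^sub>R (K *v y))"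
      using e(1) by (simp add: zM)
    then show ?thesis
      using e(2) by (simp add: vec_eq_iff algebra_simps)
  qed
  have unit0: "K *v w = 0 \<and> S *v w = 0" if w: "b \<bullet> w = 0" "w \<bullet> (A *v w) = 1" for w
  proof -
    have 1: "S *v w = - (K *v w)"
    proof -
      have "riemannian_length A w = 1" "w \<noteq> 0"
        using w(2) by (auto simp: riemannian_length_eq)
      then show ?thesis
        using reduced[of w 0] w(1) by simp
    qed
    \<comment> \<open>The value s = 0 gave \<open>S *v w = - (K *v w)\<close>; a second value
      strictly between 0 and sqrt N forces \<open>K *v w\<close> to vanish. This choice has s^2 / N
      = 1/4, hence v^2 = 3/4.\<close>
    define s where "s = sqrt N / 2"
    have s: "s > 0" "s\<^sup>2 / N = 1 / 4"
      using N by (auto simp: s_def power_divide)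
    define v where "v = sqrt (3 / 4 :: real)"
    have v: "v\<^sup>2 = 1 - s\<^sup>2 / N" "v \<noteq> 0"
      by (auto simp: v_def s)
    define y where "y = (s / N) *\<^sub>R b' + v *\<^sub>R w"
    have "(s * sinh s - cosh s) *\<^sub>R (K *v y) = S *v y"
      using reduced[OF nz[OF w v(1)] len1[OF w v(1)]] form1[OF w v(1)] by (simp add: y_def)
    then have "v *\<^sub>R ((s * sinh s - cosh s + 1) *\<^sub>R (K *v w)) = 0"
      by (simp add: y_def matrix_vector_right_distrib matrix_vector_mult_scaleR Kb' 1
          vec_eq_iff algebra_simps)
    then show ?thesis
      using x_sinh_gt[OF s(1)] v(2) by (simp add: 1)
  qed
  have "K *v y = 0 \<and> S *v y = 0"
  proof -
    obtain u w where z: "y = u *\<^sub>R b' + w" "b \<bullet> w = 0"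
      using decomp by blast
    have "K *v w = 0 \<and> S *v w = 0"
    proof (cases "w = 0")
      case False
      then obtain c u where "w = c *\<^sub>R u" "b \<bullet> u = 0" "u \<bullet> (A *v u) = 1"
        using scaled[OF z(2)] by blast
      then show ?thesis
        using unit0[of u] by (simp add: matrix_vector_mult_scaleR)
    qed simp
    then show ?thesis
      by (simp add: z(1) matrix_vector_right_distrib matrix_vector_mult_scaleR Kb')
  qed
  then show "S *v y = 0" "K *v y = 0"
    by auto
qed

text \<open>With b = 0 also s = 0, and the difference equation loses \<open>W\<close>. It does not
  separate \<open>S\<close> from \<open>K\<close>.\<close>

lemma W_form_even_imp_opposite:
  fixes M S K :: "real^'n^'n"
  assumes A: "pos_def A" and y: "y \<noteq> 0"
    and even: "W_form A 0 M S K (- y) = W_form A 0 M S K y"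
  shows "S *v y + K *v y = 0"
  using W_form_even_equations(2)[OF A y _ even] riemannian_length_pos[OF A y] by simp

section \<open>The fundamental tensor in a chart\<close>

definition vsmooth :: "'a::euclidean_space set \<Rightarrow> ('a \<Rightarrow> real^'n) \<Rightarrow> bool" where
  "vsmooth S f \<longleftrightarrow> (\<forall>i. smooth_on S (\<lambda>z. f z $ i))"

definition msmooth :: "'a::euclidean_space set \<Rightarrow> ('a \<Rightarrow> real^'n^'m) \<Rightarrow> bool" where
  "msmooth S f \<longleftrightarrow> (\<forall>i j. smooth_on S (\<lambda>z. f z $ i $ j))"

lemma vsmooth_const: "vsmooth S (\<lambda>_. c)"
  by (simp add: vsmooth_def smooth_on_const)

lemma msmooth_const: "msmooth S (\<lambda>_. c)"
  by (simp add: msmooth_def smooth_on_const)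

lemma vsmooth_id: "vsmooth S (\<lambda>z. z)"
  by (simp add: vsmooth_def smooth_on_linear bounded_linear_vec_nth)

lemma vsmooth_add: "open S \<Longrightarrow> vsmooth S f \<Longrightarrow> vsmooth S g \<Longrightarrow> vsmooth S (\<lambda>z. f z + g z)"
  by (simp add: vsmooth_def smooth_on_add)

lemma vsmooth_diff: "open S \<Longrightarrow> vsmooth S f \<Longrightarrow> vsmooth S g \<Longrightarrow> vsmooth S (\<lambda>z. f z - g z)"
  by (simp add: vsmooth_def smooth_on_diff)

lemma vsmooth_scale: "open S \<Longrightarrow> smooth_on S f \<Longrightarrow> vsmooth S g \<Longrightarrow> vsmooth S (\<lambda>z. f z *\<^sub>R g z)"
  by (simp add: vsmooth_def smooth_on_mult)

lemma vsmooth_mult: "open S \<Longrightarrow> msmooth S f \<Longrightarrow> vsmooth S g \<Longrightarrow> vsmooth S (\<lambda>z. f z *v g z)"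
  by (simp add: vsmooth_def msmooth_def matrix_vector_mult_def smooth_on_sum smooth_on_mult)

lemma smooth_on_inner: "open S \<Longrightarrow> vsmooth S f \<Longrightarrow> vsmooth S g \<Longrightarrow> smooth_on S (\<lambda>z. f z \<bullet> g z)"
  by (simp add: vsmooth_def inner_vec_def smooth_on_sum smooth_on_mult)

lemma smooth_on_riemannian_length:
  assumes "open S" "msmooth S A" "vsmooth S y" "\<And>z. z \<in> S \<Longrightarrow> pos_def (A z)" "\<And>z. z \<in> S \<Longrightarrow> y z \<noteq> 0"
  shows "smooth_on S (\<lambda>z. riemannian_length (A z) (y z))"
  unfolding riemannian_length_eq
  by (intro smooth_on_sqrt smooth_on_inner vsmooth_mult assms pos_def_pos) auto

lemmas smooth_intros = smooth_on_const smooth_on_add smooth_on_diff smooth_on_minus smooth_on_mult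
  smooth_on_divide smooth_on_exp smooth_on_power smooth_on_inner smooth_on_riemannian_length
  vsmooth_const msmooth_const vsmooth_add vsmooth_diff vsmooth_scale vsmooth_mult

lemma smooth_on_fun_val:
  assumes "open S" "msmooth S A" "vsmooth S b" "vsmooth S g" "vsmooth S y"
    "\<And>z. z \<in> S \<Longrightarrow> pos_def (A z)" "\<And>z. z \<in> S \<Longrightarrow> y z \<noteq> 0"
  shows "smooth_on S (\<lambda>z. fun_val (A z) (b z) (g z) (y z))"
  unfolding fun_val_def
  by (intro smooth_intros assms) (use riemannian_length_pos assms in fastforce)+

lemma vsmooth_fun_grad:
  assumes "open S" "msmooth S A" "vsmooth S b" "vsmooth S g" "vsmooth S y"
    "\<And>z. z \<in> S \<Longrightarrow> pos_def (A z)" "\<And>z. z \<in> S \<Longrightarrow> y z \<noteq> 0"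
  shows "vsmooth S (\<lambda>z. fun_grad (A z) (b z) (g z) (y z))"
  unfolding fun_grad_def Let_def
  by (intro smooth_intros assms) (use riemannian_length_pos assms in fastforce)+

lemma smooth_on_fun_hess:
  assumes "open S" "msmooth S A" "vsmooth S b" "vsmooth S y" "vsmooth S u" "vsmooth S v"
    "\<And>z. z \<in> S \<Longrightarrow> pos_def (A z)" "\<And>z. z \<in> S \<Longrightarrow> y z \<noteq> 0"
  shows "smooth_on S (\<lambda>z. fun_hess (A z) (b z) (y z) (u z) (v z))"
  unfolding fun_hess_def Let_def
  by (intro smooth_intros assms) (use riemannian_length_pos assms in fastforce)+

lemma vsmooth_W_form:
  fixes A :: "real^'n^'n"
  assumes A: "pos_def A" and b: "\<And>y. y \<noteq> 0 \<Longrightarrow> b \<bullet> y < riemannian_length A y"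
  shows "vsmooth (- {0}) (W_form A b M S K)"
proof -
  have o: "open (- {0} :: (real^'n) set)" by (simp add: open_Compl)
  have nz: "riemannian_length A y \<noteq> 0" "1 - (b \<bullet> y) / riemannian_length A y \<noteq> 0"
    "1 - (b \<bullet> y) / riemannian_length A y + (b \<bullet> (matrix_inv A *v b) - ((b \<bullet> y) / riemannian_length A y)\<^sup>2) \<noteq> 0"
    if "y \<in> - {0}" for y
  proof -
    have y: "y \<noteq> 0" using that by simp
    show "riemannian_length A y \<noteq> 0"
      using riemannian_length_pos[OF A y] by simp
    have 1: "1 - (b \<bullet> y) / riemannian_length A y > 0"
      using riemannian_length_pos[OF A y] b[OF y] by simp
    then show "1 - (b \<bullet> y) / riemannian_length A y \<noteq> 0"
      by linarith
    show "1 - (b \<bullet> y) / riemannian_length A y + (b \<bullet> (matrix_inv A *v b) - ((b \<bullet> y) / riemannian_length A y)\<^sup>2) \<noteq> 0"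
      using 1 square_ratio_le[OF A y, of b] by linarith
  qed
  have P: "vsmooth (- {0}) (\<lambda>y. proj_form A b y)"
    unfolding proj_form_def
    by (intro smooth_intros o vsmooth_id A) (use nz in auto)
  have h: "vsmooth (- {0}) (\<lambda>y. h_form A b M S K y)"
    unfolding h_form_def
    by (intro smooth_intros o vsmooth_id A P) (use nz in auto)
  have "vsmooth (- {0}) (\<lambda>y. W_form A b M S K y)"
    unfolding W_form_def Let_def
    by (intro smooth_intros o vsmooth_id A P h nz) auto
  then show ?thesis by simp
qed

section \<open>Directional derivatives of the metric data, in the point and in the vector\<close>

definition mat_deriv :: "(real^'n \<Rightarrow> real^'n^'n) \<Rightarrow> real^'n \<Rightarrow> real^'n \<Rightarrow> real^'n^'n" where
  "mat_deriv a e x = (\<chi> i j. ddir e (\<lambda>x. a x $ i $ j) x)"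

definition vec_deriv :: "(real^'n \<Rightarrow> real^'n) \<Rightarrow> real^'n \<Rightarrow> real^'n \<Rightarrow> real^'n" where
  "vec_deriv b e x = (\<chi> i. ddir e (\<lambda>x. b x $ i) x)"

lemma has_ddir_inner_vec:
  assumes "\<And>i. (\<lambda>x. b x $ i) differentiable (at x)"
  shows "((\<lambda>t. b (x + t *\<^sub>R e) \<bullet> v) has_real_derivative vec_deriv b e x \<bullet> v) (at 0)"
  unfolding inner_vec_def inner_real_def
  by (intro DERIV_sum DERIV_cmult_right) (use has_ddir[OF assms] in \<open>simp add: vec_deriv_def\<close>)

lemma has_ddir_inner_mat:
  assumes "\<And>i j. (\<lambda>x. a x $ i $ j) differentiable (at x)"
  shows "((\<lambda>t. u \<bullet> (a (x + t *\<^sub>R e) *v v)) has_real_derivative u \<bullet> (mat_deriv a e x *v v)) (at 0)"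
  unfolding inner_matrix_sum
  by (intro DERIV_sum DERIV_cmult_right) (use has_ddir[OF assms] in \<open>simp add: mat_deriv_def\<close>)

lemma fun_grad_inner:
  "fun_grad A b g y \<bullet> u =
    exp ((b \<bullet> y) / sqrt (y \<bullet> (A *v y))) * ((1 - (b \<bullet> y) / sqrt (y \<bullet> (A *v y))) / sqrt (y \<bullet> (A *v y)) * (u \<bullet> (A *v y)) + b \<bullet> u) + g \<bullet> u"
  by (simp add: fun_grad_def Let_def riemannian_length_eq inner_add_left inner_commute[of "A *v y" u])

lemma quadratic_line_deriv:
  assumes "pos_def A"
  shows "((\<lambda>t. (y + t *\<^sub>R e) \<bullet> (A *v (y + t *\<^sub>R e))) has_real_derivative 2 * (e \<bullet> (A *v y))) (at 0)"
proof -
  have "(\<lambda>t. (y + t *\<^sub>R e) \<bullet> (A *v (y + t *\<^sub>R e))) =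
      (\<lambda>t. y \<bullet> (A *v y) + 2 * t * (e \<bullet> (A *v y)) + t\<^sup>2 * (e \<bullet> (A *v e)))"
    using pos_def_symmetric[OF assms, of y e]
    by (simp add: fun_eq_iff matrix_vector_right_distrib matrix_vector_mult_scaleR inner_add_left
        inner_add_right power2_eq_square algebra_simps)
  then show ?thesis
    by (auto intro!: derivative_eq_intros)
qed

lemma fun_val_direction_deriv:
  assumes A: "pos_def A" and y: "y \<noteq> 0"
  shows "((\<lambda>t. fun_val A b g (y + t *\<^sub>R e)) has_real_derivative fun_grad A b g y \<bullet> e) (at 0)"
proof -
  have lin: "((\<lambda>t. c \<bullet> (y + t *\<^sub>R e)) has_real_derivative c \<bullet> e) (at 0)" for c
    by (auto simp: inner_add_right intro!: derivative_eq_intros)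
  have a: "sqrt (y \<bullet> (A *v y)) > 0"
    using pos_def_pos[OF A y] by simp
  show ?thesis
    unfolding fun_val_def riemannian_length_eq
    by (rule DERIV_cong[OF fun_val_scalar_deriv[OF quadratic_line_deriv[OF A] lin lin]])
      (use pos_def_pos[OF A y] a in \<open>simp_all add: fun_grad_inner field_simps\<close>)
qed

lemma fun_grad_direction_deriv:
  assumes A: "pos_def A" and y: "y \<noteq> 0"
  shows "((\<lambda>t. fun_grad A b g (y + t *\<^sub>R e) \<bullet> u) has_real_derivative fun_hess A b y u e) (at 0)"
proof -
  have lin: "((\<lambda>t. c \<bullet> (y + t *\<^sub>R e)) has_real_derivative c \<bullet> e) (at 0)" for c
    by (auto simp: inner_add_right intro!: derivative_eq_intros)
  have lin2: "((\<lambda>t. u \<bullet> (A *v (y + t *\<^sub>R e))) has_real_derivative u \<bullet> (A *v e)) (at 0)"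
    by (auto simp: inner_add_right matrix_vector_right_distrib matrix_vector_mult_scaleR intro!: derivative_eq_intros)
  have pos: "(y + 0 *\<^sub>R e) \<bullet> (A *v (y + 0 *\<^sub>R e)) > 0"
    using pos_def_pos[OF A y] by simp
  define r where "r = sqrt (y \<bullet> (A *v y))"
  have r: "r > 0"
    using pos_def_pos[OF A y] by (simp add: r_def)
  define s where "s = (b \<bullet> y) / r"
  define E where "E = exp s"
  show ?thesis
    unfolding fun_grad_inner
  proof (rule DERIV_cong[OF fun_grad_scalar_deriv[OF quadratic_line_deriv[OF A] lin lin2 DERIV_const DERIV_const pos]])
    have "E * ((b \<bullet> e - s * (2 * (e \<bullet> (A *v y))) / (2 * r)) / r * (b \<bullet> u - s * (u \<bullet> (A *v y)) / r) +
         (1 - s) * (u \<bullet> (A *v e) / r - u \<bullet> (A *v y) * (2 * (e \<bullet> (A *v y))) / (2 * r ^ 3)) + 0) + 0 =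
      E / r * ((1 - s) * (u \<bullet> (A *v e) - (u \<bullet> (A *v y)) * (e \<bullet> (A *v y)) / (r * r)) +
          (b \<bullet> u - s * (u \<bullet> (A *v y)) / r) * (b \<bullet> e - s * (e \<bullet> (A *v y)) / r))"
    proof -
      have 1: "(b \<bullet> e - s * (2 * (e \<bullet> (A *v y))) / (2 * r)) / r * (b \<bullet> u - s * (u \<bullet> (A *v y)) / r)
        = 1 / r * ((b \<bullet> u - s * (u \<bullet> (A *v y)) / r) * (b \<bullet> e - s * (e \<bullet> (A *v y)) / r))"
        by simp
      have 2: "u \<bullet> (A *v e) / r - u \<bullet> (A *v y) * (2 * (e \<bullet> (A *v y))) / (2 * r ^ 3)
        = 1 / r * (u \<bullet> (A *v e) - (u \<bullet> (A *v y)) * (e \<bullet> (A *v y)) / (r * r))"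
        using r by (simp add: power3_eq_cube diff_divide_distrib)
      have "E * (1 / r * p + (1 - s) * (1 / r * q) + 0) + 0 = E / r * ((1 - s) * q + p)" for p q
        by (simp add: algebra_simps add_divide_distrib diff_divide_distrib)
      then show ?thesis
        unfolding 1 2 .
    qed
    then show "exp (b \<bullet> (y + 0 *\<^sub>R e) / sqrt ((y + 0 *\<^sub>R e) \<bullet> (A *v (y + 0 *\<^sub>R e)))) *
      ((b \<bullet> e - b \<bullet> (y + 0 *\<^sub>R e) / sqrt ((y + 0 *\<^sub>R e) \<bullet> (A *v (y + 0 *\<^sub>R e))) * (2 * (e \<bullet> (A *v y))) /
           (2 * sqrt ((y + 0 *\<^sub>R e) \<bullet> (A *v (y + 0 *\<^sub>R e))))) / sqrt ((y + 0 *\<^sub>R e) \<bullet> (A *v (y + 0 *\<^sub>R e))) *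
         (b \<bullet> u - b \<bullet> (y + 0 *\<^sub>R e) / sqrt ((y + 0 *\<^sub>R e) \<bullet> (A *v (y + 0 *\<^sub>R e))) * (u \<bullet> (A *v (y + 0 *\<^sub>R e))) /
            sqrt ((y + 0 *\<^sub>R e) \<bullet> (A *v (y + 0 *\<^sub>R e)))) +
       (1 - b \<bullet> (y + 0 *\<^sub>R e) / sqrt ((y + 0 *\<^sub>R e) \<bullet> (A *v (y + 0 *\<^sub>R e)))) *
         (u \<bullet> (A *v e) / sqrt ((y + 0 *\<^sub>R e) \<bullet> (A *v (y + 0 *\<^sub>R e))) -
           u \<bullet> (A *v (y + 0 *\<^sub>R e)) * (2 * (e \<bullet> (A *v y))) / (2 * sqrt ((y + 0 *\<^sub>R e) \<bullet> (A *v (y + 0 *\<^sub>R e))) ^ 3)) + 0) + 0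
      = fun_hess A b y u e"
      by (simp only: fun_hess_def Let_def riemannian_length_eq scaleR_zero_left add_0_right
          power2_eq_square r_def[symmetric] s_def[symmetric] E_def[symmetric])
  qed
qed


lemma ddir_sum:
  assumes "\<And>i. i \<in> I \<Longrightarrow> f i differentiable (at x)"
  shows "ddir e (\<lambda>x. \<Sum>i\<in>I. c i * f i x) x = (\<Sum>i\<in>I. c i * ddir e (f i) x)"
  by (intro ddirI DERIV_sum DERIV_cmult has_ddir assms)

lemma vec_sum_axis: "v = (\<Sum>i\<in>UNIV. v $ i *\<^sub>R axis i (1::real))"
  using basis_expansion[of v] by (simp add: scalar_mult_eq_scaleR)

lemma inner_axis1: "axis l 1 \<bullet> (v :: real^'n) = v $ l"
  by (simp add: inner_axis inner_commute)

text \<open>Half the exterior derivative up to sign. The second index is the direction of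
  differentiation, as in \<open>covariant_deriv\<close>, so that for \<beta> this is the skew part
  of the covariant derivative (\<open>M_antisym\<close>).\<close>

definition curl where
  "curl f x = (\<chi> i j. 1/2 * (partial j (\<lambda>x. f x $ i) x - partial i (\<lambda>x. f x $ j) x))"

lemma curl_mult:
  assumes f: "\<And>i. (\<lambda>x. f x $ i) differentiable (at x)"
  shows "(curl f x *v y) $ l = (vec_deriv f y x $ l - vec_deriv f (axis l 1) x \<bullet> y) / 2"
proof -
  have "(curl f x *v y) $ l = ((\<Sum>j\<in>UNIV. y $ j * partial j (\<lambda>x. f x $ l) x) - (\<Sum>j\<in>UNIV. partial l (\<lambda>x. f x $ j) x * y $ j)) / 2"
    by (simp add: matrix_vector_mult_def curl_def left_diff_distrib right_diff_distrib sum_subtractf sum_divide_distrib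
        diff_divide_distrib mult_ac)
  also have "(\<Sum>j\<in>UNIV. y $ j * partial j (\<lambda>x. f x $ l) x) = vec_deriv f y x $ l"
    by (simp add: vec_deriv_def ddir_eq_sum_partial[OF f, of y])
  also have "(\<Sum>j\<in>UNIV. partial l (\<lambda>x. f x $ j) x * y $ j) = vec_deriv f (axis l 1) x \<bullet> y"
    by (simp add: vec_deriv_def inner_vec_def)
  finally show ?thesis .
qed

lemma skew_curl: "skew (curl f x)"
proof -
  have "y \<bullet> (curl f x *v y) = 0" for y
  proof -
    define X where "X = (\<Sum>i\<in>UNIV. \<Sum>j\<in>UNIV. curl f x $ i $ j * y $ i * y $ j)"
    have neg: "curl f x $ j $ i * y $ j * y $ i = - (curl f x $ i $ j * y $ i * y $ j)" for i j
      by (simp add: curl_def field_simps)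
    have "X = (\<Sum>i\<in>UNIV. \<Sum>j\<in>UNIV. curl f x $ j $ i * y $ j * y $ i)"
      unfolding X_def by (rule sum.swap)
    also have "\<dots> = (\<Sum>i\<in>UNIV. \<Sum>j\<in>UNIV. - (curl f x $ i $ j * y $ i * y $ j))"
      by (intro sum.cong refl neg)
    also have "\<dots> = - X"
      by (simp only: sum_negf X_def)
    finally show ?thesis
      by (simp add: inner_matrix_sum X_def)
  qed
  then show ?thesis
    by (simp add: skew_def)
qed

lemma curl_eq_0_iff: "curl f x = 0 \<longleftrightarrow> (\<forall>i j. partial i (\<lambda>x. f x $ j) x - partial j (\<lambda>x. f x $ i) x = 0)"
  by (auto simp: curl_def vec_eq_iff)

lemma matrix_zeroI:
  fixes A :: "real^'m^'m"
  assumes "\<And>y. y \<noteq> 0 \<Longrightarrow> A *v y = 0"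
  shows "A = 0"
  by (metis assms matrix_eq matrix_vector_mult_0 matrix_vector_mult_0_right)

lemma continuous_on_det:
  fixes f :: "'a::topological_space \<Rightarrow> real^'m^'m"
  assumes "\<And>i j. continuous_on S (\<lambda>x. f x $ i $ j)"
  shows "continuous_on S (\<lambda>x. det (f x))"
  unfolding det_def by (intro continuous_intros assms)

text \<open>What the computation in one chart needs of the norm bounds: |s| < 1, which holds for
  \<open>y\<close> and \<open>- y\<close> alike and keeps the denominators of \<open>W_form\<close>
  positive, and F > 0.\<close>

locale metric_chart =
  fixes U :: "(real^'n) set" and a :: "real^'n \<Rightarrow> real^'n^'n" and b \<gamma> :: "real^'n \<Rightarrow> real^'n"
  assumes open_U: "open U"
    and a_smooth: "msmooth U a" and b_smooth: "vsmooth U b" and \<gamma>_smooth: "vsmooth U \<gamma>"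
    and a_pos: "x \<in> U \<Longrightarrow> pos_def (a x)"
    and b_bound: "x \<in> U \<Longrightarrow> y \<noteq> 0 \<Longrightarrow> \<bar>b x \<bullet> y\<bar> < riemannian_length (a x) y"
    and F_pos: "x \<in> U \<Longrightarrow> y \<noteq> 0 \<Longrightarrow> fun_val (a x) (b x) (\<gamma> x) y > 0"
begin

definition F where "F x y = fun_val (a x) (b x) (\<gamma> x) y"
definition grad where "grad x y = fun_grad (a x) (b x) (\<gamma> x) y"
definition hess where "hess x y u v = fun_hess (a x) (b x) y u v"
text \<open>The Hessian of F^2 / 2 by the product rule, as a form on arbitrary vectors instead of a
  matrix of components.\<close>

definition g where "g x y u v = F x y * hess x y u v + (grad x y \<bullet> u) * (grad x y \<bullet> v)"

lemma b_less: "x \<in> U \<Longrightarrow> y \<noteq> 0 \<Longrightarrow> b x \<bullet> y < riemannian_length (a x) y"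
  using b_bound[of x y] by simp

lemma diff_a: "x \<in> U \<Longrightarrow> (\<lambda>x. a x $ i $ j) differentiable (at x)"
  and diff_b: "x \<in> U \<Longrightarrow> (\<lambda>x. b x $ i) differentiable (at x)"
  and diff_\<gamma>: "x \<in> U \<Longrightarrow> (\<lambda>x. \<gamma> x $ i) differentiable (at x)"
  using a_smooth b_smooth \<gamma>_smooth smooth_on_imp_differentiable[OF open_U]
  by (auto simp: msmooth_def vsmooth_def)

lemma smooth_F_x: "y \<noteq> 0 \<Longrightarrow> smooth_on U (\<lambda>x. F x y)"
  and smooth_grad_x: "y \<noteq> 0 \<Longrightarrow> smooth_on U (\<lambda>x. grad x y \<bullet> u)"
  and smooth_hess_x: "y \<noteq> 0 \<Longrightarrow> smooth_on U (\<lambda>x. hess x y u v)"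
  unfolding F_def grad_def hess_def
  by (intro smooth_on_fun_val smooth_on_inner vsmooth_fun_grad smooth_on_fun_hess vsmooth_const
      open_U a_smooth b_smooth \<gamma>_smooth a_pos; assumption)+

lemma smooth_g_x: "y \<noteq> 0 \<Longrightarrow> smooth_on U (\<lambda>x. g x y u v)"
  unfolding g_def
  by (intro smooth_on_add smooth_on_mult smooth_F_x smooth_grad_x smooth_hess_x open_U)

lemma g_commute: "x \<in> U \<Longrightarrow> g x y u v = g x y v u"
  unfolding g_def hess_def by (subst fun_hess_commute[OF a_pos]) (simp_all add: mult.commute)

lemma g_add: "g x y u (v + w) = g x y u v + g x y u w"
  by (simp add: g_def hess_def fun_hess_add inner_add_right algebra_simps)

lemma g_scale: "g x y u (c *\<^sub>R v) = c * g x y u v"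
  by (simp add: g_def hess_def fun_hess_scale algebra_simps)

lemma linear_g: "linear (g x y u)"
  by (rule linearI) (simp_all add: g_add g_scale)

lemma g_sum: "(\<Sum>j\<in>UNIV. v $ j * g x y u (axis j 1)) = g x y u v"
proof -
  interpret linear "g x y u" by (rule linear_g)
  have "g x y u v = g x y u (\<Sum>j\<in>UNIV. v $ j *\<^sub>R axis j 1)"
    by (rule arg_cong[OF vec_sum_axis])
  then show ?thesis
    by (simp add: sum scale)
qed

lemma grad_self: "x \<in> U \<Longrightarrow> y \<noteq> 0 \<Longrightarrow> grad x y \<bullet> y = F x y"
  by (simp add: grad_def F_def fun_grad_self a_pos)

lemma hess_self: "x \<in> U \<Longrightarrow> y \<noteq> 0 \<Longrightarrow> hess x y u y = 0"
  by (simp add: hess_def fun_hess_self a_pos)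

lemma g_self: "x \<in> U \<Longrightarrow> y \<noteq> 0 \<Longrightarrow> g x y u y = F x y * (grad x y \<bullet> u)"
  by (simp add: g_def grad_self hess_self)

text \<open>The Hessian of F is positive transversally to \<open>y\<close>. Along \<open>y\<close>
  it vanishes, and the square of the gradient takes over because \<open>grad x y \<bullet> y\<close>
  is F > 0.\<close>

lemma g_pos:
  assumes x: "x \<in> U" and y: "y \<noteq> 0" and v: "v \<noteq> 0"
  shows "g x y v v > 0"
proof (cases "\<exists>c. v = c *\<^sub>R y")
  case True
  then obtain c where c: "v = c *\<^sub>R y" by blast
  then have "c \<noteq> 0" using v by auto
  have "hess x y v v = 0"
    unfolding c hess_def fun_hess_scale using fun_hess_self[OF a_pos[OF x] y] by simp
  then show ?thesis
    using F_pos[OF x y] \<open>c \<noteq> 0\<close> by (auto simp: g_def c grad_self[OF x y] F_def zero_less_mult_iff mult_less_0_iff)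
next
  case False
  then have "hess x y v v > 0"
    unfolding hess_def using fun_hess_diag(2)[OF a_pos[OF x] y b_less[OF x y], of v] by blast
  then show ?thesis
    using F_pos[OF x y] by (simp add: g_def F_def add_pos_nonneg)
qed

lemma fundamental_tensor_eq:
  assumes x: "x \<in> U" and y: "y \<noteq> 0"
  shows "fundamental_tensor F x y = (\<chi> i j. g x y (axis i 1) (axis j 1))"
proof -
  have 1: "partial i (\<lambda>y. (F x y)\<^sup>2) y = 2 * F x y * (grad x y \<bullet> axis i 1)" if "y \<noteq> 0" for i y
  proof (rule ddirI)
    show "((\<lambda>t. (F x (y + t *\<^sub>R axis i 1))\<^sup>2) has_real_derivative 2 * F x y * (grad x y \<bullet> axis i 1)) (at 0)"
      unfolding F_def grad_def
      by (auto intro!: derivative_eq_intros fun_val_direction_deriv[OF a_pos[OF x] that])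
  qed
  have o: "open (- {0} :: (real^'n) set)" by (simp add: open_Compl)
  have "1 / 2 * partial j (partial i (\<lambda>y. (F x y)\<^sup>2)) y = g x y (axis i 1) (axis j 1)" for i j
  proof -
    have "partial j (partial i (\<lambda>y. (F x y)\<^sup>2)) y = partial j (\<lambda>y. 2 * F x y * (grad x y \<bullet> axis i 1)) y"
      by (rule ddir_cong[OF o]) (use y 1 in auto)
    also have "\<dots> = 2 * g x y (axis i 1) (axis j 1)"
    proof (rule ddirI)
      show "((\<lambda>t. 2 * F x (y + t *\<^sub>R axis j 1) * (grad x (y + t *\<^sub>R axis j 1) \<bullet> axis i 1))
         has_real_derivative 2 * g x y (axis i 1) (axis j 1)) (at 0)"
        unfolding F_def grad_def
        by (rule DERIV_cong[OF DERIV_mult[OF DERIV_cmult[OF fun_val_direction_deriv[OF a_pos[OF x] y]]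
            fun_grad_direction_deriv[OF a_pos[OF x] y]]])
          (simp add: g_def F_def grad_def hess_def)
    qed
    finally show ?thesis by simp
  qed
  then show ?thesis
    by (simp add: fundamental_tensor_def vec_eq_iff)
qed

lemma fundamental_tensor_mult:
  assumes x: "x \<in> U" and y: "y \<noteq> 0"
  shows "(fundamental_tensor F x y *v v) $ i = g x y (axis i 1) v"
  by (simp add: fundamental_tensor_eq[OF x y] matrix_vector_mult_def mult.commute flip: g_sum[of v])

lemma fundamental_tensor_pos_def:
  assumes x: "x \<in> U" and y: "y \<noteq> 0"
  shows "pos_def (fundamental_tensor F x y)"
proof -
  have "v \<bullet> (fundamental_tensor F x y *v v) = g x y v v" for v
  proof -
    have "v \<bullet> (fundamental_tensor F x y *v v) = (\<Sum>i\<in>UNIV. v $ i * g x y v (axis i 1))"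
      by (simp add: inner_vec_def fundamental_tensor_mult[OF x y] g_commute[OF x, of y _ v])
    then show ?thesis
      by (simp add: g_sum)
  qed
  moreover have "transpose (fundamental_tensor F x y) = fundamental_tensor F x y"
    using g_commute[OF x] by (simp add: fundamental_tensor_eq[OF x y] transpose_def vec_eq_iff)
  ultimately show ?thesis
    using g_pos[OF x y] by (simp add: pos_def_def)
qed

text \<open>By Euler's identities g(y, u) = F dF(u) and g(y, y) = F^2. As y stays fixed under
  differentiation in x, contracting the three derivative terms of the spray with y twice leaves
  twice the right-hand side of assumption \<open>Z\<close>; positive definiteness of the tensor then
  determines the solution.\<close>

lemma spray_coeff_eqI:
  assumes x: "x \<in> U" and y: "y \<noteq> 0"
    and Z: "\<And>l. 2 * g x y (axis l 1) Z = ddir y (\<lambda>x. F x y * (grad x y \<bullet> axis l 1)) x - F x y * partial l (\<lambda>x. F x y) x"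
  shows "spray_coeff F x y i = Z $ i"
proof -
  let ?e = "\<lambda>i. axis i 1 :: real^'n"
  have smd: "f differentiable (at x)" if "smooth_on U f" for f
    by (rule smooth_on_imp_differentiable[OF open_U that x])
  have p: "partial k (\<lambda>x. fundamental_tensor F x y $ i $ j) x = partial k (\<lambda>x. g x y (?e i) (?e j)) x" for i j k
    by (rule ddir_cong[OF open_U x]) (simp add: fundamental_tensor_eq[OF _ y])
  define R where "R = (\<chi> l. \<Sum>j\<in>UNIV. \<Sum>k\<in>UNIV.
     (partial k (\<lambda>x. g x y (?e j) (?e l)) x + partial j (\<lambda>x. g x y (?e l) (?e k)) x - partial l (\<lambda>x. g x y (?e j) (?e k)) x) * y $ j * y $ k)"
  have s1: "(\<Sum>j\<in>UNIV. \<Sum>k\<in>UNIV. partial k (\<lambda>x. g x y (?e j) (?e l)) x * y $ j * y $ k) =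
      ddir y (\<lambda>x. F x y * (grad x y \<bullet> ?e l)) x" for l
  proof -
    have "(\<Sum>j\<in>UNIV. \<Sum>k\<in>UNIV. partial k (\<lambda>x. g x y (?e j) (?e l)) x * y $ j * y $ k) =
      (\<Sum>k\<in>UNIV. y $ k * (\<Sum>j\<in>UNIV. y $ j * partial k (\<lambda>x. g x y (?e j) (?e l)) x))"
      by (subst sum.swap) (simp add: sum_distrib_left mult_ac)
    also have "\<dots> = (\<Sum>k\<in>UNIV. y $ k * partial k (\<lambda>x. \<Sum>j\<in>UNIV. y $ j * g x y (?e j) (?e l)) x)"
      by (subst ddir_sum) (auto intro!: smd smooth_g_x y)
    also have "\<dots> = (\<Sum>k\<in>UNIV. y $ k * partial k (\<lambda>x. F x y * (grad x y \<bullet> ?e l)) x)"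
    proof (intro sum.cong refl arg_cong[where f = "(*) _"] ddir_cong[OF open_U x])
      fix z assume z: "z \<in> U"
      have "(\<Sum>j\<in>UNIV. y $ j * g z y (?e j) (?e l)) = (\<Sum>j\<in>UNIV. y $ j * g z y (?e l) (?e j))"
        by (intro sum.cong refl arg_cong[where f = "(*) _"] g_commute[OF z])
      then show "(\<Sum>j\<in>UNIV. y $ j * g z y (?e j) (?e l)) = F z y * (grad z y \<bullet> ?e l)"
        by (simp add: g_sum g_self[OF z y])
    qed
    also have "\<dots> = ddir y (\<lambda>x. F x y * (grad x y \<bullet> ?e l)) x"
      by (subst ddir_eq_sum_partial[where e = y]) (auto intro!: smd smooth_on_mult smooth_F_x smooth_grad_x y open_U)
    finally show ?thesis .
  qed
  have s2: "(\<Sum>j\<in>UNIV. \<Sum>k\<in>UNIV. partial j (\<lambda>x. g x y (?e l) (?e k)) x * y $ j * y $ k) =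
      ddir y (\<lambda>x. F x y * (grad x y \<bullet> ?e l)) x" for l
  proof -
    have "partial j (\<lambda>x. g x y (?e l) (?e k)) x = partial j (\<lambda>x. g x y (?e k) (?e l)) x" for j k
      by (rule ddir_cong[OF open_U x g_commute])
    then show ?thesis
      unfolding s1[symmetric] by (subst sum.swap) (simp add: mult_ac)
  qed
  have s3: "(\<Sum>j\<in>UNIV. \<Sum>k\<in>UNIV. partial l (\<lambda>x. g x y (?e j) (?e k)) x * y $ j * y $ k) =
      2 * F x y * partial l (\<lambda>x. F x y) x" for l
  proof -
    have "(\<Sum>j\<in>UNIV. \<Sum>k\<in>UNIV. partial l (\<lambda>x. g x y (?e j) (?e k)) x * y $ j * y $ k) =
      (\<Sum>j\<in>UNIV. y $ j * (\<Sum>k\<in>UNIV. y $ k * partial l (\<lambda>x. g x y (?e j) (?e k)) x))"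
      by (simp add: sum_distrib_left mult_ac)
    also have "\<dots> = (\<Sum>j\<in>UNIV. y $ j * partial l (\<lambda>x. \<Sum>k\<in>UNIV. y $ k * g x y (?e j) (?e k)) x)"
      by (subst ddir_sum) (auto intro!: smd smooth_g_x y)
    also have "\<dots> = (\<Sum>j\<in>UNIV. y $ j * partial l (\<lambda>x. F x y * (grad x y \<bullet> ?e j)) x)"
      by (intro sum.cong refl arg_cong[where f = "(*) _"] ddir_cong[OF open_U x])
        (simp add: g_sum g_self y)
    also have "\<dots> = partial l (\<lambda>x. \<Sum>j\<in>UNIV. y $ j * (F x y * (grad x y \<bullet> ?e j))) x"
      by (subst ddir_sum) (auto intro!: smd smooth_on_mult smooth_F_x smooth_grad_x y open_U)
    also have "\<dots> = partial l (\<lambda>x. (F x y)\<^sup>2) x"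
    proof (rule ddir_cong[OF open_U x])
      fix z assume z: "z \<in> U"
      have "(\<Sum>j\<in>UNIV. y $ j * (F z y * (grad z y \<bullet> ?e j))) = F z y * (\<Sum>j\<in>UNIV. y $ j * grad z y $ j)"
        by (simp add: inner_axis sum_distrib_left mult_ac)
      also have "(\<Sum>j\<in>UNIV. y $ j * grad z y $ j) = F z y"
        using grad_self[OF z y] by (simp add: inner_vec_def mult.commute)
      finally show "(\<Sum>j\<in>UNIV. y $ j * (F z y * (grad z y \<bullet> ?e j))) = (F z y)\<^sup>2"
        by (simp add: power2_eq_square)
    qed
    also have "\<dots> = 2 * F x y * partial l (\<lambda>x. F x y) x"
    proof (rule ddirI)
      have "((\<lambda>t. F (x + t *\<^sub>R axis l 1) y) has_real_derivative partial l (\<lambda>x. F x y) x) (at 0)"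
        by (intro has_ddir smd smooth_F_x y)
      from DERIV_power[OF this, of 2]
      show "((\<lambda>t. (F (x + t *\<^sub>R axis l 1) y)\<^sup>2) has_real_derivative 2 * F x y * partial l (\<lambda>x. F x y) x) (at 0)"
        by (simp add: mult_ac)
    qed
    finally show ?thesis .
  qed
  have "R $ l = 4 * g x y (?e l) Z" for l
  proof -
    have "R $ l = 2 * ddir y (\<lambda>x. F x y * (grad x y \<bullet> ?e l)) x - 2 * F x y * partial l (\<lambda>x. F x y) x"
      unfolding R_def vec_lambda_beta distrib_right left_diff_distrib sum_subtractf sum.distrib s1 s2 s3 by simp
    then show ?thesis
      using Z[of l] by simp
  qed
  then have R: "R = 4 *\<^sub>R (fundamental_tensor F x y *v Z)"
    by (simp add: vec_eq_iff fundamental_tensor_mult[OF x y])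
  have "spray_coeff F x y i = 1 / 4 * (matrix_inv (fundamental_tensor F x y) *v R) $ i"
    unfolding spray_coeff_def p
    by (simp add: R_def matrix_vector_mult_def sum_distrib_left mult.assoc)
  also have "\<dots> = Z $ i"
    unfolding R matrix_vector_mult_scaleR pos_def_inv_mult[OF fundamental_tensor_pos_def[OF x y]] by simp
  finally show ?thesis .
qed

end

section \<open>The spray\<close>

context metric_chart
begin

section \<open>The components of the spray of F and the equation that determines them\<close>

definition Ga where
  "Ga x y = (\<chi> i. 1/2 * (\<Sum>j\<in>UNIV. \<Sum>k\<in>UNIV. christoffel a x i j k * y $ j * y $ k))"

definition M where "M x = (\<chi> i j. covariant_deriv a b x i j)"

definition W where "W x y = matrix_inv (a x) *v W_form (a x) (b x) (M x) (curl b x) (curl \<gamma> x) y"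

text \<open>The Hessian of F cannot see multiples of \<open>y\<close>. This multiple is the one that
  makes \<open>grad x y \<bullet> Z x y\<close> half the derivative of F in x along
  \<open>y\<close>.\<close>

definition P where
  "P x y = (1/2 * ddir y (\<lambda>x. F x y) x - grad x y \<bullet> (Ga x y + W x y)) / F x y"

definition Z where "Z x y = Ga x y + W x y + P x y *\<^sub>R y"

lemma F_x_deriv:
  assumes x: "x \<in> U" and y: "y \<noteq> 0"
  defines "\<alpha> \<equiv> riemannian_length (a x) y"
  defines "s \<equiv> (b x \<bullet> y) / \<alpha>"
  shows "ddir e (\<lambda>x. F x y) x =
    exp s * ((1 - s) * (y \<bullet> (mat_deriv a e x *v y)) / (2 * \<alpha>) + vec_deriv b e x \<bullet> y) + vec_deriv \<gamma> e x \<bullet> y"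
proof (rule ddirI)
  have pos: "y \<bullet> (a (x + 0 *\<^sub>R e) *v y) > 0"
    using pos_def_pos[OF a_pos[OF x] y] by simp
  show "((\<lambda>t. F (x + t *\<^sub>R e) y) has_real_derivative
    exp s * ((1 - s) * (y \<bullet> (mat_deriv a e x *v y)) / (2 * \<alpha>) + vec_deriv b e x \<bullet> y) + vec_deriv \<gamma> e x \<bullet> y) (at 0)"
    unfolding F_def fun_val_def riemannian_length_eq
    by (rule DERIV_cong[OF fun_val_scalar_deriv[OF has_ddir_inner_mat[where a = a and x = x and e = e and u = y and v = y]
        has_ddir_inner_vec[where b = b and x = x and e = e and v = y] has_ddir_inner_vec[where b = \<gamma> and x = x and e = e and v = y] pos]])
      (simp_all add: diff_a diff_b diff_\<gamma> x s_def \<alpha>_def riemannian_length_eq)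
qed

lemma grad_x_deriv:
  assumes x: "x \<in> U" and y: "y \<noteq> 0"
  defines "\<alpha> \<equiv> riemannian_length (a x) y"
  defines "s \<equiv> (b x \<bullet> y) / \<alpha>"
  shows "ddir e (\<lambda>x. grad x y \<bullet> u) x =
    exp s * ((vec_deriv b e x \<bullet> y - s * (y \<bullet> (mat_deriv a e x *v y)) / (2 * \<alpha>)) / \<alpha> *
        (b x \<bullet> u - s * (u \<bullet> (a x *v y)) / \<alpha>) +
      (1 - s) * ((u \<bullet> (mat_deriv a e x *v y)) / \<alpha> - (u \<bullet> (a x *v y)) * (y \<bullet> (mat_deriv a e x *v y)) / (2 * \<alpha> ^ 3)) +
      vec_deriv b e x \<bullet> u) + vec_deriv \<gamma> e x \<bullet> u"
proof (rule ddirI)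
  have pos: "y \<bullet> (a (x + 0 *\<^sub>R e) *v y) > 0"
    using pos_def_pos[OF a_pos[OF x] y] by simp
  show "((\<lambda>t. grad (x + t *\<^sub>R e) y \<bullet> u) has_real_derivative
    exp s * ((vec_deriv b e x \<bullet> y - s * (y \<bullet> (mat_deriv a e x *v y)) / (2 * \<alpha>)) / \<alpha> *
        (b x \<bullet> u - s * (u \<bullet> (a x *v y)) / \<alpha>) +
      (1 - s) * ((u \<bullet> (mat_deriv a e x *v y)) / \<alpha> - (u \<bullet> (a x *v y)) * (y \<bullet> (mat_deriv a e x *v y)) / (2 * \<alpha> ^ 3)) +
      vec_deriv b e x \<bullet> u) + vec_deriv \<gamma> e x \<bullet> u) (at 0)"
    unfolding grad_def fun_grad_inner
    by (rule DERIV_cong[OF fun_grad_scalar_deriv[OF has_ddir_inner_mat[where a = a and x = x and e = e and u = y and v = y]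
        has_ddir_inner_vec[where b = b and x = x and e = e and v = y] has_ddir_inner_mat[where a = a and x = x and e = e and u = u and v = y]
        has_ddir_inner_vec[where b = b and x = x and e = e and v = u] has_ddir_inner_vec[where b = \<gamma> and x = x and e = e and v = u] pos]])
      (simp_all add: diff_a diff_b diff_\<gamma> x s_def \<alpha>_def riemannian_length_eq)
qed

lemma mat_deriv_sum:
  "x \<in> U \<Longrightarrow> (\<Sum>k\<in>UNIV. e $ k * mat_deriv a (axis k 1) x $ i $ j) = mat_deriv a e x $ i $ j"
  by (simp add: mat_deriv_def ddir_eq_sum_partial[OF diff_a, of x e])

lemma vec_deriv_sum_b: "x \<in> U \<Longrightarrow> (\<Sum>k\<in>UNIV. e $ k * vec_deriv b (axis k 1) x $ i) = vec_deriv b e x $ i"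
  and vec_deriv_sum_\<gamma>: "x \<in> U \<Longrightarrow> (\<Sum>k\<in>UNIV. e $ k * vec_deriv \<gamma> (axis k 1) x $ i) = vec_deriv \<gamma> e x $ i"
  by (simp_all add: vec_deriv_def ddir_eq_sum_partial[OF diff_b, of x e] ddir_eq_sum_partial[OF diff_\<gamma>, of x e])

lemma mat_deriv_symmetric: 
  assumes "x \<in> U"
  shows "mat_deriv a e x $ i $ j = mat_deriv a e x $ j $ i"
proof -
  have "a z $ i $ j = a z $ j $ i" if "z \<in> U" for z
    using a_pos[OF that] unfolding pos_def_def transpose_def by (metis vec_lambda_beta)
  then show ?thesis
    unfolding mat_deriv_def vec_lambda_beta by (rule ddir_cong[OF open_U assms])
qed

text \<open>Lowering the index cancels the inverse metric in the Christoffel symbols; contracted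
  with y twice, two of the three derivative terms coincide by symmetry of \<open>a\<close>.\<close>

lemma a_Ga:
  assumes x: "x \<in> U"
  shows "(a x *v Ga x y) $ l = (mat_deriv a y x *v y) $ l / 2 - y \<bullet> (mat_deriv a (axis l 1) x *v y) / 4"
proof -
  define C where "C l j k = mat_deriv a (axis j 1) x $ k $ l + mat_deriv a (axis k 1) x $ j $ l - mat_deriv a (axis l 1) x $ j $ k" for l j k
  define c where "c = (\<chi> l. 1/4 * (\<Sum>j\<in>UNIV. \<Sum>k\<in>UNIV. C l j k * y $ j * y $ k))"
  have "Ga x y = matrix_inv (a x) *v c"
  proof -
    have "christoffel a x i j k = (\<Sum>l\<in>UNIV. matrix_inv (a x) $ i $ l * (1/2 * C l j k))" for i j k
      by (simp add: christoffel_def C_def mat_deriv_def sum_distrib_left)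
    then have "Ga x y $ i = 1/2 * (\<Sum>j\<in>UNIV. \<Sum>k\<in>UNIV. \<Sum>l\<in>UNIV. matrix_inv (a x) $ i $ l * (1/2 * C l j k) * y $ j * y $ k)" for i
      by (simp add: Ga_def sum_distrib_right)
    also have "\<dots> i = 1/2 * (\<Sum>j\<in>UNIV. \<Sum>l\<in>UNIV. \<Sum>k\<in>UNIV. matrix_inv (a x) $ i $ l * (1/2 * C l j k) * y $ j * y $ k)" for i
      by (intro arg_cong[where f = "(*) _"] sum.cong refl sum.swap)
    also have "\<dots> i = 1/2 * (\<Sum>l\<in>UNIV. \<Sum>j\<in>UNIV. \<Sum>k\<in>UNIV. matrix_inv (a x) $ i $ l * (1/2 * C l j k) * y $ j * y $ k)" for i
      by (intro arg_cong[where f = "(*) _"] sum.swap)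
    also have "\<dots> i = (matrix_inv (a x) *v c) $ i" for i
      by (simp add: c_def matrix_vector_mult_def sum_distrib_left mult_ac)
    finally show ?thesis
      by (simp add: vec_eq_iff)
  qed
  then have "(a x *v Ga x y) $ l = c $ l"
    by (simp add: pos_def_mult_inv[OF a_pos[OF x]])
  also have "\<dots> = 1/4 * ((\<Sum>j\<in>UNIV. \<Sum>k\<in>UNIV. mat_deriv a (axis j 1) x $ k $ l * y $ j * y $ k) +
      (\<Sum>j\<in>UNIV. \<Sum>k\<in>UNIV. mat_deriv a (axis k 1) x $ j $ l * y $ j * y $ k) -
      (\<Sum>j\<in>UNIV. \<Sum>k\<in>UNIV. mat_deriv a (axis l 1) x $ j $ k * y $ j * y $ k))"
    by (simp add: c_def C_def distrib_right left_diff_distrib sum.distrib sum_subtractf)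
  also have "(\<Sum>j\<in>UNIV. \<Sum>k\<in>UNIV. mat_deriv a (axis k 1) x $ j $ l * y $ j * y $ k) = (mat_deriv a y x *v y) $ l"
  proof -
    have "(mat_deriv a y x *v y) $ l = (\<Sum>j\<in>UNIV. (\<Sum>k\<in>UNIV. y $ k * mat_deriv a (axis k 1) x $ j $ l) * y $ j)"
      by (simp add: matrix_vector_mult_def mat_deriv_sum[OF x] mat_deriv_symmetric[OF x, of _ l])
    then show ?thesis
      by (simp add: sum_distrib_left mult_ac)
  qed
  also have "(\<Sum>j\<in>UNIV. \<Sum>k\<in>UNIV. mat_deriv a (axis j 1) x $ k $ l * y $ j * y $ k) = (mat_deriv a y x *v y) $ l"
  proof -
    have "(mat_deriv a y x *v y) $ l = (\<Sum>k\<in>UNIV. (\<Sum>j\<in>UNIV. y $ j * mat_deriv a (axis j 1) x $ k $ l) * y $ k)"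
      by (simp add: matrix_vector_mult_def mat_deriv_sum[OF x] mat_deriv_symmetric[OF x, of _ l])
    then show ?thesis
      by (subst sum.swap) (simp add: sum_distrib_left mult_ac)
  qed
  also have "(\<Sum>j\<in>UNIV. \<Sum>k\<in>UNIV. mat_deriv a (axis l 1) x $ j $ k * y $ j * y $ k) = y \<bullet> (mat_deriv a (axis l 1) x *v y)"
    by (simp add: inner_matrix_sum)
  finally show ?thesis
    by simp
qed

text \<open>Contracting \<open>a_Ga\<close> with y makes its two terms proportional, with total
  factor 1/2 - 1/4.\<close>

lemma y_a_Ga:
  assumes x: "x \<in> U"
  shows "y \<bullet> (a x *v Ga x y) = y \<bullet> (mat_deriv a y x *v y) / 4"
proof -
  have "(\<Sum>l\<in>UNIV. y $ l * (y \<bullet> (mat_deriv a (axis l 1) x *v y))) =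
      (\<Sum>l\<in>UNIV. \<Sum>i\<in>UNIV. \<Sum>j\<in>UNIV. y $ l * mat_deriv a (axis l 1) x $ i $ j * y $ i * y $ j)"
    by (simp add: inner_matrix_sum sum_distrib_left mult_ac)
  also have "\<dots> = (\<Sum>i\<in>UNIV. \<Sum>l\<in>UNIV. \<Sum>j\<in>UNIV. y $ l * mat_deriv a (axis l 1) x $ i $ j * y $ i * y $ j)"
    by (rule sum.swap)
  also have "\<dots> = (\<Sum>i\<in>UNIV. \<Sum>j\<in>UNIV. \<Sum>l\<in>UNIV. y $ l * mat_deriv a (axis l 1) x $ i $ j * y $ i * y $ j)"
    by (intro sum.cong refl sum.swap)
  also have "\<dots> = y \<bullet> (mat_deriv a y x *v y)"
    by (simp add: inner_matrix_sum mat_deriv_sum[OF x] flip: sum_distrib_right)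
  finally have 1: "(\<Sum>l\<in>UNIV. y $ l * (y \<bullet> (mat_deriv a (axis l 1) x *v y))) = y \<bullet> (mat_deriv a y x *v y)" .
  have "y \<bullet> (a x *v Ga x y) = (\<Sum>l\<in>UNIV. y $ l * (a x *v Ga x y) $ l)"
    by (simp add: inner_vec_def)
  also have "\<dots> = (\<Sum>l\<in>UNIV. y $ l * (mat_deriv a y x *v y) $ l) / 2 -
      (\<Sum>l\<in>UNIV. y $ l * (y \<bullet> (mat_deriv a (axis l 1) x *v y))) / 4"
    by (simp add: a_Ga[OF x] right_diff_distrib sum_subtractf sum_divide_distrib)
  also have "(\<Sum>l\<in>UNIV. y $ l * (mat_deriv a y x *v y) $ l) = y \<bullet> (mat_deriv a y x *v y)"
    by (simp add: inner_vec_def)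
  finally show ?thesis
    unfolding 1 by simp
qed

text \<open>The factor 2 undoes the 1/2 in \<open>Ga\<close>. This rewrites the covariant term of
  \<open>h_form\<close> in the partial derivatives that occur in
  \<open>rapcsak_identity\<close>.\<close>

lemma y_M_y:
  assumes x: "x \<in> U"
  shows "y \<bullet> (M x *v y) = vec_deriv b y x \<bullet> y - 2 * (b x \<bullet> Ga x y)"
proof -
  have 1: "(\<Sum>i\<in>UNIV. \<Sum>j\<in>UNIV. partial j (\<lambda>x. b x $ i) x * y $ i * y $ j) = vec_deriv b y x \<bullet> y"
  proof -
    have "vec_deriv b y x \<bullet> y = (\<Sum>i\<in>UNIV. (\<Sum>j\<in>UNIV. y $ j * vec_deriv b (axis j 1) x $ i) * y $ i)"
      by (simp add: inner_vec_def vec_deriv_sum_b[OF x])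
    then show ?thesis
      by (simp add: vec_deriv_def sum_distrib_left mult_ac)
  qed
  have 2: "(\<Sum>i\<in>UNIV. \<Sum>j\<in>UNIV. \<Sum>k\<in>UNIV. christoffel a x k i j * b x $ k * y $ i * y $ j) = 2 * (b x \<bullet> Ga x y)"
  proof -
    have "(\<Sum>i\<in>UNIV. \<Sum>j\<in>UNIV. \<Sum>k\<in>UNIV. christoffel a x k i j * b x $ k * y $ i * y $ j) =
      (\<Sum>i\<in>UNIV. \<Sum>k\<in>UNIV. \<Sum>j\<in>UNIV. christoffel a x k i j * b x $ k * y $ i * y $ j)"
      by (intro sum.cong refl sum.swap)
    also have "\<dots> = (\<Sum>k\<in>UNIV. \<Sum>i\<in>UNIV. \<Sum>j\<in>UNIV. christoffel a x k i j * b x $ k * y $ i * y $ j)"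
      by (rule sum.swap)
    also have "\<dots> = 2 * (b x \<bullet> Ga x y)"
      by (simp add: inner_vec_def Ga_def sum_distrib_left mult_ac)
    finally show ?thesis .
  qed
  have "y \<bullet> (M x *v y) = (\<Sum>i\<in>UNIV. \<Sum>j\<in>UNIV. partial j (\<lambda>x. b x $ i) x * y $ i * y $ j) -
      (\<Sum>i\<in>UNIV. \<Sum>j\<in>UNIV. \<Sum>k\<in>UNIV. christoffel a x k i j * b x $ k * y $ i * y $ j)"
    by (simp add: inner_matrix_sum M_def covariant_deriv_def left_diff_distrib sum_subtractf sum_distrib_right)
  then show ?thesis
    unfolding 1 2 .
qed

text \<open>
  Rapcsak's equation: the Hessian of \<open>F\<close>, whose kernel is spanned by \<open>y\<close>, determines the spray up to
  multiples of \<open>y\<close>; \<open>W\<close> is what is left of it after the spray \<open>Ga\<close> of \<open>\<alpha>\<close>.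
\<close>

lemma rapcsak:
  assumes x: "x \<in> U" and y: "y \<noteq> 0"
  shows "ddir y (\<lambda>x. grad x y \<bullet> axis l 1) x - partial l (\<lambda>x. F x y) x = 2 * hess x y (axis l 1) (Ga x y + W x y)"
proof -
  define \<alpha> where "\<alpha> = riemannian_length (a x) y"
  define s where "s = (b x \<bullet> y) / \<alpha>"
  let ?u = "axis l 1 :: real^'n"
  have \<alpha>: "\<alpha> > 0"
    using riemannian_length_pos[OF a_pos[OF x] y] by (simp add: \<alpha>_def)
  have proj: "?u \<bullet> proj_form (a x) (b x) y = b x \<bullet> ?u - s * (?u \<bullet> (a x *v y)) / \<alpha>"
    by (simp add: proj_form_def \<alpha>_def s_def inner_diff_right power2_eq_square inner_commute)
  have S: "?u \<bullet> (curl b x *v y) = (vec_deriv b y x \<bullet> ?u - vec_deriv b ?u x \<bullet> y) / 2"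
    and K: "?u \<bullet> (curl \<gamma> x *v y) = (vec_deriv \<gamma> y x \<bullet> ?u - vec_deriv \<gamma> ?u x \<bullet> y) / 2"
    by (simp_all add: inner_axis1 inner_axis curl_mult diff_b diff_\<gamma> x)
  have W': "hess x y ?u (W x y) = exp s / \<alpha> * ((vec_deriv b y x \<bullet> y - 2 * (b x \<bullet> Ga x y)) / 2 *
        (b x \<bullet> ?u - s * (?u \<bullet> (a x *v y)) / \<alpha>) +
      \<alpha> * ((vec_deriv b y x \<bullet> ?u - vec_deriv b ?u x \<bullet> y) / 2) +
      \<alpha> * (1 / exp s) * ((vec_deriv \<gamma> y x \<bullet> ?u - vec_deriv \<gamma> ?u x \<bullet> y) / 2))"
    unfolding hess_def W_def fun_hess_W[OF a_pos[OF x] y b_less[OF x y] skew_curl skew_curl]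
    unfolding h_form_def inner_add_right inner_scaleR_right proj S K y_M_y[OF x]
    by (simp add: s_def \<alpha>_def exp_minus inverse_eq_divide)
  have G: "?u \<bullet> (a x *v Ga x y) = (?u \<bullet> (mat_deriv a y x *v y)) / 2 - (y \<bullet> (mat_deriv a ?u x *v y)) / 4"
    by (simp add: inner_axis1 a_Ga[OF x])
  note Ga' = fun_hess_linear_G[OF G y_a_Ga[OF x] a_pos[OF x], of "b x", unfolded Let_def, folded \<alpha>_def, folded s_def]
  have add: "hess x y ?u (Ga x y + W x y) = hess x y ?u (Ga x y) + hess x y ?u (W x y)"
    by (simp add: hess_def fun_hess_add)
  show ?thesis
    unfolding add W' unfolding hess_def Ga'
    unfolding F_x_deriv[OF x y, folded \<alpha>_def, folded s_def] grad_x_deriv[OF x y, folded \<alpha>_def, folded s_def]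
    by (rule rapcsak_identity[OF \<alpha> exp_gt_zero])
qed

text \<open>As g is F times the Hessian plus the square of the gradient, the two parts can be
  matched separately: \<open>rapcsak\<close> settles the Hessian part, which is unaffected by adding
  a multiple of \<open>y\<close>, and the choice of \<open>P\<close> settles the gradient
  part.\<close>

theorem spray_coeff_eq_Z:
  assumes x: "x \<in> U" and y: "y \<noteq> 0"
  shows "spray_coeff F x y i = Z x y $ i"
proof (rule spray_coeff_eqI[OF x y])
  fix l
  let ?e = "axis l 1 :: real^'n"
  have F0: "F x y > 0"
    using F_pos[OF x y] by (simp add: F_def)
  have "((\<lambda>t. F (x + t *\<^sub>R y) y) has_real_derivative ddir y (\<lambda>x. F x y) x) (at 0)"
    "((\<lambda>t. grad (x + t *\<^sub>R y) y \<bullet> ?e) has_real_derivative ddir y (\<lambda>x. grad x y \<bullet> ?e) x) (at 0)"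
    by (intro has_ddir smooth_on_imp_differentiable[OF open_U _ x] smooth_F_x smooth_grad_x y)+
  from ddirI[OF DERIV_mult[OF this]]
  have 1: "ddir y (\<lambda>x. F x y * (grad x y \<bullet> ?e)) x =
      ddir y (\<lambda>x. F x y) x * (grad x y \<bullet> ?e) + ddir y (\<lambda>x. grad x y \<bullet> ?e) x * F x y"
    by simp
  have 2: "grad x y \<bullet> Z x y = 1/2 * ddir y (\<lambda>x. F x y) x"
    unfolding Z_def inner_add_right[of _ "Ga x y + W x y"] inner_scaleR_right grad_self[OF x y] P_def
    using F0 by simp
  have 3: "2 * hess x y ?e (Z x y) = ddir y (\<lambda>x. grad x y \<bullet> ?e) x - partial l (\<lambda>x. F x y) x"
    unfolding rapcsak[OF x y] Z_def
    using fun_hess_add[of "a x" "b x" y ?e "Ga x y + W x y" "P x y *\<^sub>R y"] hess_self[OF x y]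
    by (simp add: hess_def fun_hess_scale)
  have "2 * g x y ?e (Z x y) = F x y * (2 * hess x y ?e (Z x y)) + 2 * (grad x y \<bullet> ?e) * (grad x y \<bullet> Z x y)"
    by (simp add: g_def algebra_simps)
  then show "2 * g x y ?e (Z x y) = ddir y (\<lambda>x. F x y * (grad x y \<bullet> ?e)) x - F x y * partial l (\<lambda>x. F x y) x"
    unfolding 1 2 3 by (simp add: algebra_simps)
qed

end

section \<open>Functions with vanishing third derivatives\<close>

lemma open_punctured: "open (- {0 :: real^'n})"
  by (simp add: open_Compl)

lemma ddir3_cong:
  assumes "open S" "x \<in> S" "\<And>z. z \<in> S \<Longrightarrow> f z = g z"
  shows "ddir u (ddir v (ddir w f)) x = ddir u (ddir v (ddir w g)) x"
proof -
  have "ddir w f z = ddir w g z" if "z \<in> S" for z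
    by (rule ddir_cong[OF assms(1) that assms(3)])
  then have "ddir v (ddir w f) z = ddir v (ddir w g) z" if "z \<in> S" for z
    by (rule ddir_cong[OF assms(1) that])
  then show ?thesis
    by (rule ddir_cong[OF assms(1,2)])
qed

text \<open>The hypothesis concerns coordinate directions; linearity of \<open>ddir\<close> in the
  direction extends it to the direction of an arbitrary line.\<close>

lemma third_direction_deriv_zero:
  fixes T :: "real^'n \<Rightarrow> real"
  assumes S: "open S" and T: "smooth_on S T" and x: "x \<in> S"
    and zero: "\<And>y i j k. y \<in> S \<Longrightarrow> partial i (partial j (partial k T)) y = 0"
  shows "ddir z (ddir z (ddir z T)) x = 0"
proof -
  have d: "f differentiable (at y)" if "smooth_on S f" "y \<in> S" for f y
    using smooth_on_imp_differentiable[OF S that] .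
  have 1: "ddir z T y = (\<Sum>k\<in>UNIV. z $ k * partial k T y)" if "y \<in> S" for y
    using ddir_eq_sum_partial[OF d[OF T that]] .
  have 2: "ddir z (ddir z T) y = (\<Sum>k\<in>UNIV. z $ k * (\<Sum>j\<in>UNIV. z $ j * partial j (partial k T) y))" if y: "y \<in> S" for y
  proof -
    have "ddir z (ddir z T) y = ddir z (\<lambda>y. \<Sum>k\<in>UNIV. z $ k * partial k T y) y"
      by (rule ddir_cong[OF S y 1])
    also have "\<dots> = (\<Sum>k\<in>UNIV. z $ k * ddir z (partial k T) y)"
      by (rule ddir_sum) (intro d smooth_on_partial T y)
    finally show ?thesis
      unfolding ddir_eq_sum_partial[OF d[OF smooth_on_partial[OF T] y], of z] .
  qed
  have d3: "partial j (partial k T) differentiable (at x)" for j k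
    by (intro d smooth_on_partial T x)
  have "ddir z (ddir z (ddir z T)) x = ddir z (\<lambda>y. \<Sum>k\<in>UNIV. z $ k * (\<Sum>j\<in>UNIV. z $ j * partial j (partial k T) y)) x"
    by (rule ddir_cong[OF S x 2])
  also have "\<dots> = (\<Sum>k\<in>UNIV. z $ k * ddir z (\<lambda>y. \<Sum>j\<in>UNIV. z $ j * partial j (partial k T) y) x)"
    by (rule ddir_sum) (intro d smooth_on_sum smooth_on_mult smooth_on_const smooth_on_partial S T x)
  also have "\<dots> = (\<Sum>k\<in>UNIV. z $ k * (\<Sum>j\<in>UNIV. z $ j * ddir z (partial j (partial k T)) x))"
    by (intro sum.cong refl arg_cong[where f = "(*) _"] ddir_sum d3)
  also have "\<dots> = 0"
  proof -
    have "ddir z (partial j (partial k T)) x = 0" for j k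
      unfolding ddir_eq_sum_partial[OF d3, of z] by (simp add: zero[OF x])
    then show ?thesis by simp
  qed
  finally show ?thesis .
qed

lemma smooth_on_ddir:
  fixes f :: "real^'n \<Rightarrow> real"
  assumes "open S" "smooth_on S f"
  shows "smooth_on S (ddir z f)"
proof (rule smooth_on_cong[OF assms(1)])
  show "smooth_on S (\<lambda>y. \<Sum>k\<in>UNIV. z $ k * partial k f y)"
    by (intro smooth_on_sum smooth_on_mult smooth_on_const smooth_on_partial assms)
  show "(\<Sum>k\<in>UNIV. z $ k * partial k f y) = ddir z f y" if "y \<in> S" for y
    by (rule ddir_eq_sum_partial[OF smooth_on_imp_differentiable[OF assms that], symmetric])
qed

lemma has_derivative_line:
  fixes f :: "real^'n \<Rightarrow> real"
  assumes "open S" "smooth_on S f" "w + t *\<^sub>R z \<in> S"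
  shows "((\<lambda>t. f (w + t *\<^sub>R z)) has_real_derivative ddir z f (w + t *\<^sub>R z)) (at t)"
proof -
  have "((\<lambda>h. f ((w + t *\<^sub>R z) + h *\<^sub>R z)) has_real_derivative ddir z f (w + t *\<^sub>R z)) (at 0)"
    by (rule has_ddir[OF smooth_on_imp_differentiable[OF assms]])
  moreover have "(\<lambda>h. f ((w + t *\<^sub>R z) + h *\<^sub>R z)) = (\<lambda>h. f (w + (h + t) *\<^sub>R z))"
    by (simp add: algebra_simps)
  ultimately show ?thesis
    using DERIV_at_within_shift[of "\<lambda>t. f (w + t *\<^sub>R z)" _ t 0 UNIV] by (simp add: add.commute)
qed

lemma third_deriv_zero_imp_quadratic:
  fixes \<phi> \<phi>1 \<phi>2 :: "real \<Rightarrow> real"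
  assumes 1: "\<And>t. (\<phi> has_real_derivative \<phi>1 t) (at t)" and 2: "\<And>t. (\<phi>1 has_real_derivative \<phi>2 t) (at t)"
    and 3: "\<And>t. (\<phi>2 has_real_derivative 0) (at t)"
  shows "\<exists>A B C. \<forall>t. \<phi> t = A + B * t + C * t\<^sup>2"
proof -
  have c: "\<phi>2 t = \<phi>2 0" for t
    using DERIV_isconst_all[of \<phi>2] 3 by blast
  have "((\<lambda>t. \<phi>1 t - \<phi>2 0 * t) has_real_derivative 0) (at t)" for t
    using DERIV_diff[OF 2[of t] DERIV_cmult_Id[of "\<phi>2 0" t UNIV]] c[of t] by simp
  then have d: "\<phi>1 t - \<phi>2 0 * t = \<phi>1 0" for t
    using DERIV_isconst_all[of "\<lambda>t. \<phi>1 t - \<phi>2 0 * t" t 0] by simp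
  have "((\<lambda>t. \<phi> t - (\<phi>1 0 * t + \<phi>2 0 / 2 * t\<^sup>2)) has_real_derivative 0) (at t)" for t
    by (auto intro!: derivative_eq_intros 1) (use d[of t] in \<open>simp add: algebra_simps\<close>)
  then have e: "\<phi> t - (\<phi>1 0 * t + \<phi>2 0 / 2 * t\<^sup>2) = \<phi> 0" for t
    using DERIV_isconst_all[of "\<lambda>t. \<phi> t - (\<phi>1 0 * t + \<phi>2 0 / 2 * t\<^sup>2)" t 0] by simp
  have "\<phi> t = \<phi> 0 + \<phi>1 0 * t + \<phi>2 0 / 2 * t\<^sup>2" for t
    using e[of t] by linarith
  then show ?thesis by (intro exI allI)
qed

text \<open>
  On a line \<open>w + t z\<close> that misses the origin \<open>T\<close> is a quadratic polynomial in \<open>t\<close>; by homogeneity its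
  leading coefficient is both \<open>T z\<close> and \<open>T (- z)\<close>, as \<open>t\<close> tends to plus or minus infinity.
\<close>

lemma third_deriv_zero_imp_even:
  fixes T :: "real^'n \<Rightarrow> real"
  assumes n: "CARD('n) \<ge> 2" and T: "smooth_on (- {0}) T"
    and zero: "\<And>y i j k. y \<noteq> 0 \<Longrightarrow> partial i (partial j (partial k T)) y = 0"
    and hom: "\<And>t y. t > 0 \<Longrightarrow> y \<noteq> 0 \<Longrightarrow> T (t *\<^sub>R y) = t\<^sup>2 * T y"
    and z: "z \<noteq> 0"
  shows "T (- z) = T z"
proof -
  have "2 \<le> DIM(real^'n)"
    using n by simp
  \<comment> \<open>A base point orthogonal to \<open>z\<close> keeps the line away from the origin;
    it exists because the dimension is at least 2.\<close>
  then obtain w where w: "w \<noteq> 0" "orthogonal z w"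
    using orthogonal_to_vector_exists by blast
  have nz: "w + t *\<^sub>R z \<in> - {0}" for t
  proof -
    have "(w + t *\<^sub>R z) \<bullet> w > 0"
      using w by (simp add: inner_add_left orthogonal_def)
    then show ?thesis by force
  qed
  note o = open_punctured
  have "\<exists>A B C. \<forall>t. T (w + t *\<^sub>R z) = A + B * t + C * t\<^sup>2"
  proof (rule third_deriv_zero_imp_quadratic)
    show "((\<lambda>t. T (w + t *\<^sub>R z)) has_real_derivative ddir z T (w + t *\<^sub>R z)) (at t)" for t
      by (rule has_derivative_line[OF o T nz])
    show "((\<lambda>t. ddir z T (w + t *\<^sub>R z)) has_real_derivative ddir z (ddir z T) (w + t *\<^sub>R z)) (at t)" for t
      by (rule has_derivative_line[OF o smooth_on_ddir[OF o T] nz])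
    have "ddir z (ddir z (ddir z T)) (w + t *\<^sub>R z) = 0" for t
      by (rule third_direction_deriv_zero[OF o T nz]) (use zero in simp)
    then show "((\<lambda>t. ddir z (ddir z T) (w + t *\<^sub>R z)) has_real_derivative 0) (at t)" for t
      using has_derivative_line[OF o smooth_on_ddir[OF o smooth_on_ddir[OF o T]] nz[of t], of z z] by simp
  qed
  then obtain A B C where \<phi>: "T (w + t *\<^sub>R z) = A + B * t + C * t\<^sup>2" for t
    by blast
  have lim: "T (c *\<^sub>R z) = C" if c: "c = 1 \<or> c = -1" for c
  proof -
    have "c *\<^sub>R z \<noteq> 0"
      using z c by auto
    then have "continuous (at (c *\<^sub>R z)) T"
      using smooth_on_imp_differentiable[OF o T] differentiable_imp_continuous_within by blast
    moreover have "((\<lambda>k. c *\<^sub>R z + k *\<^sub>R w) \<longlongrightarrow> c *\<^sub>R z + 0 *\<^sub>R w) (at_right 0)"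
      by (intro tendsto_intros)
    ultimately have 1: "((\<lambda>k. T (c *\<^sub>R z + k *\<^sub>R w)) \<longlongrightarrow> T (c *\<^sub>R z)) (at_right 0)"
      using isCont_tendsto_compose[of "c *\<^sub>R z" T] by simp
    \<comment> \<open>\<open>k\<close> is, up to sign, the reciprocal of the line parameter: pulling
      it out of the argument leaves the point w + (c / k) z, and homogeneity turns the quadratic in
      c / k into one in \<open>k\<close>.\<close>
    have "T (c *\<^sub>R z + k *\<^sub>R w) = A * k\<^sup>2 + B * c * k + C" if "k > 0" for k
    proof -
      have "c *\<^sub>R z + k *\<^sub>R w = k *\<^sub>R (w + (c / k) *\<^sub>R z)"
        using that by (simp add: algebra_simps)
      then have "T (c *\<^sub>R z + k *\<^sub>R w) = k\<^sup>2 * (A + B * (c / k) + C * (c / k)\<^sup>2)"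
        using hom[OF that, of "w + (c / k) *\<^sub>R z"] nz \<phi>[of "c / k"] by simp
      also have "\<dots> = A * k\<^sup>2 + B * c * k + C * c\<^sup>2"
        using that by (simp add: field_simps power2_eq_square)
      also have "c\<^sup>2 = 1" using c by auto
      finally show ?thesis by simp
    qed
    then have "\<forall>\<^sub>F k in at_right 0. A * k\<^sup>2 + B * c * k + C = T (c *\<^sub>R z + k *\<^sub>R w)"
      by (auto simp: eventually_at_right_less intro: eventually_mono[OF eventually_at_right_less[of 0]])
    moreover have "((\<lambda>k. A * k\<^sup>2 + B * c * k + C) \<longlongrightarrow> A * 0\<^sup>2 + B * c * 0 + C) (at_right 0)"
      by (intro tendsto_intros)
    ultimately have "((\<lambda>k. T (c *\<^sub>R z + k *\<^sub>R w)) \<longlongrightarrow> C) (at_right 0)"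
      using Lim_transform_eventually by fastforce
    then show ?thesis
      using tendsto_unique[OF _ 1] by simp
  qed
  show ?thesis
    using lim[of 1] lim[of "-1"] by simp
qed

section \<open>Homogeneous functions and quadratic forms\<close>

lemma ddir_homogeneous:
  fixes f :: "real^'n \<Rightarrow> real"
  assumes f: "smooth_on (- {0}) f" and hom: "\<And>t y. t > 0 \<Longrightarrow> y \<noteq> 0 \<Longrightarrow> f (t *\<^sub>R y) = t\<^sup>2 * f y"
    and t: "t > 0" and y: "y \<noteq> 0"
  shows "ddir e f (t *\<^sub>R y) = t * ddir e f y"
proof -
  have d: "f differentiable (at y)"
    using smooth_on_imp_differentiable[OF open_punctured f] y by simp
  have "ddir e f (t *\<^sub>R y) = ddir e (\<lambda>z. t\<^sup>2 * f ((1 / t) *\<^sub>R z)) (t *\<^sub>R y)"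
  proof (rule ddir_cong[OF open_punctured])
    show "t *\<^sub>R y \<in> - {0}" using t y by simp
    show "f z = t\<^sup>2 * f ((1 / t) *\<^sub>R z)" if "z \<in> - {0}" for z
      using hom[OF t, of "(1 / t) *\<^sub>R z"] t that by simp
  qed
  also have "\<dots> = t\<^sup>2 * ddir ((1 / t) *\<^sub>R e) f y"
  proof (rule ddirI)
    have "(\<lambda>h. (1 / t) *\<^sub>R (t *\<^sub>R y + h *\<^sub>R e)) = (\<lambda>h. y + h *\<^sub>R ((1 / t) *\<^sub>R e))"
      using t by (simp add: fun_eq_iff scaleR_add_right)
    then show "((\<lambda>h. t\<^sup>2 * f ((1 / t) *\<^sub>R (t *\<^sub>R y + h *\<^sub>R e))) has_real_derivative t\<^sup>2 * ddir ((1 / t) *\<^sub>R e) f y) (at 0)"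
      using DERIV_cmult[OF has_ddir[OF d, of "(1 / t) *\<^sub>R e"], of "t\<^sup>2"] by (simp add: fun_eq_iff)
  qed
  also have "ddir ((1 / t) *\<^sub>R e) f y = (1 / t) * ddir e f y"
    using linear_scale[OF linear_ddir[OF d], of "1 / t" e] by simp
  finally show ?thesis
    using t by (simp add: power2_eq_square)
qed

lemma quadratic_third_deriv:
  fixes Q :: "real^'n^'n"
  shows "ddir u (ddir v (ddir w (\<lambda>y. y \<bullet> (Q *v y)))) y = 0"
proof -
  have 1: "ddir w (\<lambda>y. y \<bullet> (Q *v y)) = (\<lambda>y. w \<bullet> (Q *v y) + y \<bullet> (Q *v w))"
  proof
    fix y
    have "(\<lambda>t. (y + t *\<^sub>R w) \<bullet> (Q *v (y + t *\<^sub>R w))) =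
      (\<lambda>t. y \<bullet> (Q *v y) + t * (w \<bullet> (Q *v y) + y \<bullet> (Q *v w)) + t\<^sup>2 * (w \<bullet> (Q *v w)))"
      by (simp add: fun_eq_iff matrix_vector_right_distrib matrix_vector_mult_scaleR inner_add_left
          inner_add_right power2_eq_square distrib_left)
    then show "ddir w (\<lambda>y. y \<bullet> (Q *v y)) y = w \<bullet> (Q *v y) + y \<bullet> (Q *v w)"
      by (intro ddirI) (auto intro!: derivative_eq_intros)
  qed
  have 2: "ddir v (\<lambda>y. w \<bullet> (Q *v y) + y \<bullet> (Q *v w)) = (\<lambda>y. w \<bullet> (Q *v v) + v \<bullet> (Q *v w))"
    by (rule ext, rule ddirI)
      (auto simp: matrix_vector_right_distrib matrix_vector_mult_scaleR inner_add_left inner_add_right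
        intro!: derivative_eq_intros)
  show ?thesis
    unfolding 1 2 by (simp add: ddir_def)
qed

lemma ddir_quadratic:
  fixes Q :: "real^'n^'n"
  shows "ddir w (\<lambda>y. y \<bullet> (Q *v y)) y = (w v* Q + Q *v w) \<bullet> y"
    and "(\<lambda>y. y \<bullet> (Q *v y)) differentiable (at y)"
proof -
  have "(\<lambda>t. (y + t *\<^sub>R w) \<bullet> (Q *v (y + t *\<^sub>R w))) =
      (\<lambda>t. y \<bullet> (Q *v y) + t * (w \<bullet> (Q *v y) + y \<bullet> (Q *v w)) + t\<^sup>2 * (w \<bullet> (Q *v w)))"
    by (simp add: fun_eq_iff matrix_vector_right_distrib matrix_vector_mult_scaleR inner_add_left
        inner_add_right power2_eq_square distrib_left)
  then show "ddir w (\<lambda>y. y \<bullet> (Q *v y)) y = (w v* Q + Q *v w) \<bullet> y"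
    by (intro ddirI) (auto intro!: derivative_eq_intros simp: inner_add_left dot_lmul_matrix inner_commute[of "Q *v w"])
  show "(\<lambda>y. y \<bullet> (Q *v y)) differentiable (at y)"
    by (rule smooth_on_imp_differentiable[OF open_UNIV])
      (intro smooth_on_inner vsmooth_mult vsmooth_id msmooth_const open_UNIV, simp)
qed

lemma product_forms_quadratic:
  "(l \<bullet> y) * (m \<bullet> y) = y \<bullet> ((\<chi> p q. l $ p * m $ q) *v (y :: real^'n))"
  by (simp add: inner_matrix_sum) (simp add: inner_vec_def sum_product mult_ac)

section \<open>The Douglas tensor\<close>

lemma smooth_on_coord: "smooth_on S (\<lambda>y :: real^'n. y $ i)"
  by (simp add: smooth_on_linear bounded_linear_vec_nth)

lemma W_form_scale:
  assumes A: "pos_def A" and t: "t > 0" and y: "y \<noteq> 0"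
  shows "W_form A b M S K (t *\<^sub>R y) = t\<^sup>2 *\<^sub>R W_form A b M S K y"
proof -
  have l: "riemannian_length A (t *\<^sub>R y) = t * riemannian_length A y"
    using t by (simp add: riemannian_length_scale)
  have P: "proj_form A b (t *\<^sub>R y) = proj_form A b y"
    using t by (simp add: proj_form_def l matrix_vector_mult_scaleR power2_eq_square)
  have h: "h_form A b M S K (t *\<^sub>R y) = t\<^sup>2 *\<^sub>R h_form A b M S K y"
    unfolding h_form_def P using t
    by (simp add: l matrix_vector_mult_scaleR power2_eq_square scaleR_add_right mult_ac)
  show ?thesis
    unfolding W_form_def Let_def h P using t
    by (simp add: l scaleR_diff_right mult_ac)
qed

context metric_chart
begin

section \<open>Smoothness and homogeneity of the terms of the spray\<close>

lemma smooth_F_xderiv: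
  assumes x: "x \<in> U"
  shows "smooth_on (- {0}) (\<lambda>y. ddir y (\<lambda>x. F x y) x)"
proof (rule smooth_on_cong[OF open_punctured])
  have 1: "msmooth (- {0}) (\<lambda>y. mat_deriv a y x)"
  proof -
    have "smooth_on (- {0}) (\<lambda>y. \<Sum>k\<in>UNIV. y $ k * mat_deriv a (axis k 1) x $ i $ j)" for i j
      by (intro smooth_on_sum smooth_on_mult smooth_on_coord smooth_on_const open_punctured)
    then show ?thesis
      unfolding msmooth_def mat_deriv_sum[OF x] by blast
  qed
  have 2: "vsmooth (- {0}) (\<lambda>y. vec_deriv b y x)"
  proof -
    have "smooth_on (- {0}) (\<lambda>y. \<Sum>k\<in>UNIV. y $ k * vec_deriv b (axis k 1) x $ i)" for i
      by (intro smooth_on_sum smooth_on_mult smooth_on_coord smooth_on_const open_punctured)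
    then show ?thesis
      unfolding vsmooth_def vec_deriv_sum_b[OF x] by blast
  qed
  have 3: "vsmooth (- {0}) (\<lambda>y. vec_deriv \<gamma> y x)"
  proof -
    have "smooth_on (- {0}) (\<lambda>y. \<Sum>k\<in>UNIV. y $ k * vec_deriv \<gamma> (axis k 1) x $ i)" for i
      by (intro smooth_on_sum smooth_on_mult smooth_on_coord smooth_on_const open_punctured)
    then show ?thesis
      unfolding vsmooth_def vec_deriv_sum_\<gamma>[OF x] by blast
  qed
  let ?\<alpha> = "\<lambda>y. riemannian_length (a x) y"
  show "smooth_on (- {0}) (\<lambda>y. exp ((b x \<bullet> y) / ?\<alpha> y) * ((1 - (b x \<bullet> y) / ?\<alpha> y) * (y \<bullet> (mat_deriv a y x *v y)) / (2 * ?\<alpha> y) +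
      vec_deriv b y x \<bullet> y) + vec_deriv \<gamma> y x \<bullet> y)"
    by (intro smooth_intros open_punctured vsmooth_id 1 2 3 a_pos[OF x])
      (use riemannian_length_pos[OF a_pos[OF x]] in fastforce)+
  show "exp ((b x \<bullet> y) / ?\<alpha> y) * ((1 - (b x \<bullet> y) / ?\<alpha> y) * (y \<bullet> (mat_deriv a y x *v y)) / (2 * ?\<alpha> y) +
      vec_deriv b y x \<bullet> y) + vec_deriv \<gamma> y x \<bullet> y = ddir y (\<lambda>x. F x y) x" if "y \<in> - {0}" for y
    using that by (simp add: F_x_deriv[OF x])
qed

lemma smooth_Ga: "vsmooth (- {0}) (Ga x)"
  unfolding vsmooth_def Ga_def vec_lambda_beta
  by (intro allI smooth_on_sum smooth_on_mult smooth_on_coord smooth_on_const open_punctured)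

lemma smooth_W: "x \<in> U \<Longrightarrow> vsmooth (- {0}) (W x)"
  unfolding W_def
  by (intro vsmooth_mult msmooth_const vsmooth_W_form open_punctured a_pos b_less)

lemma smooth_P: "x \<in> U \<Longrightarrow> smooth_on (- {0}) (P x)"
proof -
  assume x: "x \<in> U"
  have 1: "smooth_on (- {0}) (F x)"
    unfolding F_def by (intro smooth_on_fun_val open_punctured msmooth_const vsmooth_const vsmooth_id a_pos x) simp
  have 2: "vsmooth (- {0}) (grad x)"
    unfolding grad_def by (intro vsmooth_fun_grad open_punctured msmooth_const vsmooth_const vsmooth_id a_pos x) simp
  show ?thesis
    unfolding P_def
    by (intro smooth_on_divide smooth_on_diff smooth_on_mult smooth_on_const smooth_on_inner vsmooth_add
        smooth_F_xderiv smooth_Ga smooth_W 1 2 x open_punctured)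
      (use F_pos[OF x] in \<open>auto simp: F_def less_imp_neq[symmetric]\<close>)
qed

lemma smooth_Z: "x \<in> U \<Longrightarrow> vsmooth (- {0}) (Z x)"
  unfolding Z_def
  by (intro vsmooth_add vsmooth_scale vsmooth_id smooth_Ga smooth_W smooth_P open_punctured)

lemma Ga_scale: "Ga x (t *\<^sub>R y) = t\<^sup>2 *\<^sub>R Ga x y"
  by (simp add: Ga_def vec_eq_iff sum_distrib_left power2_eq_square mult_ac)

lemma W_scale: "x \<in> U \<Longrightarrow> t > 0 \<Longrightarrow> y \<noteq> 0 \<Longrightarrow> W x (t *\<^sub>R y) = t\<^sup>2 *\<^sub>R W x y"
  by (simp add: W_def W_form_scale[OF a_pos] matrix_vector_mult_scaleR)

lemma F_scale: "t > 0 \<Longrightarrow> F x (t *\<^sub>R y) = t * F x y"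
  by (simp add: F_def fun_val_def riemannian_length_scale distrib_left)

lemma grad_scale: "t > 0 \<Longrightarrow> grad x (t *\<^sub>R y) = grad x y"
  by (simp add: grad_def fun_grad_def Let_def riemannian_length_scale matrix_vector_mult_scaleR)

lemma F_xderiv_scale:
  assumes x: "x \<in> U" and t: "t > 0" and y: "y \<noteq> 0"
  shows "ddir (t *\<^sub>R y) (\<lambda>x. F x (t *\<^sub>R y)) x = t\<^sup>2 * ddir y (\<lambda>x. F x y) x"
proof -
  have d: "(\<lambda>x. F x y) differentiable (at x)"
    by (rule smooth_on_imp_differentiable[OF open_U smooth_F_x[OF y] x])
  have "ddir (t *\<^sub>R y) (\<lambda>x. t * F x y) x = t * ddir (t *\<^sub>R y) (\<lambda>x. F x y) x"
    by (rule ddirI) (rule DERIV_cmult[OF has_ddir[OF d]])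
  then show ?thesis
    using linear_scale[OF linear_ddir[OF d], of t y] t by (simp add: F_scale power2_eq_square)
qed

lemma P_scale:
  assumes x: "x \<in> U" and t: "t > 0" and y: "y \<noteq> 0"
  shows "P x (t *\<^sub>R y) = t * P x y"
proof -
  have "1/2 * (t\<^sup>2 * d) - u \<bullet> (t\<^sup>2 *\<^sub>R v + t\<^sup>2 *\<^sub>R w) = t * (t * (1/2 * d - u \<bullet> (v + w)))" for d and u v w :: "real^'n"
    by (simp add: inner_add_right power2_eq_square algebra_simps)
  then show ?thesis
    unfolding P_def F_xderiv_scale[OF assms]
    unfolding F_scale[OF t] grad_scale[OF t] Ga_scale W_scale[OF assms]
    using t by simp
qed

lemma Z_scale: "x \<in> U \<Longrightarrow> t > 0 \<Longrightarrow> y \<noteq> 0 \<Longrightarrow> Z x (t *\<^sub>R y) = t\<^sup>2 *\<^sub>R Z x y"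
  by (simp add: Z_def Ga_scale W_scale P_scale scaleR_add_right power2_eq_square mult_ac)

definition div_Z where "div_Z x y = (\<Sum>m\<in>UNIV. partial m (\<lambda>y. Z x y $ m) y)"

text \<open>The projectively invariant part of the spray: a summand P y with P of degree 1 has
  divergence (n + 1) P by Euler's identity, so the trace term removes it.\<close>

definition T where
  "T x y i = Z x y $ i - 1 / (real CARD('n) + 1) * div_Z x y * y $ i"

lemma douglas_tensor_eq:
  assumes x: "x \<in> U" and y: "y \<noteq> 0"
  shows "douglas_tensor F x y i j k l = partial j (partial k (partial l (\<lambda>y. T x y i))) y"
  unfolding douglas_tensor_def
proof (rule ddir3_cong[OF open_punctured])
  show "y \<in> - {0}" using y by simp
  fix z :: "real^'n" assume z: "z \<in> - {0}"
  have "partial m (\<lambda>y. spray_coeff F x y m) z = partial m (\<lambda>y. Z x y $ m) z" for m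
    by (rule ddir_cong[OF open_punctured z]) (simp add: spray_coeff_eq_Z[OF x])
  then show "spray_coeff F x z i - 1 / (real CARD('n) + 1) * (\<Sum>m\<in>UNIV. partial m (\<lambda>y. spray_coeff F x y m) z) * z $ i = T x z i"
    using z by (simp add: T_def div_Z_def spray_coeff_eq_Z[OF x])
qed

lemma smooth_T: "x \<in> U \<Longrightarrow> smooth_on (- {0}) (\<lambda>y. T x y i)"
  unfolding T_def div_Z_def
  by (intro smooth_on_diff smooth_on_mult smooth_on_sum smooth_on_const smooth_on_coord open_punctured smooth_on_partial)
    (use smooth_Z in \<open>auto simp: vsmooth_def\<close>)

lemma T_scale:
  assumes x: "x \<in> U" and t: "t > 0" and y: "y \<noteq> 0"
  shows "T x (t *\<^sub>R y) i = t\<^sup>2 * T x y i"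
proof -
  have "partial m (\<lambda>y. Z x y $ m) (t *\<^sub>R y) = t * partial m (\<lambda>y. Z x y $ m) y" for m
  proof (rule ddir_homogeneous[OF _ _ t y])
    show "smooth_on (- {0}) (\<lambda>y. Z x y $ m)"
      using smooth_Z[OF x] by (simp add: vsmooth_def)
    show "Z x (r *\<^sub>R z) $ m = r\<^sup>2 * Z x z $ m" if "r > 0" "z \<noteq> 0" for r z
      using that by (simp add: Z_scale[OF x])
  qed
  then have "div_Z x (t *\<^sub>R y) = t * div_Z x y"
    by (simp add: div_Z_def sum_distrib_left)
  then show ?thesis
    by (simp add: T_def Z_scale[OF assms] power2_eq_square algebra_simps)
qed

text \<open>\<open>T\<close> and the quadratic \<open>Ga\<close> are even, so \<open>W\<close>
  changes under y to -y at most by a multiple of \<open>y\<close>; since \<open>W_form\<close> is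
  orthogonal to \<open>y\<close> at both points, that multiple is zero.\<close>

lemma W_form_even:
  assumes n: "CARD('n) \<ge> 2" and x: "x \<in> U"
    and D: "\<And>y i j k l. y \<noteq> 0 \<Longrightarrow> douglas_tensor F x y i j k l = 0"
    and y: "y \<noteq> 0"
  shows "W_form (a x) (b x) (M x) (curl b x) (curl \<gamma> x) (- y) = W_form (a x) (b x) (M x) (curl b x) (curl \<gamma> x) y"
proof -
  have Teven: "T x (- y) i = T x y i" for i
    by (rule third_deriv_zero_imp_even[OF n smooth_T[OF x]])
      (use y D douglas_tensor_eq[OF x] T_scale[OF x] in auto)
  define Q where "Q y = P x y - 1 / (real CARD('n) + 1) * div_Z x y" for y
  have T: "T x z i = Ga x z $ i + W x z $ i + Q z * z $ i" for z i
    by (simp add: T_def Z_def Q_def left_diff_distrib)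
  have Ga: "Ga x (- y) = Ga x y"
    using Ga_scale[of x "-1" y] by simp
  have "W x (- y) = W x y + (Q y + Q (- y)) *\<^sub>R y"
  proof -
    have "W x (- y) $ i = W x y $ i + (Q y + Q (- y)) * y $ i" for i
      using Teven[of i] by (simp add: T Ga algebra_simps)
    then show ?thesis
      by (simp add: vec_eq_iff)
  qed
  then have "a x *v W x (- y) = a x *v W x y + (Q y + Q (- y)) *\<^sub>R (a x *v y)"
    by (simp add: matrix_vector_right_distrib matrix_vector_mult_scaleR)
  then have *: "W_form (a x) (b x) (M x) (curl b x) (curl \<gamma> x) (- y) =
      W_form (a x) (b x) (M x) (curl b x) (curl \<gamma> x) y + (Q y + Q (- y)) *\<^sub>R (a x *v y)"
    by (simp add: W_def pos_def_mult_inv[OF a_pos[OF x]])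
  have "W_form (a x) (b x) (M x) (curl b x) (curl \<gamma> x) (- y) \<bullet> y = 0"
    "W_form (a x) (b x) (M x) (curl b x) (curl \<gamma> x) y \<bullet> y = 0"
    using W_form_self[OF a_pos[OF x], of "- y" "curl b x" "curl \<gamma> x" "b x" "M x"]
      W_form_self[OF a_pos[OF x], of y "curl b x" "curl \<gamma> x" "b x" "M x"] y
    by (simp_all add: skew_curl)
  then have "(Q y + Q (- y)) * (y \<bullet> (a x *v y)) = 0"
    unfolding * by (simp add: inner_add_left inner_commute[of "a x *v y" y])
  then have "Q y + Q (- y) = 0"
    using pos_def_pos[OF a_pos[OF x] y] by simp
  then show ?thesis
    unfolding * by simp
qed

section \<open>Symmetry and continuity of the covariant derivative\<close>

lemma christoffel_commute:
  assumes x: "x \<in> U"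
  shows "christoffel a x k i j = christoffel a x k j i"
proof -
  have "partial l (\<lambda>x. a x $ i $ j) x = partial l (\<lambda>x. a x $ j $ i) x" for l
    using mat_deriv_symmetric[OF x, of "axis l 1" i j] by (simp add: mat_deriv_def)
  then show ?thesis
    by (simp add: christoffel_def add.commute)
qed

lemma M_antisym: "x \<in> U \<Longrightarrow> M x $ i $ j - M x $ j $ i = 2 * curl b x $ i $ j"
  by (simp add: M_def covariant_deriv_def curl_def christoffel_commute[of x _ i j])

text \<open>The quadratic form carries the symmetric part of \<open>M x\<close>, and
  \<open>curl b x\<close> carries the skew part.\<close>

lemma M_zeroI:
  assumes x: "x \<in> U" and q: "\<And>y. y \<bullet> (M x *v y) = 0" and c: "curl b x = 0"
  shows "M x = 0"
proof -
  have "skew (M x)"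
    using q by (simp add: skew_def)
  have "M x $ i $ j = 0" for i j
  proof -
    have "axis i 1 \<bullet> (M x *v axis j 1) = - (axis j 1 \<bullet> (M x *v axis i 1))"
      by (rule skew_inner[OF \<open>skew (M x)\<close>])
    then have "M x $ i $ j = - M x $ j $ i"
      by (simp add: inner_axis1 matrix_vector_mult_basis column_def)
    then show ?thesis
      using M_antisym[OF x, of i j] c by simp
  qed
  then show ?thesis
    by (simp add: vec_eq_iff)
qed

lemma continuous_inverse: "continuous_on U (\<lambda>x. matrix_inv (a x) $ k $ l)"
proof -
  have ca: "continuous_on U (\<lambda>x. a x $ i $ j)" for i j
    using a_smooth by (auto simp: msmooth_def intro: smooth_on_imp_continuous_on)
  \<comment> \<open>\<open>a x\<close> with column \<open>k\<close> replaced by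
    \<open>axis l 1\<close>: the numerator in Cramer's rule.\<close>
  define N where "N x = (\<chi> i j. if j = k then (axis l 1 :: real^'n) $ i else a x $ i $ j)" for x
  have cN: "continuous_on U (\<lambda>x. N x $ i $ j)" for i j
    by (cases "j = k") (simp_all add: N_def ca)
  have dn: "det (a x) \<noteq> 0" if "x \<in> U" for x
    using pos_def_inverse[OF a_pos[OF that]] invertible_det_nz unfolding invertible_def by blast
  have "matrix_inv (a x) $ k $ l = det (N x) / det (a x)" if x: "x \<in> U" for x
  proof -
    have "a x *v (matrix_inv (a x) *v axis l 1) = axis l 1"
      by (rule pos_def_mult_inv[OF a_pos[OF x]])
    then have "(matrix_inv (a x) *v axis l 1) $ k = det (N x) / det (a x)"
      unfolding cramer[OF dn[OF x]] N_def by (metis (lifting) vec_lambda_beta)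
    then show ?thesis
      by (simp add: matrix_vector_mult_basis column_def)
  qed
  moreover have "continuous_on U (\<lambda>x. det (N x) / det (a x))"
    by (intro continuous_on_divide continuous_on_det cN ca) (use dn in auto)
  ultimately show ?thesis
    by (simp cong: continuous_on_cong)
qed

lemma continuous_M: "continuous_on U (\<lambda>x. M x $ i $ j)"
proof -
  have ca: "continuous_on U (\<lambda>x. partial k (\<lambda>x. a x $ i $ j) x)" for i j k
    using a_smooth by (auto simp: msmooth_def intro!: smooth_on_imp_continuous_on smooth_on_partial)
  have cb: "continuous_on U (\<lambda>x. partial k (\<lambda>x. b x $ i) x)" "continuous_on U (\<lambda>x. b x $ i)" for i k
    using b_smooth by (auto simp: vsmooth_def intro!: smooth_on_imp_continuous_on smooth_on_partial)
  show ?thesis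
    unfolding M_def covariant_deriv_def christoffel_def vec_lambda_beta
    by (intro continuous_intros ca cb continuous_inverse)
qed

theorem douglas_imp:
  assumes n: "CARD('n) \<ge> 2"
    and D: "\<And>x y i j k l. x \<in> U \<Longrightarrow> y \<noteq> 0 \<Longrightarrow> douglas_tensor F x y i j k l = 0"
    and x: "x \<in> U"
  shows "M x = 0" "curl \<gamma> x = 0"
proof -
  have nz: "M x = 0 \<and> curl b x = 0 \<and> curl \<gamma> x = 0" if x: "x \<in> U" and b: "b x \<noteq> 0" for x
  proof -
    note r = W_form_even_imp_zero[OF n a_pos[OF x] b_bound[OF x] skew_curl skew_curl W_form_even[OF n x D[OF x]] b]
    have "curl b x = 0" "curl \<gamma> x = 0"
      using r by (auto intro!: matrix_zeroI)
    then show ?thesis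
      using M_zeroI[OF x r(1)] by blast
  qed
  have M0: "M x = 0" if x: "x \<in> U" for x
  proof (cases "x \<in> closure {z \<in> U. b z \<noteq> 0}")
    case True
    have "M x $ i $ j = 0" for i j
    proof -
      obtain f where f: "\<And>n. f n \<in> {z \<in> U. b z \<noteq> 0}" "f \<longlonglongrightarrow> x"
        using True unfolding closure_sequential by blast
      have "isCont (\<lambda>x. M x $ i $ j) x"
        using continuous_M open_U x continuous_on_eq_continuous_at by blast
      then have "(\<lambda>n. M (f n) $ i $ j) \<longlonglongrightarrow> M x $ i $ j"
        using isCont_tendsto_compose[OF _ f(2)] by blast
      moreover have "(\<lambda>n. M (f n) $ i $ j) = (\<lambda>n. 0)"
        using f(1) nz by (auto simp: fun_eq_iff)
      ultimately show ?thesis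
        using LIMSEQ_unique tendsto_const by metis
    qed
    then show ?thesis
      by (simp add: vec_eq_iff)
  next
    case False
    \<comment> \<open>\<open>b x = 0\<close> alone says nothing about the derivative of
      \<open>b\<close>; on the open set \<open>V\<close> the form vanishes identically.\<close>
    define V where "V = U - closure {z \<in> U. b z \<noteq> 0}"
    have V: "open V" "x \<in> V" "V \<subseteq> U"
      using open_U x False by (auto simp: V_def open_Diff)
    have bV: "b z = 0" if "z \<in> V" for z
      using that closure_subset[of "{z \<in> U. b z \<noteq> 0}"] by (auto simp: V_def)
    have "partial j (\<lambda>x. b x $ i) x = 0" for i j
    proof -
      have "partial j (\<lambda>x. b x $ i) x = partial j (\<lambda>x. 0) x"
        by (rule ddir_cong[OF V(1,2)]) (simp add: bV)
      then show ?thesis by (simp add: ddir_def)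
    qed
    then show ?thesis
      by (simp add: M_def covariant_deriv_def bV[OF V(2)] vec_eq_iff)
  qed
  then show "M x = 0" using x .
  show "curl \<gamma> x = 0"
  proof (cases "b x = 0")
    case False
    then show ?thesis using nz[OF x] by blast
  next
    case True
    \<comment> \<open>At a zero of \<beta> evenness controls only the sum of the two curls; the
      first is already known to vanish because \<open>M x\<close> does.\<close>
    have c: "curl b x = 0"
      using M_antisym[OF x] M0[OF x] by (simp add: vec_eq_iff)
    show ?thesis
    proof (rule matrix_zeroI)
      fix y :: "real^'n" assume y: "y \<noteq> 0"
      show "curl \<gamma> x *v y = 0"
        using W_form_even_imp_opposite[OF a_pos[OF x] y, of "M x" "curl b x" "curl \<gamma> x"]
          W_form_even[OF n x D[OF x] y] True c by simp
    qed
  qed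
qed

text \<open>With \<open>W\<close> zero the spray is a quadratic form plus P y. The trace term of
  \<open>T\<close> cancels P y and otherwise contributes a product of two linear forms, so
  \<open>T\<close> is quadratic.\<close>

theorem parallel_closed_imp:
  assumes M: "\<And>x. x \<in> U \<Longrightarrow> M x = 0" and K: "\<And>x. x \<in> U \<Longrightarrow> curl \<gamma> x = 0"
    and x: "x \<in> U" and y: "y \<noteq> 0"
  shows "douglas_tensor F x y i j k l = 0"
proof -
  have S: "curl b x = 0"
    using M_antisym[OF x] M[OF x] by (simp add: vec_eq_iff)
  have W0: "W x y = 0" for y
    by (simp add: W_def W_form_def Let_def h_form_def M[OF x] K[OF x] S)
  have Z: "Z x y = Ga x y + P x y *\<^sub>R y" for y
    by (simp add: Z_def W0)
  define Q where "Q m = (\<chi> j k. 1/2 * christoffel a x m j k)" for m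
  have Ga: "Ga x y $ m = y \<bullet> (Q m *v y)" for m y
    by (simp add: Ga_def Q_def inner_matrix_sum sum_distrib_left)
  define lm where "lm = (\<Sum>m\<in>UNIV. axis m 1 v* Q m + Q m *v axis m 1)"
  have div: "div_Z x y = lm \<bullet> y + (real CARD('n) + 1) * P x y" if y: "y \<noteq> 0" for y
  proof -
    have dP: "P x differentiable (at y)"
      using smooth_on_imp_differentiable[OF open_punctured smooth_P[OF x]] y by simp
    have "partial m (\<lambda>y. Z x y $ m) y = (axis m 1 v* Q m + Q m *v axis m 1) \<bullet> y + (y $ m * partial m (P x) y + P x y)" for m
    proof -
      have "((\<lambda>t. (y + t *\<^sub>R axis m 1) $ m) has_real_derivative 1) (at 0)"
        by (auto intro!: derivative_eq_intros)
      note 1 = DERIV_mult[OF has_ddir[OF dP, of "axis m 1"] this]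
      have 2: "((\<lambda>t. (y + t *\<^sub>R axis m 1) \<bullet> (Q m *v (y + t *\<^sub>R axis m 1))) has_real_derivative
          (axis m 1 v* Q m + Q m *v axis m 1) \<bullet> y) (at 0)"
        using has_ddir[OF ddir_quadratic(2)[of "Q m" y], of "axis m 1"] unfolding ddir_quadratic(1) .
      have 3: "(\<lambda>t. Z x (y + t *\<^sub>R axis m 1) $ m) = (\<lambda>t. (y + t *\<^sub>R axis m 1) \<bullet> (Q m *v (y + t *\<^sub>R axis m 1)) +
          P x (y + t *\<^sub>R axis m 1) * (y + t *\<^sub>R axis m 1) $ m)"
        unfolding Z vector_add_component[of "Ga x _"] Ga by simp
      show ?thesis
        by (rule ddirI, unfold 3, rule DERIV_cong[OF DERIV_add[OF 2 1]]) (simp add: mult.commute)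
    qed
    moreover have "(\<Sum>m\<in>UNIV. y $ m * partial m (P x) y) = P x y"
    proof -
      \<comment> \<open>Euler's identity for \<open>P x\<close>, of degree 1, read off from its
        values at (1 + t) y for t > -1.\<close>
      have "ddir y (P x) y = P x y"
      proof -
        have "ddir y (P x) y = deriv (\<lambda>t. P x (y + t *\<^sub>R y)) 0"
          by (simp add: ddir_def)
        also have "\<dots> = deriv (\<lambda>t. (1 + t) * P x y) 0"
        proof (rule deriv_cong_ev)
          have "\<forall>\<^sub>F t :: real in nhds 0. t > -1"
            using eventually_nhds_in_open[of "{-1<..}" "0::real"] by simp
          then show "\<forall>\<^sub>F t in nhds 0. P x (y + t *\<^sub>R y) = (1 + t) * P x y"
          proof eventually_elim
            case (elim t)
            have "y + t *\<^sub>R y = (1 + t) *\<^sub>R y"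
              by (simp add: scaleR_add_left)
            then show ?case
              using P_scale[OF x, of "1 + t" y] elim y by simp
          qed
        qed simp
        also have "\<dots> = P x y"
          by (rule DERIV_imp_deriv) (auto intro!: derivative_eq_intros)
        finally show ?thesis .
      qed
      then show ?thesis
        using ddir_eq_sum_partial[OF dP, of y] by simp
    qed
    ultimately show ?thesis
      by (simp add: div_Z_def sum.distrib lm_def inner_sum_left inner_add_left algebra_simps)
  qed
  define N where "N = Q i - (1 / (real CARD('n) + 1)) *\<^sub>R (\<chi> p q. lm $ p * axis i 1 $ q)"
  have T: "T x z i = z \<bullet> (N *v z)" if "z \<in> - {0}" for z
  proof -
    have z: "z \<noteq> 0" using that by simp
    have "z $ i = axis i 1 \<bullet> z"
      by (simp add: inner_axis1)
    then have "(lm \<bullet> z) * z $ i = z \<bullet> ((\<chi> p q. lm $ p * axis i 1 $ q) *v z)"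
      using product_forms_quadratic[of lm z "axis i 1"] by simp
    then have "z \<bullet> (N *v z) = z \<bullet> (Q i *v z) - 1 / (real CARD('n) + 1) * ((lm \<bullet> z) * z $ i)"
      by (simp add: N_def matrix_vector_mult_diff_rdistrib scaleR_matrix_vector_assoc[symmetric] inner_diff_right)
    moreover have "1 / (real CARD('n) + 1) * ((lm \<bullet> z + (real CARD('n) + 1) * P x z) * z $ i) =
        1 / (real CARD('n) + 1) * ((lm \<bullet> z) * z $ i) + P x z * z $ i"
      by (simp add: field_simps)
    ultimately show ?thesis
      by (simp add: T_def Z Ga div[OF z] mult.assoc)
  qed
  show ?thesis
    unfolding douglas_tensor_eq[OF x y]
    using ddir3_cong[OF open_punctured _ T, of y] y by (simp add: quadratic_third_deriv)
qed

end

section \<open>The manifold\<close>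

text \<open>Larger bounds would admit a pair (s, s') with (1 - s) exp s or exp s + s' not
  positive.\<close>

lemma largest_bounds_le:
  assumes "largest_bounds b0 g0"
  shows "b0 \<le> 1" "g0 \<le> exp (- b0)"
proof -
  have b0: "b0 > 0" and g0: "g0 > 0"
    and adm: "\<And>b g s s'. \<bar>s\<bar> < b \<Longrightarrow> b < b0 \<Longrightarrow> \<bar>s'\<bar> < g \<Longrightarrow> g < g0 \<Longrightarrow> exp s + s' > 0 \<and> (1 - s) * exp s > 0"
    using assms unfolding largest_bounds_def admissible_bounds_def by blast+
  show "b0 \<le> 1"
  proof (rule ccontr)
    assume "\<not> b0 \<le> 1"
    then show False
      \<comment> \<open>The pair s = 1, s' = 0, for which (1 - s) exp s is 0.\<close>
      using adm[of 1 "(1 + b0) / 2" 0 "g0 / 2"] g0 by simp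
  qed
  show "g0 \<le> exp (- b0)"
  proof (rule ccontr)
    assume "\<not> g0 \<le> exp (- b0)"
    then obtain g1 where g1: "exp (- b0) < g1" "g1 < g0"
      using dense[of "exp (- b0)" g0] by auto
    have pos: "g1 > 0"
      using g1(1) exp_gt_zero[of "- b0"] by linarith
    have "- ln g1 < b0"
      using g1(1) pos by (metis exp_less_cancel_iff exp_ln minus_less_iff)
    \<comment> \<open>The pair will be s = - \<sigma> and s' = - g1: \<sigma> is close enough to
      \<open>b0\<close> for exp (- \<sigma>) < g1, which makes exp s + s' negative.\<close>
    then obtain \<sigma> where \<sigma>: "max 0 (- ln g1) < \<sigma>" "\<sigma> < b0"
      using dense[of "max 0 (- ln g1)" b0] b0 by auto
    have "exp (- \<sigma>) < g1"
      using \<sigma>(1) pos by (metis exp_less_cancel_iff exp_ln max_less_iff_conj minus_less_iff)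
    then show False
      using adm[of "- \<sigma>" "(\<sigma> + b0) / 2" "- g1" "(g1 + g0) / 2"] \<sigma> g1 pos by simp
  qed
qed

text \<open>Cauchy-Schwarz turns the norm bounds into |s| < b0 \<le> 1 and |s'| < g0 \<le> exp (-
  b0) \<le> exp s.\<close>

lemma metric_chart_intro:
  fixes U :: "(real^'n) set"
  assumes "open U" "msmooth U a" "vsmooth U b" "vsmooth U \<gamma>"
    and A: "\<And>x. x \<in> U \<Longrightarrow> pos_def (a x)" and bounds: "largest_bounds b0 g0"
    and b: "\<And>x. x \<in> U \<Longrightarrow> covector_norm (a x) (b x) < b0"
    and g: "\<And>x. x \<in> U \<Longrightarrow> covector_norm (a x) (\<gamma> x) < g0"
  shows "metric_chart U a b \<gamma>"
proof
  fix x y :: "real^'n" assume x: "x \<in> U" and y: "y \<noteq> 0"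
  define \<alpha> where "\<alpha> = riemannian_length (a x) y"
  have \<alpha>: "\<alpha> > 0"
    using riemannian_length_pos[OF A[OF x] y] by (simp add: \<alpha>_def)
  have 1: "\<bar>b x \<bullet> y\<bar> < b0 * \<alpha>"
    using abs_form_le[OF A[OF x], of "b x" y] mult_strict_right_mono[OF b[OF x] \<alpha>] by (simp add: \<alpha>_def)
  have 2: "\<bar>\<gamma> x \<bullet> y\<bar> < g0 * \<alpha>"
    using abs_form_le[OF A[OF x], of "\<gamma> x" y] mult_strict_right_mono[OF g[OF x] \<alpha>] by (simp add: \<alpha>_def)
  note le = largest_bounds_le[OF bounds]
  show "\<bar>b x \<bullet> y\<bar> < riemannian_length (a x) y"
  proof -
    have "b0 * \<alpha> \<le> 1 * \<alpha>"
      using le(1) \<alpha> by (intro mult_right_mono) auto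
    then show ?thesis
      using 1 unfolding \<alpha>_def by linarith
  qed
  have "- b0 \<le> (b x \<bullet> y) / \<alpha>"
    using 1 \<alpha> by (simp add: pos_le_divide_eq abs_less_iff)
  then have "g0 \<le> exp ((b x \<bullet> y) / \<alpha>)"
    using le(2) by (meson exp_le_cancel_iff order_trans)
  then have "g0 * \<alpha> \<le> \<alpha> * exp ((b x \<bullet> y) / \<alpha>)"
    using \<alpha> by (simp add: mult.commute)
  then show "fun_val (a x) (b x) (\<gamma> x) y > 0"
    unfolding fun_val_def \<alpha>_def[symmetric] using 2 by linarith
qed (use assms in auto)

lemma exp_abc_metric_eq: "exp_abc_metric a b \<gamma> c x y = fun_val (a c x) (b c x) (\<gamma> c x) y"
  by (simp add: exp_abc_metric_def Let_def fun_val_def form_value_eq)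

lemma tangent_bundle_exp_abc_metric:
  assumes "riemannian_metric A a" "one_form A b" "one_form A \<gamma>"
  shows "tangent_bundle_function A (exp_abc_metric a b \<gamma>)"
  unfolding tangent_bundle_function_def
proof (intro ballI allI)
  fix c d x y assume c: "c \<in> A" "d \<in> A" "x \<in> overlap c d"
  define J where "J = jacobian c d x"
  have tr: "y \<bullet> (transpose J *v v) = (J *v y) \<bullet> v" for v
    by (metis dot_lmul_matrix inner_commute transpose_matrix_vector)
  have a: "a c x = transpose J ** a d (transition c d x) ** J"
    using assms(1) c unfolding riemannian_metric_def J_def by blast
  have f: "b c x = transpose J *v b d (transition c d x)" "\<gamma> c x = transpose J *v \<gamma> d (transition c d x)"
    using assms(2,3) c unfolding one_form_def J_def by blast+
  have 1: "riemannian_length (a c x) y = riemannian_length (a d (transition c d x)) (J *v y)"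
    unfolding riemannian_length_eq a by (simp only: matrix_vector_mul_assoc[symmetric] tr)
  have 2: "b c x \<bullet> y = b d (transition c d x) \<bullet> (J *v y)" "\<gamma> c x \<bullet> y = \<gamma> d (transition c d x) \<bullet> (J *v y)"
    unfolding f inner_commute[of _ y] tr by (simp_all add: inner_commute)
  show "exp_abc_metric a b \<gamma> c x y = exp_abc_metric a b \<gamma> d (transition c d x) (jacobian c d x *v y)"
    unfolding exp_abc_metric_eq fun_val_def 1 2 J_def ..
qed

section \<open>From the charts to the manifold\<close>

context metric_chart
begin

lemma smooth_F: "smooth_on (U \<times> (UNIV - {0})) (\<lambda>(x, y). F x y)"
proof -
  have o: "open (UNIV - {0 :: real^'n})"
    by (simp add: open_Diff)
  have 1: "msmooth (U \<times> (UNIV - {0 :: real^'n})) (\<lambda>z. a (fst z))"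
    using a_smooth by (auto simp: msmooth_def intro: smooth_on_fst[OF open_U o])
  have 2: "vsmooth (U \<times> (UNIV - {0 :: real^'n})) (\<lambda>z. b (fst z))" "vsmooth (U \<times> (UNIV - {0 :: real^'n})) (\<lambda>z. \<gamma> (fst z))"
    using b_smooth \<gamma>_smooth by (auto simp: vsmooth_def intro: smooth_on_fst[OF open_U o])
  have 3: "vsmooth (U \<times> (UNIV - {0 :: real^'n})) snd"
    unfolding vsmooth_def
    by (intro allI smooth_on_linear bounded_linear_compose[OF bounded_linear_vec_nth bounded_linear_snd])
  have "smooth_on (U \<times> (UNIV - {0})) (\<lambda>z. F (fst z) (snd z))"
    unfolding F_def
    by (intro smooth_on_fun_val 1 2 3 open_Times open_U o a_pos) auto
  then show ?thesis
    by (simp add: case_prod_beta')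
qed

lemma M_eq_0_iff: "M x = 0 \<longleftrightarrow> (\<forall>i j. covariant_deriv a b x i j = 0)"
  by (simp add: M_def vec_eq_iff)

end

theorem mainTheorem2:
  fixes A :: "('m::{t2_space, second_countable_topology}, 'n::finite) chart set"
    and a :: "('m, 'n) chart \<Rightarrow> real^'n \<Rightarrow> real^'n^'n"
    and b \<gamma> :: "('m, 'n) chart \<Rightarrow> real^'n \<Rightarrow> real^'n"
    and b0 g0 :: real
  assumes "CARD('n) \<ge> 2"
    and "smooth_atlas A"
    and "riemannian_metric A a"
    and "one_form A b"
    and "one_form A \<gamma>"
    and "largest_bounds b0 g0"
    and "\<forall>c\<in>A. \<forall>x\<in>cimage c. covector_norm (a c x) (b c x) < b0"
    and "\<forall>c\<in>A. \<forall>x\<in>cimage c. covector_norm (a c x) (\<gamma> c x) < g0"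
  shows "douglas_metric A (exp_abc_metric a b \<gamma>) \<longleftrightarrow> parallel_form A a b \<and> closed_form A \<gamma>"
proof -
  have chart: "metric_chart (cimage c) (a c) (b c) (\<gamma> c)" if c: "c \<in> A" for c
  proof (rule metric_chart_intro)
    show "open (cimage c)"
      using assms(2) c by (simp add: smooth_atlas_def)
    show "msmooth (cimage c) (a c)" "\<And>x. x \<in> cimage c \<Longrightarrow> pos_def (a c x)"
      using assms(3) c by (auto simp: riemannian_metric_def msmooth_def pos_def_def)
    show "vsmooth (cimage c) (b c)" "vsmooth (cimage c) (\<gamma> c)"
      using assms(4,5) c by (auto simp: one_form_def vsmooth_def)
  qed (use assms(6-8) c in auto)
  have F_eq: "exp_abc_metric a b \<gamma> c = metric_chart.F (a c) (b c) (\<gamma> c)" if "c \<in> A" for c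
    by (intro ext) (simp add: exp_abc_metric_eq metric_chart.F_def[OF chart[OF that]])
  \<comment> \<open>\<open>douglas_metric\<close> includes being a Finsler metric, which the
    converse direction must supply; it holds whether or not \<beta> is parallel and \<gamma>
    closed.\<close>
  have finsler: "finsler_metric A (exp_abc_metric a b \<gamma>)"
    unfolding finsler_metric_def
  proof (intro conjI ballI tangent_bundle_exp_abc_metric assms(3-5))
    fix c assume c: "c \<in> A"
    interpret metric_chart "cimage c" "a c" "b c" "\<gamma> c"
      by (rule chart[OF c])
    show "\<forall>y. exp_abc_metric a b \<gamma> c x y \<ge> 0" if x: "x \<in> cimage c" for x
    proof
      show "exp_abc_metric a b \<gamma> c x y \<ge> 0" for y
        using F_pos[OF x, of y] by (cases "y = 0") (auto simp: exp_abc_metric_eq fun_val_def riemannian_length_eq)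
    qed
    show "smooth_on (cimage c \<times> (UNIV - {0})) (\<lambda>(x, y). exp_abc_metric a b \<gamma> c x y)"
      unfolding F_eq[OF c] by (rule smooth_F)
    show "\<forall>y. \<forall>t>0. exp_abc_metric a b \<gamma> c x (t *\<^sub>R y) = t * exp_abc_metric a b \<gamma> c x y" for x
      by (simp add: F_eq[OF c] F_scale)
    show "\<forall>y. y \<noteq> 0 \<longrightarrow> (\<forall>v. v \<noteq> 0 \<longrightarrow> v \<bullet> (fundamental_tensor (exp_abc_metric a b \<gamma> c) x y *v v) > 0)"
      if "x \<in> cimage c" for x
      using fundamental_tensor_pos_def[OF that] by (simp add: F_eq[OF c] pos_def_def)
  qed
  show ?thesis
  proof
    assume D: "douglas_metric A (exp_abc_metric a b \<gamma>)"
    have "metric_chart.M (a c) (b c) x = 0 \<and> curl (\<gamma> c) x = 0"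
      if c: "c \<in> A" and x: "x \<in> cimage c" for c x
    proof -
      interpret metric_chart "cimage c" "a c" "b c" "\<gamma> c"
        by (rule chart[OF c])
      have "douglas_tensor F x y i j k l = 0" if "x \<in> cimage c" "y \<noteq> 0" for x y i j k l
      proof -
        have "douglas_tensor (exp_abc_metric a b \<gamma> c) x y i j k l = 0"
          using D c that by (simp add: douglas_metric_def)
        then show ?thesis
          by (simp add: F_eq[OF c])
      qed
      then show ?thesis
        using douglas_imp[OF assms(1) _ x] by blast
    qed
    then show "parallel_form A a b \<and> closed_form A \<gamma>"
      using metric_chart.M_eq_0_iff[OF chart] curl_eq_0_iff
      unfolding parallel_form_def closed_form_def by blast
  next
    assume P: "parallel_form A a b \<and> closed_form A \<gamma>"
    have "douglas_tensor (exp_abc_metric a b \<gamma> c) x y i j k l = 0"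
      if c: "c \<in> A" and x: "x \<in> cimage c" and y: "y \<noteq> 0" for c x y i j k l
    proof -
      interpret metric_chart "cimage c" "a c" "b c" "\<gamma> c"
        by (rule chart[OF c])
      show ?thesis
        unfolding F_eq[OF c]
        by (rule parallel_closed_imp[OF _ _ x y])
          (use P c in \<open>simp_all add: M_eq_0_iff curl_eq_0_iff parallel_form_def closed_form_def\<close>)
    qed
    then show "douglas_metric A (exp_abc_metric a b \<gamma>)"
      using finsler by (simp add: douglas_metric_def)
  qed
qed

end
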